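(* Let $\overline{\Gamma}=(\Gamma,f)$ be a connected integral $f$-graph. Then: (1) $\overline{\Gamma}$ generates a Dynkin scheme if and only if the $\rho$-degree $g_\rho(x)$ of every vertex $x$ of $\Gamma$ is less than $4$; (2) $\overline{\Gamma}$ generates an extended Dynkin scheme if and only if $\max_{x\in\Gamma_v} g_\rho(x)=4$.
   Context: $\mathbb N=\{1,2,\dots\}$, $\mathbb N^\infty=\mathbb N\cup\{\infty\}$. Put $\rho(n)=1+\frac{n-1}{n+1}=\frac{2n}{n+1}$ for $n\in\mathbb N$. Graphs $\Gamma$ are finite, with nonempty vertex set $\Gamma_v$ and edge set $\Gamma_e$; loops and parallel edges are allowed. $\varphi(\alpha)$ is the set of endpoints of an edge $\alpha$ (one element for a loop, two otherwise), and $\varphi^{-1}(x)=\{\alpha\in\Gamma_e: x\in\varphi(\alpha)\}$. The degree is $g(x)=|\varphi^{-1}(x)|$ (a loop counts once). $A_l$ ($l\ge1$) denotes the path graph with $l$ vertices; a graph is simple if it is isomorphic to some $A_l$. An edge $\alpha$ of a connected graph $\Gamma$ is cyclic if $\Gamma\setminus\alpha$ (same vertices, edge $\alpha$ deleted) is connected; otherwise, with $\varphi(\alpha)=\{x,y\}$, $\Gamma\setminus\alpha$ has two components $\Gamma'(x,\alpha)\ni x$ and $\Gamma'(y,\alpha)\ni y$. An integral $f$-graph $(\Gamma,f)$ is a graph $\Gamma$ with a function $f:\Gamma_e\to\mathbb N^\infty$. A pair $(x,\alpha)$ with $x\in\varphi(\alpha)$ is $f$-simple if $\alpha$ is not cyclic,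 and, with $\varphi(\alpha)=\{x,y\}$, $g(y)\le 2$, the graph $\Gamma'(y,\alpha)$ is simple, and $f(\beta)=1$ for all edges $\beta$ of $\Gamma'(y,\alpha)$ (no condition on $f(\alpha)$). For $x\in\varphi(\alpha)$ define $\frac{\partial x}{\partial\alpha}$ to be: $\rho(|\Gamma'(y,\alpha)_v|)$ if $(x,\alpha)$ is $f$-simple; $2$ if $\alpha$ is not a loop and $(x,\alpha)$ is not $f$-simple; $4$ if $\alpha$ is a loop. The $\rho$-degree of $x$ is $g_\rho(x)=\sum_{\alpha\in\varphi^{-1}(x)} f(\alpha)\frac{\partial x}{\partial\alpha}$ (equal to $\infty$ if some $f(\alpha)=\infty$ occurs). A Dynkin scheme (or extended one) is viewed as an $f$-graph in which the edges with $f(\alpha)\ne1$ additionally carry an arrow, $f(\alpha)$ being the multiplicity of the edge. An $f$-graph generates a (possibly extended) Dynkin scheme if some (equivalently any) choice of arrows on the edges with $f(\alpha)>1$ gives such a scheme. Explicitly (edges have $f=1$ unless stated; $T_{p,q,r}$ denotes the tree with a vertex whose removal leaves three paths with $p,q,r$ vertices, each joined to that vertex by an end): $(\Gamma,f)$ generates a Dynkin scheme iff it is isomorphic to one of: $A_l$ ($l\ge1$); $B_l$ ($l\ge2$): path with $l$ vertices, one end edge having $f=2$; $D_l=T_{1,1,l-3}$ ($l\ge4$); $E_6=T_{1,2,2}$; $E_7=T_{1,2,3}$; $E_8=T_{1,2,4}$; $F_4$: path with $4$ vertices with successive $f$-values $1,2,1$; $G_2$: one edge (two vertices) with $f=3$.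 $(\Gamma,f)$ generates an extended Dynkin scheme iff it is isomorphic to one of: $\widetilde A_{l-1}$ ($l\ge1$): cycle with $l$ vertices (one loop if $l=1$, two parallel edges if $l=2$); $\widetilde C_l$ ($l\ge2$): path with $l+1$ vertices, both end edges having $f=2$; $\widetilde D_l$ ($l\ge4$): path with $l-3$ vertices, with two additional leaves attached to each of its two ends (four leaves attached to the single vertex if $l=4$); $\widetilde B_l$ ($l\ge3$): path $a_1,\dots,a_{l-1}$ with $f=2$ on the edge $a_{l-2}a_{l-1}$ and two additional leaves attached to $a_1$; $\widetilde G_2$: path with $3$ vertices and $f$-values $1,3$; $\widetilde E_6=T_{2,2,2}$; $\widetilde E_7=T_{1,3,3}$; $\widetilde E_8=T_{1,2,5}$; $\widetilde F_4$: path with $5$ vertices and $f$-values $1,1,2,1$; $BA_2$: one edge with $f=4$. *)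

theory Defs
  imports "HOL-Library.Extended_Real"
begin

section \<open>Finite graphs with loops and parallel edges\<close>

record ('v, 'e) graph =
  verts :: "'v set"
  edges :: "'e set"
  ends :: "'e \<Rightarrow> 'v set"

definition finite_graph :: "('v, 'e) graph \<Rightarrow> bool" where
  "finite_graph G \<longleftrightarrow>
     finite (verts G) \<and> verts G \<noteq> {} \<and> finite (edges G) \<and>
     (\<forall>\<alpha>\<in>edges G. ends G \<alpha> \<subseteq> verts G \<and> card (ends G \<alpha>) \<in> {1, 2})"

definition is_loop :: "('v, 'e) graph \<Rightarrow> 'e \<Rightarrow> bool" where
  "is_loop G \<alpha> \<longleftrightarrow> card (ends G \<alpha>) = 1"

definition incident :: "('v, 'e) graph \<Rightarrow> 'v \<Rightarrow> 'e set" where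
  "incident G x = {\<alpha> \<in> edges G. x \<in> ends G \<alpha>}"

text \<open>A loop contributes one to the degree, not two.\<close>

definition degree :: "('v, 'e) graph \<Rightarrow> 'v \<Rightarrow> nat" where
  "degree G x = card (incident G x)"

definition adj :: "('v, 'e) graph \<Rightarrow> ('v \<times> 'v) set" where
  "adj G = {(x, y). \<exists>\<alpha>\<in>edges G. ends G \<alpha> = {x, y}}"

definition connected_graph :: "('v, 'e) graph \<Rightarrow> bool" where
  "connected_graph G \<longleftrightarrow> verts G \<noteq> {} \<and> (\<forall>x\<in>verts G. \<forall>y\<in>verts G. (x, y) \<in> (adj G)\<^sup>*)"

definition del_edge :: "('v, 'e) graph \<Rightarrow> 'e \<Rightarrow> ('v, 'e) graph" where
  "del_edge G \<alpha> = G\<lparr>edges := edges G - {\<alpha>}\<rparr>"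

definition component :: "('v, 'e) graph \<Rightarrow> 'v \<Rightarrow> ('v, 'e) graph" where
  "component G x =
     (let V = {y \<in> verts G. (x, y) \<in> (adj G)\<^sup>*}
      in G\<lparr>verts := V, edges := {\<alpha> \<in> edges G. ends G \<alpha> \<subseteq> V}\<rparr>)"

definition cyclic_edge :: "('v, 'e) graph \<Rightarrow> 'e \<Rightarrow> bool" where
  "cyclic_edge G \<alpha> \<longleftrightarrow> connected_graph (del_edge G \<alpha>)"

text \<open>The component \<open>\<Gamma>'(y, \<alpha>)\<close> of \<open>\<Gamma> \<setminus> \<alpha>\<close>.\<close>

definition branch :: "('v, 'e) graph \<Rightarrow> 'v \<Rightarrow> 'e \<Rightarrow> ('v, 'e) graph" where
  "branch G y \<alpha> = component (del_edge G \<alpha>) y"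

text \<open>Only meaningful for an edge \<open>\<alpha>\<close> having \<open>x\<close> as an endpoint; it returns \<open>x\<close> itself for a loop.\<close>

definition other_end :: "('v, 'e) graph \<Rightarrow> 'v \<Rightarrow> 'e \<Rightarrow> 'v" where
  "other_end G x \<alpha> = (THE y. ends G \<alpha> = {x, y})"

definition is_iso ::
  "('v \<Rightarrow> 'w) \<Rightarrow> ('e \<Rightarrow> 'd) \<Rightarrow> ('v, 'e) graph \<Rightarrow> ('w, 'd) graph \<Rightarrow> bool" where
  "is_iso \<phi> \<psi> G H \<longleftrightarrow>
     bij_betw \<phi> (verts G) (verts H) \<and> bij_betw \<psi> (edges G) (edges H) \<and>
     (\<forall>\<alpha>\<in>edges G. ends H (\<psi> \<alpha>) = \<phi> ` ends G \<alpha>)"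

definition graph_iso :: "('v, 'e) graph \<Rightarrow> ('w, 'd) graph \<Rightarrow> bool" where
  "graph_iso G H \<longleftrightarrow> (\<exists>\<phi> \<psi>. is_iso \<phi> \<psi> G H)"

definition path_graph :: "nat \<Rightarrow> (nat, nat) graph" where
  "path_graph l = \<lparr>verts = {1..l}, edges = {1..<l}, ends = (\<lambda>i. {i, i + 1})\<rparr>"

text \<open>Here \<open>simple\<close> means being a path, not the absence of loops and parallel edges.\<close>

definition simple_graph :: "('v, 'e) graph \<Rightarrow> bool" where
  "simple_graph G \<longleftrightarrow> (\<exists>l\<ge>1. graph_iso G (path_graph l))"


section \<open>Integral f-graphs and the rho-degree\<close>

text \<open>An f-graph is a graph \<open>G\<close> together with a function \<open>f\<close> on its edges; values of \<open>f\<close>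
  outside \<open>edges G\<close> are irrelevant.\<close>

definition integral_f_graph :: "('v, 'e) graph \<Rightarrow> ('e \<Rightarrow> enat) \<Rightarrow> bool" where
  "integral_f_graph G f \<longleftrightarrow> finite_graph G \<and> (\<forall>\<alpha>\<in>edges G. 1 \<le> f \<alpha>)"

definition f_iso ::
  "('v, 'e) graph \<Rightarrow> ('e \<Rightarrow> enat) \<Rightarrow> ('w, 'd) graph \<Rightarrow> ('d \<Rightarrow> enat) \<Rightarrow> bool" where
  "f_iso G f H h \<longleftrightarrow> (\<exists>\<phi> \<psi>. is_iso \<phi> \<psi> G H \<and> (\<forall>\<alpha>\<in>edges G. h (\<psi> \<alpha>) = f \<alpha>))"

definition rho :: "nat \<Rightarrow> real" where
  "rho n = 1 + (real n - 1) / (real n + 1)"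

definition f_simple :: "('v, 'e) graph \<Rightarrow> ('e \<Rightarrow> enat) \<Rightarrow> 'v \<Rightarrow> 'e \<Rightarrow> bool" where
  "f_simple G f x \<alpha> \<longleftrightarrow>
     \<not> cyclic_edge G \<alpha> \<and>
     (let y = other_end G x \<alpha> in
        degree G y \<le> 2 \<and> simple_graph (branch G y \<alpha>) \<and>
        (\<forall>\<beta>\<in>edges (branch G y \<alpha>). f \<beta> = 1))"

text \<open>The quantity \<open>\<partial>x/\<partial>\<alpha>\<close>, for an edge \<open>\<alpha>\<close> having \<open>x\<close> as an endpoint. In a connected graph
  loops are cyclic, so the first and last cases exclude each other.\<close>

definition edge_deriv :: "('v, 'e) graph \<Rightarrow> ('e \<Rightarrow> enat) \<Rightarrow> 'v \<Rightarrow> 'e \<Rightarrow> real" where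
  "edge_deriv G f x \<alpha> =
     (if f_simple G f x \<alpha> then rho (card (verts (branch G (other_end G x \<alpha>) \<alpha>)))
      else if \<not> is_loop G \<alpha> then 2
      else 4)"

definition rho_degree :: "('v, 'e) graph \<Rightarrow> ('e \<Rightarrow> enat) \<Rightarrow> 'v \<Rightarrow> ereal" where
  "rho_degree G f x =
     (\<Sum>\<alpha>\<in>incident G x. ereal_of_enat (f \<alpha>) * ereal (edge_deriv G f x \<alpha>))"


section \<open>Dynkin schemes and extended Dynkin schemes\<close>

definition cycle_graph :: "nat \<Rightarrow> (nat, nat) graph" where
  "cycle_graph l =
     \<lparr>verts = {1..l}, edges = {1..l}, ends = (\<lambda>i. {i, if i = l then 1 else i + 1})\<rparr>"

text \<open>The tree \<open>T\<^bsub>p,q,r\<^esub>\<close>: the centre is \<open>(0, 0)\<close>, and \<open>(i, j)\<close> is the vertex at distance \<open>j\<close>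
  from it on the \<open>i\<close>-th arm. An edge carries the name of its endpoint farther from the centre.\<close>

definition tripod :: "nat \<Rightarrow> nat \<Rightarrow> nat \<Rightarrow> (nat \<times> nat, nat \<times> nat) graph" where
  "tripod p q r =
     (let arms = {1} \<times> {1..p} \<union> {2} \<times> {1..q} \<union> {3} \<times> {1..r}
      in \<lparr>verts = insert (0, 0) arms, edges = arms,
          ends = (\<lambda>(i, j). {(i, j), if j = 1 then (0, 0) else (i, j - 1)})\<rparr>)"

text \<open>Attach to \<open>x\<close> a new leaf \<open>n\<close> by a new edge, also named \<open>n\<close>.\<close>

definition add_leaf :: "'a \<Rightarrow> 'a \<Rightarrow> ('a, 'a) graph \<Rightarrow> ('a, 'a) graph" where
  "add_leaf n x G =
     \<lparr>verts = insert n (verts G), edges = insert n (edges G), ends = (ends G)(n := {x, n})\<rparr>"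

definition fork_graph :: "nat \<Rightarrow> (nat, nat) graph" where
  "fork_graph m = add_leaf (m + 2) 1 (add_leaf (m + 1) 1 (path_graph m))"

definition double_fork_graph :: "nat \<Rightarrow> (nat, nat) graph" where
  "double_fork_graph m = add_leaf (m + 4) m (add_leaf (m + 3) m (fork_graph m))"

abbreviation unit_weight :: "'e \<Rightarrow> enat" where
  "unit_weight \<equiv> (\<lambda>_. 1)"

text \<open>Dynkin schemes are taken without the arrows on their multiple edges: whether an f-graph
  generates a scheme does not depend on the choice of arrows. The disjuncts are, in order,
  \<open>A\<^sub>l\<close>, \<open>B\<^sub>l\<close>, \<open>D\<^sub>l\<close>, \<open>E\<^sub>6\<close>, \<open>E\<^sub>7\<close>, \<open>E\<^sub>8\<close>, \<open>F\<^sub>4\<close>, \<open>G\<^sub>2\<close> (so \<open>B\<^sub>l\<close> also stands for \<open>C\<^sub>l\<close>).\<close>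

definition generates_dynkin :: "('v, 'e) graph \<Rightarrow> ('e \<Rightarrow> enat) \<Rightarrow> bool" where
  "generates_dynkin G f \<longleftrightarrow>
     (\<exists>l\<ge>1. f_iso G f (path_graph l) unit_weight) \<or>
     (\<exists>l\<ge>2. f_iso G f (path_graph l) (unit_weight(1 := 2))) \<or>
     (\<exists>l\<ge>4. f_iso G f (tripod 1 1 (l - 3)) unit_weight) \<or>
     f_iso G f (tripod 1 2 2) unit_weight \<or>
     f_iso G f (tripod 1 2 3) unit_weight \<or>
     f_iso G f (tripod 1 2 4) unit_weight \<or>
     f_iso G f (path_graph 4) (unit_weight(2 := 2)) \<or>
     f_iso G f (path_graph 2) (unit_weight(1 := 3))"

text \<open>The disjuncts are, in order, the extended versions of
  \<open>A\<^bsub>l-1\<^esub>\<close>, \<open>C\<^sub>l\<close>, \<open>D\<^sub>l\<close>, \<open>B\<^sub>l\<close>, \<open>G\<^sub>2\<close>, \<open>E\<^sub>6\<close>, \<open>E\<^sub>7\<close>, \<open>E\<^sub>8\<close>, \<open>F\<^sub>4\<close>, followed by \<open>BA\<^sub>2\<close>.\<close>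

definition generates_extended_dynkin :: "('v, 'e) graph \<Rightarrow> ('e \<Rightarrow> enat) \<Rightarrow> bool" where
  "generates_extended_dynkin G f \<longleftrightarrow>
     (\<exists>l\<ge>1. f_iso G f (cycle_graph l) unit_weight) \<or>
     (\<exists>l\<ge>2. f_iso G f (path_graph (l + 1)) (unit_weight(1 := 2, l := 2))) \<or>
     (\<exists>l\<ge>4. f_iso G f (double_fork_graph (l - 3)) unit_weight) \<or>
     (\<exists>l\<ge>3. f_iso G f (fork_graph (l - 1)) (unit_weight(l - 2 := 2))) \<or>
     f_iso G f (path_graph 3) (unit_weight(2 := 3)) \<or>
     f_iso G f (tripod 2 2 2) unit_weight \<or>
     f_iso G f (tripod 1 3 3) unit_weight \<or>
     f_iso G f (tripod 1 2 5) unit_weight \<or>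
     f_iso G f (path_graph 5) (unit_weight(3 := 2)) \<or>
     f_iso G f (path_graph 2) (unit_weight(1 := 4))"

end

theory Submission imports Defs
begin

text \<open>A pair \<open>(x, \<alpha>)\<close> is f-simple iff the edge \<open>\<alpha>\<close> enters, at its other end, an arm: a walk through
  vertices of degree two along edges of weight one that stops at a leaf. This is a condition on
  incidence sets only, and it turns the \<open>\<rho>\<close>-degree into a local sum of terms \<open>f \<alpha> * \<rho> n\<close> (an arm with
  \<open>n\<close> vertices), \<open>2 * f \<alpha>\<close> (no arm) and \<open>4 * f \<alpha>\<close> (a loop). Evaluating these sums on the diagrams gives one
  direction of both equivalences. Conversely it suffices to show that a graph with all degrees at
  most \<open>4\<close> is one of the diagrams. Every contribution is at least \<open>1\<close>, and at least \<open>2\<close> unless it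
  belongs to an arm with \<open>f \<alpha> = 1\<close>. A loop or a cyclic edge therefore exhausts the bound along the
  whole graph, which is a cycle. In a tree a vertex of degree four carries four leaves; a vertex of
  degree three carries either three arms with \<open>1/(p+1) + 1/(q+1) + 1/(r+1) \<ge> 1\<close> or two leaves and a
  walk that must end in a second fork or in a double edge; and on a path the bounds leave room for
  at most two multiple edges, in few positions.\<close>

section \<open>Cuts, branches and arms\<close>

text \<open>The constant \<open>rho n\<close> is twice n/(n+1), the corner entry of the inverse
  Cartan matrix of \<open>A_n\<close>: eliminating an arm of n vertices joined by a simple edge
  lowers the diagonal entry 2 at its root by n/(n+1). At a vertex from which only simple arms leave,
  degree below 4 thus means that a positive diagonal entry survives, and degree 4 that it vanishes.
  Two obstacles shape the proof. f-simplicity speaks of components after deleting an edge and of an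
  abstract isomorphism with a path, so it is first exchanged for arms, which isomorphisms visibly
  preserve. And a walk found in an abstract graph has to be identified with a model diagram: instead
  of tracking which vertices were visited, the walk is read as a map from the model that is
  bijective on the edges around each vertex. Such a map is a covering, and the relation |V| = |E| +
  1 of a tree leaves room for one sheet only.\<close>

lemma ends_cases:
  assumes "finite_graph G" "\<alpha> \<in> edges G"
  obtains x y where "ends G \<alpha> = {x, y}" "x \<in> verts G" "y \<in> verts G"
proof -
  from assms have "card (ends G \<alpha>) = 1 \<or> card (ends G \<alpha>) = 2" and s: "ends G \<alpha> \<subseteq> verts G"
    by (auto simp: finite_graph_def)
  then obtain x y where "ends G \<alpha> = {x, y}"
    by (metis card_1_singletonE card_2_iff insert_absorb2)
  with s that show thesis by auto
qed

lemma incident_iff: "\<alpha> \<in> incident G x \<longleftrightarrow> \<alpha> \<in> edges G \<and> x \<in> ends G \<alpha>"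
  by (simp add: incident_def)

lemma finite_incident: "finite_graph G \<Longrightarrow> finite (incident G x)"
  by (simp add: finite_graph_def incident_def)

lemma del_edge_simps [simp]:
  "verts (del_edge G \<alpha>) = verts G" "edges (del_edge G \<alpha>) = edges G - {\<alpha>}"
  "ends (del_edge G \<alpha>) = ends G" "incident (del_edge G \<alpha>) x = incident G x - {\<alpha>}"
  by (auto simp: del_edge_def incident_def)

lemma finite_graph_del_edge: "finite_graph G \<Longrightarrow> finite_graph (del_edge G \<alpha>)"
  by (auto simp: finite_graph_def)

text \<open>Reachability is handled through sets that no edge leaves: in a connected graph such a
  set contains all vertices once it contains one, and bounding a branch takes only one explicit
  closed set.\<close>

definition cut_closed :: "('v, 'e) graph \<Rightarrow> 'v set \<Rightarrow> bool" where
  "cut_closed G S \<longleftrightarrow> (\<forall>e\<in>edges G. ends G e \<inter> S \<noteq> {} \<longrightarrow> ends G e \<subseteq> S)"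

lemma cut_closed_rtrancl:
  assumes "cut_closed G S" "x \<in> S" "(x, y) \<in> (adj G)\<^sup>*"
  shows "y \<in> S"
  using assms(3,2)
proof (induction rule: rtrancl_induct)
  case (step y z)
  then obtain e where "e \<in> edges G" "ends G e = {y, z}" "y \<in> S" by (auto simp: adj_def)
  with assms(1) show ?case by (auto simp: cut_closed_def)
qed

lemma cut_closed_reachable:
  assumes "finite_graph G"
  shows "cut_closed G {y \<in> verts G. (x, y) \<in> (adj G)\<^sup>*}"
  unfolding cut_closed_def
proof (intro ballI impI)
  fix e assume e: "e \<in> edges G" and i: "ends G e \<inter> {y \<in> verts G. (x, y) \<in> (adj G)\<^sup>*} \<noteq> {}"
  obtain a b where ab: "ends G e = {a, b}" "a \<in> verts G" "b \<in> verts G"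
    using ends_cases[OF assms e] by metis
  then have "(a, b) \<in> adj G" "(b, a) \<in> adj G" using e by (auto simp: adj_def insert_commute)
  with ab i show "ends G e \<subseteq> {y \<in> verts G. (x, y) \<in> (adj G)\<^sup>*}"
    by (auto intro: rtrancl_into_rtrancl)
qed

lemma connected_graphI:
  assumes "finite_graph G"
    and "\<And>S. S \<subseteq> verts G \<Longrightarrow> S \<noteq> {} \<Longrightarrow> cut_closed G S \<Longrightarrow> S = verts G"
  shows "connected_graph G"
  unfolding connected_graph_def
proof (intro conjI ballI)
  show "verts G \<noteq> {}" using assms(1) by (simp add: finite_graph_def)
  fix x y assume "x \<in> verts G" "y \<in> verts G"
  with assms(2)[OF _ _ cut_closed_reachable[OF assms(1), of x]] show "(x, y) \<in> (adj G)\<^sup>*"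
    by blast
qed

lemma connected_graphD:
  assumes "connected_graph G" "cut_closed G S" "x \<in> S" "x \<in> verts G" "y \<in> verts G"
  shows "y \<in> S"
  using assms cut_closed_rtrancl by (fastforce simp: connected_graph_def)

lemma branch_simps:
  "verts (branch G y \<alpha>) = {v \<in> verts G. (y, v) \<in> (adj (del_edge G \<alpha>))\<^sup>*}"
  "edges (branch G y \<alpha>) = {e \<in> edges G - {\<alpha>}. ends G e \<subseteq> verts (branch G y \<alpha>)}"
  "ends (branch G y \<alpha>) = ends G"
  by (simp_all add: branch_def component_def Let_def del_edge_def)

lemma cut_closed_branch:
  "finite_graph G \<Longrightarrow> cut_closed (del_edge G \<alpha>) (verts (branch G y \<alpha>))"
  using cut_closed_reachable[OF finite_graph_del_edge, of G \<alpha> y] by (simp add: branch_simps)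

lemma branch_self: "y \<in> verts G \<Longrightarrow> y \<in> verts (branch G y \<alpha>)"
  by (simp add: branch_simps)

lemma finite_branch: "finite_graph G \<Longrightarrow> finite (verts (branch G y \<alpha>))"
  by (simp add: branch_simps finite_graph_def)

lemma branch_subset:
  assumes "cut_closed (del_edge G \<alpha>) S" "y \<in> S"
  shows "verts (branch G y \<alpha>) \<subseteq> S"
  using cut_closed_rtrancl[OF assms] by (auto simp: branch_simps)

lemma other_end_eq: "ends G \<alpha> = {x, y} \<Longrightarrow> other_end G x \<alpha> = y"
  unfolding other_end_def by (rule the_equality) (auto simp: doubleton_eq_iff)

text \<open>If \<open>x\<close> is still reachable from \<open>y\<close> without
  \<open>\<alpha>\<close>, a set closed after the deletion contains both ends of
  \<open>\<alpha>\<close> or neither, so it is already closed in \<open>G\<close> and connectedness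
  of \<open>G\<close> applies. For a loop both sides are false.\<close>

lemma noncyclic_iff:
  assumes "finite_graph G" "connected_graph G" "\<alpha> \<in> edges G" "ends G \<alpha> = {x, y}"
  shows "\<not> cyclic_edge G \<alpha> \<longleftrightarrow> x \<notin> verts (branch G y \<alpha>)"
proof
  assume "\<not> cyclic_edge G \<alpha>"
  show "x \<notin> verts (branch G y \<alpha>)"
  proof
    assume x: "x \<in> verts (branch G y \<alpha>)"
    have v: "x \<in> verts G" "y \<in> verts G" using assms by (auto simp: finite_graph_def)
    have "connected_graph (del_edge G \<alpha>)"
    proof (rule connected_graphI[OF finite_graph_del_edge[OF assms(1)]])
      fix S assume S: "S \<subseteq> verts (del_edge G \<alpha>)" "S \<noteq> {}" "cut_closed (del_edge G \<alpha>) S"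
      \<comment> \<open>Reachability from \<open>y\<close> only shows that \<open>y\<close> in
        \<open>S\<close> forces \<open>x\<close> in \<open>S\<close>; the complement supplies the
        converse.\<close>
      have "cut_closed (del_edge G \<alpha>) (verts G - S)"
        using S(3) assms(1) unfolding cut_closed_def finite_graph_def by fastforce
      then have "x \<in> S" if "y \<in> S" "y \<in> verts G" using branch_subset[OF S(3)] x that by blast
      moreover have "x \<notin> S" if "y \<notin> S"
        using branch_subset[OF \<open>cut_closed (del_edge G \<alpha>) (verts G - S)\<close>, of y] x v that by blast
      ultimately have "ends G \<alpha> \<inter> S \<noteq> {} \<Longrightarrow> ends G \<alpha> \<subseteq> S" using assms(4) v by auto
      then have "cut_closed G S"
        using S(3) unfolding cut_closed_def del_edge_simps by blast
      moreover obtain s where "s \<in> S" "s \<in> verts G" using S by auto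
      ultimately show "S = verts (del_edge G \<alpha>)"
        using connected_graphD[OF assms(2)] S(1) by auto
    qed
    then show False using \<open>\<not> cyclic_edge G \<alpha>\<close> by (simp add: cyclic_edge_def)
  qed
next
  assume "x \<notin> verts (branch G y \<alpha>)"
  then show "\<not> cyclic_edge G \<alpha>"
    using assms unfolding cyclic_edge_def connected_graph_def branch_simps finite_graph_def by auto
qed

text \<open>A chain entered through \<open>\<alpha>\<close> at \<open>y\<close> runs through vertices of degree two along edges of
  weight one until \<open>T\<close> holds of the current edge and vertex; \<open>n\<close> counts its vertices.\<close>

inductive chain ::
  "('v, 'e) graph \<Rightarrow> ('e \<Rightarrow> enat) \<Rightarrow> ('e \<Rightarrow> 'v \<Rightarrow> bool) \<Rightarrow> 'e \<Rightarrow> 'v \<Rightarrow> nat \<Rightarrow> bool"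
  for G f T where
  stop: "T \<alpha> y \<Longrightarrow> chain G f T \<alpha> y 1"
| step: "incident G y = {\<alpha>, \<beta>} \<Longrightarrow> \<alpha> \<noteq> \<beta> \<Longrightarrow> ends G \<beta> = {y, z} \<Longrightarrow> y \<noteq> z \<Longrightarrow> f \<beta> = 1 \<Longrightarrow>
    chain G f T \<beta> z n \<Longrightarrow> chain G f T \<alpha> y (Suc n)"

text \<open>The stopping test for arms. \<open>chain\<close> leaves the test open because stems of
  forks are walks of the same kind that stop at another configuration.\<close>

definition leaf_edge :: "('v, 'e) graph \<Rightarrow> 'e \<Rightarrow> 'v \<Rightarrow> bool" where
  "leaf_edge G \<alpha> y \<longleftrightarrow> incident G y = {\<alpha>}"

text \<open>As in f-simplicity, the weight of the entering edge stays unrestricted: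
  \<open>chain.step\<close> asks weight one of the next edge only.\<close>

abbreviation arm :: "('v, 'e) graph \<Rightarrow> ('e \<Rightarrow> enat) \<Rightarrow> 'e \<Rightarrow> 'v \<Rightarrow> nat \<Rightarrow> bool" where
  "arm G f \<equiv> chain G f (leaf_edge G)"

lemma chain_pos: "chain G f T \<alpha> y n \<Longrightarrow> n \<ge> 1"
  by (induction rule: chain.induct) auto

text \<open>At a vertex of degree two the continuation is forced, and a leaf offers none.\<close>

lemma arm_unique:
  assumes "arm G f \<alpha> y n" "arm G f \<alpha> y m"
  shows "n = m"
  using assms
proof (induction arbitrary: m rule: chain.induct)
  case (stop \<alpha> y)
  from stop(2,1) show ?case
    by (cases rule: chain.cases) (auto simp: leaf_edge_def doubleton_eq_iff)
next
  case (step y \<alpha> \<beta> z n)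
  from step.prems show ?case
  proof (cases rule: chain.cases)
    case stop
    then show ?thesis using step.hyps by (auto simp: leaf_edge_def doubleton_eq_iff)
  next
    case (step \<beta>' z' n')
    with step.hyps have "\<beta>' = \<beta>" "z' = z" by (auto simp: doubleton_eq_iff)
    with step step.IH show ?thesis by auto
  qed
qed

text \<open>Indexing used throughout: \<open>u 0\<close> lies before the entrance,
  \<open>u 1\<close> to \<open>u n\<close> are the counted vertices, and \<open>e i\<close> joins
  \<open>u i\<close> to \<open>u (Suc i)\<close>. Vertices might still repeat here; excluding this
  needs information on where the walk stops.\<close>

lemma chain_seq:
  assumes "chain G f T \<alpha> y n" "ends G \<alpha> = {x, y}" "x \<noteq> y"
  obtains u e where "e 0 = \<alpha>" "u 0 = x" "u 1 = y"
    "\<And>i. i < n \<Longrightarrow> ends G (e i) = {u i, u (Suc i)}"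
    "\<And>i. i < n \<Longrightarrow> u i \<noteq> u (Suc i)"
    "\<And>i. 0 < i \<Longrightarrow> i < n \<Longrightarrow> incident G (u i) = {e (i - 1), e i}"
    "\<And>i. 0 < i \<Longrightarrow> i < n \<Longrightarrow> e (i - 1) \<noteq> e i"
    "\<And>i. 0 < i \<Longrightarrow> i < n \<Longrightarrow> f (e i) = 1"
    "T (e (n - 1)) (u n)"
proof -
  have "\<exists>u e. e 0 = \<alpha> \<and> u 0 = x \<and> u 1 = y \<and>
    (\<forall>i<n. ends G (e i) = {u i, u (Suc i)} \<and> u i \<noteq> u (Suc i)) \<and>
    (\<forall>i. 0 < i \<longrightarrow> i < n \<longrightarrow> incident G (u i) = {e (i - 1), e i} \<and> e (i - 1) \<noteq> e i \<and> f (e i) = 1) \<and>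
    T (e (n - 1)) (u n)"
    using assms
  proof (induction arbitrary: x rule: chain.induct)
    case (stop \<alpha> y)
    then show ?case by (intro exI[of _ "\<lambda>i. if i = 0 then x else y"] exI[of _ "\<lambda>_. \<alpha>"]) auto
  next
    case (step y \<alpha> \<beta> z n)
    obtain u e where ue: "e 0 = \<beta>" "u 0 = y" "u 1 = z"
      "\<forall>i<n. ends G (e i) = {u i, u (Suc i)} \<and> u i \<noteq> u (Suc i)"
      "\<forall>i. 0 < i \<longrightarrow> i < n \<longrightarrow> incident G (u i) = {e (i - 1), e i} \<and> e (i - 1) \<noteq> e i \<and> f (e i) = 1"
      "T (e (n - 1)) (u n)"
      using step.IH[OF step.hyps(3,4)] by blast
    have n: "n \<ge> 1" using chain_pos[OF step.hyps(6)] .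
    define u' where "u' = case_nat x u"
    define e' where "e' = case_nat \<alpha> e"
    have "ends G (e' i) = {u' i, u' (Suc i)} \<and> u' i \<noteq> u' (Suc i)" if "i < Suc n" for i
      using that ue(2,4) step.prems by (cases i) (auto simp: u'_def e'_def)
    moreover have "incident G (u' i) = {e' (i - 1), e' i} \<and> e' (i - 1) \<noteq> e' i \<and> f (e' i) = 1"
      if i: "0 < i" "i < Suc n" for i
    proof -
      obtain j where j: "i = Suc j" using i by (cases i) auto
      show ?thesis
      proof (cases j)
        case 0
        then show ?thesis using j ue(1,2) step.hyps by (simp add: u'_def e'_def)
      next
        case (Suc k)
        then show ?thesis using j i ue(5)[rule_format, of j] by (simp add: u'_def e'_def)
      qed
    qed
    moreover have "T (e' (Suc n - 1)) (u' (Suc n))"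
      using ue(6) n by (cases n) (auto simp: u'_def e'_def)
    ultimately show ?case using ue(2)
      by (intro exI[of _ u'] exI[of _ e']) (auto simp: u'_def e'_def)
  qed
  then obtain u e where ue: "e 0 = \<alpha>" "u 0 = x" "u 1 = y"
    "\<forall>i<n. ends G (e i) = {u i, u (Suc i)} \<and> u i \<noteq> u (Suc i)"
    "\<forall>i. 0 < i \<longrightarrow> i < n \<longrightarrow> incident G (u i) = {e (i - 1), e i} \<and> e (i - 1) \<noteq> e i \<and> f (e i) = 1"
    "T (e (n - 1)) (u n)"
    by (elim exE conjE)
  show thesis by (rule that[where u = u and e = e]) (use ue in auto)
qed

text \<open>The dead end at \<open>u n\<close> is what prevents the walk from running around a
  cycle. Peel off the first edge: the rest is injective by induction, and its vertices meet only
  edges of the rest, apart from \<open>e 0\<close> at \<open>u 1\<close>, so neither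
  \<open>e 0\<close> nor \<open>u 0\<close> can come back.\<close>

lemma pendant_walk_inj:
  assumes "n \<ge> 1" "e 0 \<in> edges G"
    and "\<And>i. i < n \<Longrightarrow> ends G (e i) = {u i, u (Suc i)}"
    and "\<And>i. i < n \<Longrightarrow> u i \<noteq> u (Suc i)"
    and "\<And>i. 0 < i \<Longrightarrow> i < n \<Longrightarrow> incident G (u i) = {e (i - 1), e i}"
    and "\<And>i. 0 < i \<Longrightarrow> i < n \<Longrightarrow> e (i - 1) \<noteq> e i"
    and "incident G (u n) = {e (n - 1)}"
  shows "inj_on u {..n} \<and> inj_on e {..<n}"
  using assms
proof (induction n arbitrary: u e rule: nat_induct_at_least)
  case base
  from base.prems(3)[of 0] show ?case by (auto simp: inj_on_def le_Suc_eq)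
next
  case (Suc n u e)
  let ?u = "\<lambda>i. u (Suc i)" and ?e = "\<lambda>i. e (Suc i)"
  have inc1: "incident G (u 1) = {e 0, e 1}" "e 0 \<noteq> e 1"
    using Suc.prems(4,5)[of 1] Suc.hyps by auto
  have IH: "inj_on ?u {..n} \<and> inj_on ?e {..<n}"
  proof (rule Suc.IH)
    show "e (Suc 0) \<in> edges G" using inc1 by (auto simp: incident_def)
    show "incident G (u (Suc i)) = {e (Suc (i - 1)), e (Suc i)}" if "0 < i" "i < n" for i
      using Suc.prems(4)[of "Suc i"] that by simp
    show "e (Suc (i - 1)) \<noteq> e (Suc i)" if "0 < i" "i < n" for i
      using Suc.prems(5)[of "Suc i"] that by simp
    show "incident G (u (Suc n)) = {e (Suc (n - 1))}"
      using Suc.prems(6) Suc.hyps by simp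
  qed (use Suc.prems in auto)
  have e0: "ends G (e 0) = {u 0, u 1}" "u 0 \<noteq> u 1" using Suc.prems(2,3)[of 0] by auto
  \<comment> \<open>A return of \<open>e 0\<close> would make \<open>u 1\<close> an end of a later
    edge, which by injectivity of the rest can only be \<open>e 1\<close>.\<close>
  have e_new: "e 0 \<noteq> ?e j" if "j < n" for j
  proof
    assume eq: "e 0 = ?e j"
    then have "u 1 \<in> {?u j, ?u (Suc j)}" using Suc.prems(2)[of "Suc j"] that e0 by auto
    then have "j = 0"
      using IH[THEN conjunct1, THEN inj_onD, of 0 j] IH[THEN conjunct1, THEN inj_onD, of 0 "Suc j"] that
      by auto
    with eq inc1 show False by simp
  qed
  \<comment> \<open>If \<open>u 0\<close> recurred, its edge \<open>e 0\<close> would lie in the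
    incidence set of a later vertex, which consists of later edges.\<close>
  have u_new: "u 0 \<noteq> ?u j" if "j \<le> n" for j
  proof
    assume eq: "u 0 = ?u j"
    with e0 have j: "j > 0" by (cases j) auto
    have "e 0 \<in> incident G (?u j)" using Suc.prems(1) e0(1) eq by (simp add: incident_def)
    moreover have "incident G (?u j) \<subseteq> ?e ` {..<n}"
    proof (cases "j = n")
      case True
      then show ?thesis using Suc.prems(6) j by (cases n) auto
    next
      case False
      then show ?thesis using Suc.prems(4)[of "Suc j"] j that by (cases j) auto
    qed
    ultimately show False using e_new by auto
  qed
  show ?case
  proof
    show "inj_on u {..Suc n}"
      unfolding lessThan_Suc_eq_insert_0 atMost_Suc_eq_insert_0 inj_on_insert
      using IH u_new by (fastforce simp: inj_on_def)
    show "inj_on e {..<Suc n}"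
      unfolding lessThan_Suc_eq_insert_0 inj_on_insert
      using IH e_new by (fastforce simp: inj_on_def)
  qed
qed

lemma arm_seq:
  assumes "arm G f \<alpha> y n" "ends G \<alpha> = {x, y}" "x \<noteq> y" "\<alpha> \<in> edges G"
  obtains u e where "e 0 = \<alpha>" "u 0 = x" "u 1 = y"
    "\<And>i. i < n \<Longrightarrow> ends G (e i) = {u i, u (Suc i)}"
    "\<And>i. 0 < i \<Longrightarrow> i < n \<Longrightarrow> incident G (u i) = {e (i - 1), e i}"
    "\<And>i. 0 < i \<Longrightarrow> i < n \<Longrightarrow> f (e i) = 1"
    "incident G (u n) = {e (n - 1)}" "inj_on u {..n}" "inj_on e {..<n}"
proof (rule chain_seq[OF assms(1-3)])
  fix u e
  assume ue: "e 0 = \<alpha>" "u 0 = x" "u 1 = y"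
    "\<And>i. i < n \<Longrightarrow> ends G (e i) = {u i, u (Suc i)}"
    "\<And>i. i < n \<Longrightarrow> u i \<noteq> u (Suc i)"
    "\<And>i. 0 < i \<Longrightarrow> i < n \<Longrightarrow> incident G (u i) = {e (i - 1), e i}"
    "\<And>i. 0 < i \<Longrightarrow> i < n \<Longrightarrow> e (i - 1) \<noteq> e i"
    "\<And>i. 0 < i \<Longrightarrow> i < n \<Longrightarrow> f (e i) = 1"
    "leaf_edge G (e (n - 1)) (u n)"
  have "inj_on u {..n} \<and> inj_on e {..<n}"
    by (rule pendant_walk_inj[OF chain_pos[OF assms(1)] _ ue(4-7) ue(9)[unfolded leaf_edge_def]])
      (simp add: ue(1) assms(4))
  then show thesis
    by (intro that[OF ue(1-4) ue(6) ue(8) ue(9)[unfolded leaf_edge_def]]) auto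
qed

section \<open>Isomorphisms and the branch behind an arm\<close>

lemma is_iso_incident:
  assumes "is_iso \<phi> \<psi> G H" "x \<in> verts G" "\<And>\<alpha>. \<alpha> \<in> edges G \<Longrightarrow> ends G \<alpha> \<subseteq> verts G"
  shows "incident H (\<phi> x) = \<psi> ` incident G x"
proof -
  have b: "bij_betw \<psi> (edges G) (edges H)" "inj_on \<phi> (verts G)"
    "\<And>\<alpha>. \<alpha> \<in> edges G \<Longrightarrow> ends H (\<psi> \<alpha>) = \<phi> ` ends G \<alpha>"
    using assms(1) by (auto simp: is_iso_def bij_betw_def)
  have "\<phi> x \<in> \<phi> ` ends G \<alpha> \<longleftrightarrow> x \<in> ends G \<alpha>" if "\<alpha> \<in> edges G" for \<alpha>
    using inj_on_image_mem_iff[OF b(2)] assms(2) assms(3)[OF that] by blast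
  with b show ?thesis unfolding incident_def bij_betw_def by force
qed

lemma is_iso_sym:
  assumes "is_iso \<phi> \<psi> G H" "\<And>\<alpha>. \<alpha> \<in> edges G \<Longrightarrow> ends G \<alpha> \<subseteq> verts G"
  shows "is_iso (inv_into (verts G) \<phi>) (inv_into (edges G) \<psi>) H G"
proof -
  have "ends G (inv_into (edges G) \<psi> b) = inv_into (verts G) \<phi> ` ends H b" if "b \<in> edges H" for b
  proof -
    have "inv_into (edges G) \<psi> b \<in> edges G" "\<psi> (inv_into (edges G) \<psi> b) = b"
      using assms(1) that by (auto simp: is_iso_def bij_betw_def inv_into_into f_inv_into_f)
    with assms show ?thesis unfolding is_iso_def bij_betw_def
      by (metis inv_into_image_cancel)
  qed
  with assms show ?thesis by (simp add: is_iso_def bij_betw_inv_into)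
qed

lemma is_iso_trans:
  assumes "is_iso \<phi> \<psi> G H" "is_iso \<phi>' \<psi>' H K"
  shows "is_iso (\<phi>' \<circ> \<phi>) (\<psi>' \<circ> \<psi>) G K"
  using assms unfolding is_iso_def
  by (auto intro: bij_betw_trans simp: image_comp dest: bij_betwE)

lemma path_graph_simps [simp]:
  "verts (path_graph l) = {1..l}" "edges (path_graph l) = {1..<l}"
  "ends (path_graph l) = (\<lambda>i. {i, Suc i})"
  by (simp_all add: path_graph_def)

lemma incident_path_graph:
  "1 \<le> i \<Longrightarrow> i \<le> l \<Longrightarrow> incident (path_graph l) i = {i - 1, i} \<inter> {1..<l}"
  by (auto simp: incident_def)

lemma path_graph_flip:
  "is_iso (\<lambda>i. Suc l - i) (\<lambda>i. l - i) (path_graph l) (path_graph l)"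
  unfolding is_iso_def
proof (intro conjI ballI)
  show "bij_betw (\<lambda>i. Suc l - i) (verts (path_graph l)) (verts (path_graph l))"
    by (rule bij_betw_byWitness[where f' = "\<lambda>i. Suc l - i"]) auto
  show "bij_betw (\<lambda>i. l - i) (edges (path_graph l)) (edges (path_graph l))"
    by (rule bij_betw_byWitness[where f' = "\<lambda>i. l - i"]) auto
qed auto

text \<open>The vertices of the arm form a set that no edge other than \<open>\<alpha>\<close>
  leaves, and each of them is reached from \<open>y\<close>; so they are the whole branch, and the
  indexing of the arm is an isomorphism from a path onto it. Since \<open>u 0 = x\<close> differs
  from all later vertices, \<open>x\<close> stays outside.\<close>

lemma arm_branch_iso:
  assumes G: "finite_graph G" and arm: "arm G f \<alpha> y n"
    and \<alpha>: "\<alpha> \<in> edges G" "ends G \<alpha> = {x, y}" "x \<noteq> y"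
  shows "x \<notin> verts (branch G y \<alpha>)" "card (verts (branch G y \<alpha>)) = n"
    "simple_graph (branch G y \<alpha>)" "\<forall>\<beta>\<in>edges (branch G y \<alpha>). f \<beta> = 1" "degree G y \<le> 2"
proof -
  obtain u e where ue: "e 0 = \<alpha>" "u 0 = x" "u 1 = y"
    "\<And>i. i < n \<Longrightarrow> ends G (e i) = {u i, u (Suc i)}"
    "\<And>i. 0 < i \<Longrightarrow> i < n \<Longrightarrow> incident G (u i) = {e (i - 1), e i}"
    "\<And>i. 0 < i \<Longrightarrow> i < n \<Longrightarrow> f (e i) = 1"
    "incident G (u n) = {e (n - 1)}" "inj_on u {..n}" "inj_on e {..<n}"
    using arm_seq[OF arm \<alpha>(2,3,1)] by metis
  have n: "n \<ge> 1" using chain_pos[OF arm] .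
  define V where "V = u ` {1..n}"
  define E where "E = e ` {1..<n}"
  have inc: "incident G v \<subseteq> insert \<alpha> E" if v: "v \<in> V" for v
  proof -
    obtain i where i: "v = u i" "1 \<le> i" "i \<le> n" using v by (auto simp: V_def)
    have "incident G v \<subseteq> {e (i - 1)} \<union> (if i < n then {e i} else {})"
      using i ue(5)[of i] ue(7) by (cases "i = n") auto
    moreover have "e (i - 1) \<in> insert \<alpha> E"
    proof (cases "i = 1")
      case False
      then have "i - 1 \<in> {1..<n}" using i by auto
      then show ?thesis unfolding E_def by blast
    qed (use ue(1) in simp)
    ultimately show ?thesis using i by (fastforce simp: E_def split: if_splits)
  qed
  have V: "V \<subseteq> verts G" unfolding V_def
  proof clarify
    fix i assume i: "i \<in> {1..n}"
    have "e (i - 1) \<in> edges G"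
    proof (cases "i = 1")
      case False
      then have "e (i - 1) \<in> incident G (u (i - 1))" using ue(5)[of "i - 1"] i by auto
      then show ?thesis by (simp add: incident_def)
    qed (use \<alpha>(1) ue(1) in simp)
    then have "ends G (e (i - 1)) \<subseteq> verts G" using G by (auto simp: finite_graph_def)
    then show "u i \<in> verts G" using ue(4)[of "i - 1"] i by auto
  qed
  have Eends: "ends G b \<subseteq> V" if "b \<in> E" for b using that ue(4) by (auto simp: E_def V_def)
  have Eed: "b \<in> edges G - {\<alpha>}" if b: "b \<in> E" for b
  proof -
    obtain i where i: "b = e i" "1 \<le> i" "i < n" using b by (auto simp: E_def)
    then have "b \<in> edges G" using ue(5)[of i] by (auto simp: incident_def)
    moreover have "b \<noteq> \<alpha>" using i ue(1) inj_onD[OF ue(9), of 0 i] by auto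
    ultimately show ?thesis by simp
  qed
  have xV: "x \<notin> V" using inj_onD[OF ue(8), of 0] ue(2) by (force simp: V_def)
  have yV: "y \<in> V" using ue(3) n unfolding V_def by force
  have cl: "cut_closed (del_edge G \<alpha>) V"
    unfolding cut_closed_def
  proof (intro ballI impI)
    fix b assume b: "b \<in> edges (del_edge G \<alpha>)" "ends (del_edge G \<alpha>) b \<inter> V \<noteq> {}"
    then obtain v where "v \<in> V" "b \<in> incident G v" by (auto simp: incident_def)
    with inc b(1) have "b \<in> E" by auto
    then show "ends (del_edge G \<alpha>) b \<subseteq> V" using Eends by simp
  qed
  have reach: "(y, u (Suc i)) \<in> (adj (del_edge G \<alpha>))\<^sup>*" if "Suc i \<le> n" for i
    using that
  proof (induction i)
    case 0
    then show ?case using ue(3) by simp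
  next
    case (Suc i)
    have "e (Suc i) \<in> E" using Suc.prems by (auto simp: E_def)
    then have "(u (Suc i), u (Suc (Suc i))) \<in> adj (del_edge G \<alpha>)"
      using ue(4)[of "Suc i"] Eed[of "e (Suc i)"] Suc.prems by (auto simp: adj_def)
    with Suc show ?case by (auto intro: rtrancl_into_rtrancl)
  qed
  have vb: "verts (branch G y \<alpha>) = V"
  proof
    show "verts (branch G y \<alpha>) \<subseteq> V" using branch_subset[OF cl yV] .
    show "V \<subseteq> verts (branch G y \<alpha>)"
    proof
      fix v assume "v \<in> V"
      then obtain i where "v = u i" "1 \<le> i" "i \<le> n" by (auto simp: V_def)
      with reach[of "i - 1"] V \<open>v \<in> V\<close> show "v \<in> verts (branch G y \<alpha>)" by (auto simp: branch_simps)
    qed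
  qed
  have eb: "edges (branch G y \<alpha>) = E"
  proof (intro set_eqI iffI)
    fix b assume b: "b \<in> edges (branch G y \<alpha>)"
    then have bb: "b \<in> edges G" "b \<noteq> \<alpha>" "ends G b \<subseteq> V" using vb by (auto simp: branch_simps(2))
    then obtain v where "v \<in> V" "b \<in> incident G v"
      using ends_cases[OF G bb(1)] by (metis insert_subset incident_iff insertI1)
    with inc bb show "b \<in> E" by auto
  next
    fix b assume "b \<in> E"
    then show "b \<in> edges (branch G y \<alpha>)" using Eends Eed vb by (auto simp: branch_simps(2))
  qed
  have injV: "inj_on u {1..n}" using ue(8) by (rule inj_on_subset) auto
  have injE: "inj_on e {1..<n}" using ue(9) by (rule inj_on_subset) auto
  show "x \<notin> verts (branch G y \<alpha>)" using xV vb by simp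
  show "card (verts (branch G y \<alpha>)) = n" using vb card_image[OF injV] by (simp add: V_def)
  show "\<forall>\<beta>\<in>edges (branch G y \<alpha>). f \<beta> = 1" using eb ue(6) by (auto simp: E_def)
  have "is_iso u e (path_graph n) (branch G y \<alpha>)"
    using vb eb ue(4) injV injE by (auto simp: is_iso_def bij_betw_def V_def E_def branch_simps(3))
  from is_iso_sym[OF this] have "graph_iso (branch G y \<alpha>) (path_graph n)"
    by (auto simp: graph_iso_def)
  then show "simple_graph (branch G y \<alpha>)" using n by (auto simp: simple_graph_def)
  have "incident G y \<subseteq> {e 0, e 1}"
  proof (cases "n = 1")
    case True
    then show ?thesis using ue(3,7) by auto
  next
    case False
    then show ?thesis using ue(3) ue(5)[of 1] n by auto
  qed
  then have "card (incident G y) \<le> card {e 0, e 1}" by (intro card_mono) auto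
  also have "\<dots> \<le> 2" by (simp add: card_insert_if)
  finally show "degree G y \<le> 2" by (simp add: degree_def)
qed

text \<open>The branch at \<open>y\<close> is a path, but \<open>y\<close> might sit anywhere on it.
  An inner vertex of the path has two edges in the branch besides \<open>\<alpha>\<close>, which
  contradicts degree at most two; so \<open>y\<close> is an end, and the path read from
  \<open>y\<close> is the arm.\<close>

lemma f_simple_imp_arm:
  assumes G: "finite_graph G" "connected_graph G"
    and \<alpha>: "\<alpha> \<in> edges G" "ends G \<alpha> = {x, y}" "x \<noteq> y" and fs: "f_simple G f x \<alpha>"
  shows "\<exists>n. arm G f \<alpha> y n"
proof -
  let ?B = "branch G y \<alpha>"
  have nc: "\<not> cyclic_edge G \<alpha>" and deg: "degree G y \<le> 2" and "simple_graph ?B"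
    and f1: "\<forall>\<beta>\<in>edges ?B. f \<beta> = 1"
    using fs other_end_eq[OF \<alpha>(2)] by (auto simp: f_simple_def Let_def)
  then obtain l \<phi> \<psi> where "l \<ge> 1" and iso: "is_iso \<phi> \<psi> ?B (path_graph l)"
    by (auto simp: simple_graph_def graph_iso_def)
  have x: "x \<notin> verts ?B" using noncyclic_iff[OF G \<alpha>(1,2)] nc by simp
  have y: "y \<in> verts ?B" using \<alpha> G by (intro branch_self) (auto simp: finite_graph_def)
  have Bends: "\<And>\<beta>. \<beta> \<in> edges ?B \<Longrightarrow> ends ?B \<beta> \<subseteq> verts ?B" by (simp add: branch_simps(2,3))
  have incB: "incident ?B v = incident G v - {\<alpha>}" if "v \<in> verts ?B" for v
    using cut_closed_branch[OF G(1), of \<alpha> y] that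
    by (auto simp: incident_def branch_simps(2,3) cut_closed_def)
  have inc\<alpha>: "\<alpha> \<in> incident G v \<longleftrightarrow> v = y" if "v \<in> verts ?B" for v
    using that x \<alpha> by (auto simp: incident_def)
  obtain u e where ue: "is_iso u e (path_graph l) ?B"
    using is_iso_sym[OF iso Bends] by blast
  have inc_ue: "incident ?B (u i) = e ` ({i - 1, i} \<inter> {1..<l})" if "1 \<le> i" "i \<le> l" for i
    using is_iso_incident[OF ue, of i] that by (auto simp: incident_path_graph)
  obtain j where j: "1 \<le> j" "j \<le> l" "u j = y"
    using ue y unfolding is_iso_def bij_betw_def by (metis imageE atLeastAtMost_iff path_graph_simps(1))
  have j1l: "j = 1 \<or> j = l"
  proof (rule ccontr)
    assume "\<not> ?thesis"
    then have "{j - 1, j} \<inter> {1..<l} = {j - 1, j}" "j - 1 \<noteq> j" "{j - 1, j} \<subseteq> {1..<l}" using j by auto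
    moreover have "inj_on e {1..<l}" using ue by (simp add: is_iso_def bij_betw_def)
    ultimately have "card (e ` {j - 1, j}) = 2"
      using inj_on_subset[of e "{1..<l}" "{j - 1, j}"] by (subst card_image) auto
    then have "card (incident ?B (u j)) = 2"
      using inc_ue[OF j(1,2)] \<open>{j - 1, j} \<inter> {1..<l} = {j - 1, j}\<close> by (simp only:)
    moreover have "card (incident ?B y) < card (incident G y)"
      using incB[OF y] inc\<alpha>[OF y] finite_incident[OF G(1)] by (intro psubset_card_mono) auto
    ultimately show False using deg j by (simp add: degree_def)
  qed
  \<comment> \<open>If \<open>y\<close> is the last vertex, the path is reversed.\<close>
  obtain u e where ue: "is_iso u e (path_graph l) ?B" "u 1 = y"
  proof (cases "j = 1")
    case True
    then show ?thesis using that ue j by blast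
  next
    case False
    then have "j = l" using j1l by simp
    then show ?thesis using that[OF is_iso_trans[OF path_graph_flip[of l] ue]] j by simp
  qed
  have inc_ue: "incident ?B (u i) = e ` ({i - 1, i} \<inter> {1..<l})" if "1 \<le> i" "i \<le> l" for i
    using is_iso_incident[OF ue(1), of i] that by (auto simp: incident_path_graph)
  have inj: "inj_on u {1..l}" "inj_on e {1..<l}" and im: "u ` {1..l} = verts ?B" "e ` {1..<l} = edges ?B"
    and ends_e: "\<And>i. 1 \<le> i \<Longrightarrow> i < l \<Longrightarrow> ends G (e i) = {u i, u (Suc i)}"
    using ue(1) by (auto simp: is_iso_def bij_betw_def branch_simps(3))
  \<comment> \<open>Index 0, which is not an edge of the path, is given to \<open>\<alpha>\<close>,
    so that the edge leading into \<open>u i\<close> is \<open>?e (i - 1)\<close> for every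
    \<open>i\<close>, including 1.\<close>
  let ?e = "\<lambda>i. if i = 0 then \<alpha> else e i"
  have \<alpha>B: "\<alpha> \<notin> edges ?B" by (simp add: branch_simps(2))
  have inc: "incident G (u i) = {?e (i - 1)} \<union> (if i < l then {e i} else {})" if i: "1 \<le> i" "i \<le> l" for i
  proof -
    have ui: "u i \<in> verts ?B" using im i by auto
    have "u i = y \<longleftrightarrow> i = 1" using inj_onD[OF inj(1), of i 1] i ue(2) by auto
    then have "incident G (u i) = incident ?B (u i) \<union> (if i = 1 then {\<alpha>} else {})"
      using incB[OF ui] inc\<alpha>[OF ui] by auto
    moreover have "{i - 1, i} \<inter> {1..<l} = (if i = 1 then {} else {i - 1}) \<union> (if i < l then {i} else {})"
      using i by auto
    ultimately show ?thesis using inc_ue[OF i] i by (auto simp: image_Un)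
  qed
  have "arm G f (?e (i - 1)) (u i) (Suc (l - i))" if "1 \<le> i" "i \<le> l" for i
    using that(2,1)
  proof (induction i rule: inc_induct)
    case base
    then have "leaf_edge G (?e (l - 1)) (u l)" using inc[of l] by (simp add: leaf_edge_def)
    from chain.stop[of "leaf_edge G", OF this] show ?case by simp
  next
    case (step i)
    have "?e (i - 1) \<noteq> e i"
    proof (cases "i = 1")
      case True
      then show ?thesis using \<alpha>B im(2) step.hyps by auto
    next
      case False
      then have "i - 1 \<in> {1..<l}" "i \<in> {1..<l}" "i - 1 \<noteq> i" using step by auto
      then show ?thesis using inj_onD[OF inj(2), of "i - 1" i] False step.prems by auto
    qed
    moreover have "u i \<noteq> u (Suc i)" using inj_onD[OF inj(1), of i "Suc i"] step by auto
    moreover have "f (e i) = 1" using f1 im(2) step by auto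
    moreover have "arm G f (e i) (u (Suc i)) (l - i)"
      using step.IH step.hyps step.prems by (simp add: Suc_diff_Suc)
    moreover have "incident G (u i) = {?e (i - 1), e i}" "ends G (e i) = {u i, u (Suc i)}"
      using inc[of i] ends_e[of i] step by auto
    ultimately show ?case by (intro chain.step)
  qed
  from this[of 1] have "arm G f \<alpha> y (Suc (l - 1))" using \<open>l \<ge> 1\<close> ue(2) by simp
  then show ?thesis ..
qed

section \<open>The derivative of an edge in terms of arms\<close>

lemma edge_deriv_arm:
  assumes "finite_graph G" "connected_graph G" "\<alpha> \<in> edges G" "ends G \<alpha> = {x, y}" "x \<noteq> y"
    and "arm G f \<alpha> y n"
  shows "edge_deriv G f x \<alpha> = rho n"
proof -
  note b = arm_branch_iso[OF assms(1,6,3,4,5)]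
  have "\<not> cyclic_edge G \<alpha>" using noncyclic_iff[OF assms(1-4)] b(1) by blast
  moreover have o: "other_end G x \<alpha> = y" using other_end_eq[OF assms(4)] .
  ultimately have "f_simple G f x \<alpha>" unfolding f_simple_def Let_def using b(3-5) by blast
  then show ?thesis unfolding edge_deriv_def using o b(2) by simp
qed

lemma edge_deriv_no_arm:
  assumes "finite_graph G" "connected_graph G" "\<alpha> \<in> edges G" "ends G \<alpha> = {x, y}" "x \<noteq> y"
    and "\<And>n. \<not> arm G f \<alpha> y n"
  shows "edge_deriv G f x \<alpha> = 2"
proof -
  have "\<not> f_simple G f x \<alpha>" using f_simple_imp_arm[OF assms(1-5)] assms(6) by blast
  then show ?thesis using assms(4,5) by (simp add: edge_deriv_def is_loop_def)
qed

lemma loop_cyclic: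
  assumes "finite_graph G" "connected_graph G" "\<alpha> \<in> edges G" "ends G \<alpha> = {x}"
  shows "cyclic_edge G \<alpha>"
  using noncyclic_iff[OF assms(1-3), of x x] assms branch_self[of x G \<alpha>]
  by (auto simp: finite_graph_def)

lemma edge_deriv_loop:
  assumes "finite_graph G" "connected_graph G" "\<alpha> \<in> edges G" "ends G \<alpha> = {x}"
  shows "edge_deriv G f x \<alpha> = 4"
  using loop_cyclic[OF assms] assms(4) by (simp add: edge_deriv_def f_simple_def is_loop_def)

section \<open>Isomorphisms and coverings\<close>

lemma finite_graph_ends: "finite_graph G \<Longrightarrow> \<alpha> \<in> edges G \<Longrightarrow> ends G \<alpha> \<subseteq> verts G"
  by (simp add: finite_graph_def)

lemma is_iso_finite_graph:
  assumes iso: "is_iso \<phi> \<psi> G H" and G: "finite_graph G"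
  shows "finite_graph H"
proof -
  have b: "bij_betw \<phi> (verts G) (verts H)" "bij_betw \<psi> (edges G) (edges H)"
    and en: "\<And>\<alpha>. \<alpha> \<in> edges G \<Longrightarrow> ends H (\<psi> \<alpha>) = \<phi> ` ends G \<alpha>"
    using iso by (auto simp: is_iso_def)
  have "ends H b \<subseteq> verts H \<and> card (ends H b) \<in> {1, 2}" if bH: "b \<in> edges H" for b
  proof -
    obtain a where a: "a \<in> edges G" "b = \<psi> a" using bH b(2) unfolding bij_betw_def by blast
    have "ends G a \<subseteq> verts G" "card (ends G a) \<in> {1, 2}" using G a(1) by (auto simp: finite_graph_def)
    moreover from this have "inj_on \<phi> (ends G a)" using b(1) by (auto simp: bij_betw_def intro: inj_on_subset)
    ultimately show ?thesis using b(1) en[OF a(1)] a(2) by (auto simp: bij_betw_def card_image)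
  qed
  moreover have "finite (verts H)" "verts H \<noteq> {}" "finite (edges H)"
    using b G bij_betw_finite[OF b(1)] bij_betw_finite[OF b(2)]
    by (auto simp: finite_graph_def bij_betw_def)
  ultimately show ?thesis by (simp add: finite_graph_def)
qed

lemma is_iso_connected_graph:
  assumes iso: "is_iso \<phi> \<psi> G H" and G: "finite_graph G" "connected_graph G"
  shows "connected_graph H"
proof (rule connected_graphI[OF is_iso_finite_graph[OF iso G(1)]])
  fix S assume S: "S \<subseteq> verts H" "S \<noteq> {}" "cut_closed H S"
  have b: "bij_betw \<phi> (verts G) (verts H)" "bij_betw \<psi> (edges G) (edges H)"
    and en: "\<And>\<alpha>. \<alpha> \<in> edges G \<Longrightarrow> ends H (\<psi> \<alpha>) = \<phi> ` ends G \<alpha>"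
    using iso by (auto simp: is_iso_def)
  define U where "U = {v \<in> verts G. \<phi> v \<in> S}"
  have "cut_closed G U"
    unfolding cut_closed_def
  proof (intro ballI impI)
    fix e assume e: "e \<in> edges G" "ends G e \<inter> U \<noteq> {}"
    then have "\<psi> e \<in> edges H" using b(2) by (auto simp: bij_betw_def)
    moreover have "ends H (\<psi> e) \<inter> S \<noteq> {}" using e en by (auto simp: U_def)
    ultimately have "ends H (\<psi> e) \<subseteq> S" using S(3) by (simp add: cut_closed_def)
    then show "ends G e \<subseteq> U" using en[OF e(1)] finite_graph_ends[OF G(1) e(1)] by (auto simp: U_def)
  qed
  moreover obtain s where "s \<in> U"
  proof -
    obtain t where t: "t \<in> S" using S(2) by blast
    then have "t \<in> \<phi> ` verts G" using S(1) b(1) by (auto simp: bij_betw_def)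
    then show thesis using t that by (auto simp: U_def)
  qed
  ultimately have "verts G \<subseteq> U" using connected_graphD[OF G(2)] by (auto simp: U_def)
  then have "\<phi> ` verts G \<subseteq> S" by (auto simp: U_def)
  then show "S = verts H" using S(1) b(1) by (auto simp: bij_betw_def)
qed

lemma arm_iso:
  assumes "arm G f \<alpha> y n" "y \<in> verts G"
    and iso: "is_iso \<phi> \<psi> G H" and G: "finite_graph G" and h: "\<And>\<alpha>. \<alpha> \<in> edges G \<Longrightarrow> h (\<psi> \<alpha>) = f \<alpha>"
  shows "arm H h (\<psi> \<alpha>) (\<phi> y) n"
  using assms(1,2)
proof (induction rule: chain.induct)
  case (stop \<alpha> y)
  then have "leaf_edge H (\<psi> \<alpha>) (\<phi> y)"
    using is_iso_incident[OF iso _ finite_graph_ends[OF G], of y] by (simp add: leaf_edge_def)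
  then show ?case by (rule chain.stop)
next
  case (step y \<alpha> \<beta> z n)
  have ed: "\<alpha> \<in> edges G" "\<beta> \<in> edges G" using step.hyps(1) by (auto simp: incident_def)
  have z: "z \<in> verts G" using finite_graph_ends[OF G ed(2)] step.hyps(3) by simp
  have inj: "inj_on \<phi> (verts G)" "inj_on \<psi> (edges G)" using iso by (auto simp: is_iso_def bij_betw_def)
  show ?case
  proof (rule chain.step)
    show "incident H (\<phi> y) = {\<psi> \<alpha>, \<psi> \<beta>}"
      using is_iso_incident[OF iso step.prems finite_graph_ends[OF G]] step.hyps(1) by simp
    show "\<psi> \<alpha> \<noteq> \<psi> \<beta>" using inj_onD[OF inj(2)] ed step.hyps(2) by blast
    show "ends H (\<psi> \<beta>) = {\<phi> y, \<phi> z}" using iso ed step.hyps(3) by (simp add: is_iso_def)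
    show "\<phi> y \<noteq> \<phi> z" using inj_onD[OF inj(1)] z step by blast
  qed (use h ed step z in auto)
qed

text \<open>Only the existence and the length of arms have to be carried over; branches and
  components are never compared. Transport along the inverse isomorphism gives the converse for
  arms, hence also the case without an arm.\<close>

lemma edge_deriv_iso:
  assumes iso: "is_iso \<phi> \<psi> G H" and G: "finite_graph G" "connected_graph G"
    and h: "\<And>\<alpha>. \<alpha> \<in> edges G \<Longrightarrow> h (\<psi> \<alpha>) = f \<alpha>" and \<alpha>: "\<alpha> \<in> incident G x"
  shows "edge_deriv H h (\<phi> x) (\<psi> \<alpha>) = edge_deriv G f x \<alpha>"
proof -
  have H: "finite_graph H" "connected_graph H"
    using is_iso_finite_graph[OF iso G(1)] is_iso_connected_graph[OF iso G] .
  have ed: "\<alpha> \<in> edges G" "\<psi> \<alpha> \<in> edges H" "x \<in> ends G \<alpha>"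
    using \<alpha> iso by (auto simp: incident_def is_iso_def bij_betw_def)
  then obtain y where y: "ends G \<alpha> = {x, y}"
    by (metis ends_cases[OF G(1)] insert_iff insert_commute singletonD)
  have v: "x \<in> verts G" "y \<in> verts G" using finite_graph_ends[OF G(1) ed(1)] y by auto
  have yH: "ends H (\<psi> \<alpha>) = {\<phi> x, \<phi> y}" using iso ed y by (simp add: is_iso_def)
  have inj: "inj_on \<phi> (verts G)" "inj_on \<psi> (edges G)" using iso by (auto simp: is_iso_def bij_betw_def)
  show ?thesis
  proof (cases "x = y")
    case True
    then show ?thesis using edge_deriv_loop[OF G ed(1)] edge_deriv_loop[OF H ed(2)] y yH by simp
  next
    case False
    then have ne: "\<phi> x \<noteq> \<phi> y" using inj_onD[OF inj(1)] v by blast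
    have "arm G f \<alpha> y n \<longleftrightarrow> arm H h (\<psi> \<alpha>) (\<phi> y) n" for n
    proof
      assume "arm G f \<alpha> y n"
      from arm_iso[OF this v(2) iso G(1), of h] h show "arm H h (\<psi> \<alpha>) (\<phi> y) n" by blast
    next
      let ?\<phi> = "inv_into (verts G) \<phi>" and ?\<psi> = "inv_into (edges G) \<psi>"
      assume a: "arm H h (\<psi> \<alpha>) (\<phi> y) n"
      have "f (?\<psi> b) = h b" if "b \<in> edges H" for b
        using that h iso by (metis bij_betw_def f_inv_into_f inv_into_into is_iso_def)
      with arm_iso[OF a _ is_iso_sym[OF iso finite_graph_ends[OF G(1)]] H(1)] v iso
      have "arm G f (?\<psi> (\<psi> \<alpha>)) (?\<phi> (\<phi> y)) n" by (auto simp: is_iso_def bij_betw_def)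
      then show "arm G f \<alpha> y n" using inj v ed by simp
    qed
    note arms = this
    show ?thesis
    proof (cases "\<exists>n. arm G f \<alpha> y n")
      case True
      then obtain n where "arm G f \<alpha> y n" by blast
      with arms edge_deriv_arm[OF G ed(1) y False] edge_deriv_arm[OF H ed(2) yH ne]
      show ?thesis by simp
    next
      case False
      with arms edge_deriv_no_arm[OF G ed(1) y \<open>x \<noteq> y\<close>] edge_deriv_no_arm[OF H ed(2) yH ne]
      show ?thesis by simp
    qed
  qed
qed

text \<open>The theorem refers only to the set of degrees, so equality of images is enough and no
  vertex of \<open>G\<close> has to be named in the computations on models.\<close>

lemma f_iso_transfer:
  assumes "f_iso G f H h" and G: "finite_graph G" "connected_graph G"
  shows "finite_graph H" "connected_graph H" "rho_degree H h ` verts H = rho_degree G f ` verts G"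
proof -
  obtain \<phi> \<psi> where iso: "is_iso \<phi> \<psi> G H" and h: "\<And>\<alpha>. \<alpha> \<in> edges G \<Longrightarrow> h (\<psi> \<alpha>) = f \<alpha>"
    using assms(1) by (auto simp: f_iso_def)
  show "finite_graph H" "connected_graph H"
    using is_iso_finite_graph[OF iso G(1)] is_iso_connected_graph[OF iso G] .
  have "rho_degree H h (\<phi> x) = rho_degree G f x" if "x \<in> verts G" for x
  proof -
    have "inj_on \<psi> (incident G x)"
      using iso by (auto simp: is_iso_def bij_betw_def incident_def intro: inj_on_subset)
    moreover have "incident H (\<phi> x) = \<psi> ` incident G x"
      by (rule is_iso_incident[OF iso that finite_graph_ends[OF G(1)]])
    moreover have "ereal_of_enat (h (\<psi> \<alpha>)) * ereal (edge_deriv H h (\<phi> x) (\<psi> \<alpha>)) =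
        ereal_of_enat (f \<alpha>) * ereal (edge_deriv G f x \<alpha>)" if "\<alpha> \<in> incident G x" for \<alpha>
      using edge_deriv_iso[where h = h and f = f, OF iso G _ that] h that by (simp add: incident_def)
    ultimately show ?thesis unfolding rho_degree_def by (simp add: sum.reindex)
  qed
  moreover have "verts H = \<phi> ` verts G" using iso by (simp add: is_iso_def bij_betw_def)
  ultimately show "rho_degree H h ` verts H = rho_degree G f ` verts G"
    by (simp add: image_image)
qed

text \<open>The constructions below define maps on a model, where vertices are explicit, and go into
  \<open>G\<close>; the definitions of the two lists ask for the opposite direction.\<close>

lemma f_iso_from:
  assumes "is_iso \<phi> \<psi> H G" "finite_graph H" "\<And>b. b \<in> edges H \<Longrightarrow> h b = f (\<psi> b)"
  shows "f_iso G f H h"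
  unfolding f_iso_def
proof (intro exI conjI ballI)
  show "is_iso (inv_into (verts H) \<phi>) (inv_into (edges H) \<psi>) G H"
    using is_iso_sym[OF assms(1) finite_graph_ends[OF assms(2)]] .
  show "h (inv_into (edges H) \<psi> \<alpha>) = f \<alpha>" if "\<alpha> \<in> edges G" for \<alpha>
    using assms(1,3) that by (metis bij_betw_def f_inv_into_f inv_into_into is_iso_def)
qed

lemma f_iso_trans:
  assumes "f_iso G f H h" "f_iso H h K k"
  shows "f_iso G f K k"
proof -
  obtain \<phi> \<psi> \<phi>' \<psi>' where iso: "is_iso \<phi> \<psi> G H" "is_iso \<phi>' \<psi>' H K"
    and w: "\<And>\<alpha>. \<alpha> \<in> edges G \<Longrightarrow> h (\<psi> \<alpha>) = f \<alpha>" "\<And>b. b \<in> edges H \<Longrightarrow> k (\<psi>' b) = h b"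
    using assms by (auto simp: f_iso_def)
  have "\<psi> \<alpha> \<in> edges H" if "\<alpha> \<in> edges G" for \<alpha> using iso(1) that by (auto simp: is_iso_def bij_betw_def)
  with w have "k ((\<psi>' \<circ> \<psi>) \<alpha>) = f \<alpha>" if "\<alpha> \<in> edges G" for \<alpha> using that by simp
  with is_iso_trans[OF iso] show ?thesis unfolding f_iso_def by blast
qed

lemma f_iso_cong:
  assumes "f_iso G f H h" "finite_graph G" "\<And>b. b \<in> edges H \<Longrightarrow> h b = k b"
  shows "f_iso G f H k"
  using assms(1,3) unfolding f_iso_def is_iso_def bij_betw_def by (metis image_eqI)

section \<open>Coverings with one sheet\<close>

lemma bij_betw_singleton_fibres:
  assumes "g ` A \<subseteq> B" "\<And>v. v \<in> B \<Longrightarrow> card {a \<in> A. g a = v} = 1"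
  shows "bij_betw g A B"
proof -
  have fibre: "\<exists>a. {a \<in> A. g a = v} = {a}" if v: "v \<in> B" for v
    by (rule card_1_singletonE[OF assms(2)[OF v]]) (rule exI)
  show ?thesis
    unfolding bij_betw_def
  proof (intro conjI inj_onI equalityI subsetI)
    fix a b assume ab: "a \<in> A" "b \<in> A" "g a = g b"
    have "g a \<in> B" using assms(1) ab(1) by (rule subsetD[OF _ imageI])
    from fibre[OF this] obtain c where c: "{a' \<in> A. g a' = g a} = {c}" by (elim exE)
    have "a \<in> {a' \<in> A. g a' = g a}" "b \<in> {a' \<in> A. g a' = g a}" using ab by simp_all
    then show "a = b" unfolding c by simp
  next
    fix v assume "v \<in> B"
    from fibre[OF this] obtain c where c: "{a \<in> A. g a = v} = {c}" by (elim exE)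
    then have "c \<in> {a \<in> A. g a = v}" by simp
    then show "v \<in> g ` A" by auto
  qed (use assms(1) in blast)
qed

text \<open>A covering of a connected graph with \<open>d\<close> sheets multiplies the numbers of vertices and of
  edges by \<open>d\<close>; over a graph with \<open>card (verts H) = card (edges H) + 1\<close> this forces \<open>d = 1\<close>.\<close>

lemma covering_is_iso:
  assumes H: "finite (verts H)" "verts H \<noteq> {}" "finite (edges H)" "card (verts H) = Suc (card (edges H))"
    and H_ends: "\<And>b. b \<in> edges H \<Longrightarrow> ends H b \<subseteq> verts H \<and> card (ends H b) = 2"
    and G: "finite_graph G" "connected_graph G" "\<And>e. e \<in> edges G \<Longrightarrow> card (ends G e) = 2"
    and \<phi>: "\<And>a. a \<in> verts H \<Longrightarrow> \<phi> a \<in> verts G"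
    and \<psi>: "\<And>a. a \<in> verts H \<Longrightarrow> bij_betw \<psi> (incident H a) (incident G (\<phi> a))"
    and ends: "\<And>b. b \<in> edges H \<Longrightarrow> ends G (\<psi> b) = \<phi> ` ends H b"
  shows "is_iso \<phi> \<psi> H G"
proof -
  have \<psi>E: "\<psi> b \<in> edges G" if b: "b \<in> edges H" for b
  proof -
    have "ends H b \<noteq> {}" using H_ends[OF b] by auto
    then obtain a where "a \<in> verts H" "b \<in> incident H a"
      using H_ends[OF b] b by (auto simp: incident_def)
    then show ?thesis using \<psi> by (auto simp: bij_betw_def incident_def)
  qed
  \<comment> \<open>\<open>G\<close> has no loops here, so the image of an edge has two ends and
    \<open>\<phi>\<close> cannot identify the ends of \<open>b\<close>.\<close>
  have inj_ends: "inj_on \<phi> (ends H b)" if "b \<in> edges H" for b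
    using H_ends[OF that] ends[OF that] G(3)[OF \<psi>E[OF that]]
    by (intro eq_card_imp_inj_on) (auto intro: card_ge_0_finite)
  define N where "N v = card {a \<in> verts H. \<phi> a = v}" for v
  define M where "M e = card {b \<in> edges H. \<psi> b = e}" for e
  \<comment> \<open>Sending an edge over \<open>e\<close> to its end over \<open>v\<close> is a
    bijection: the local bijection \<open>\<psi>\<close> at each vertex over \<open>v\<close> hits
    \<open>e\<close> exactly once.\<close>
  have MN: "M e = N v" if e: "e \<in> edges G" "v \<in> ends G e" for e v
  proof -
    define g where "g b = (THE a. a \<in> ends H b \<and> \<phi> a = v)" for b
    have g: "g b = a" if "b \<in> edges H" "a \<in> ends H b" "\<phi> a = v" for a b
      unfolding g_def using that inj_onD[OF inj_ends[OF that(1)]] by (intro the_equality) blast+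
    have ex: "\<exists>a \<in> ends H b. \<phi> a = v" if "b \<in> edges H" "\<psi> b = e" for b
      using ends[OF that(1)] that(2) e(2) by auto
    have "bij_betw g {b \<in> edges H. \<psi> b = e} {a \<in> verts H. \<phi> a = v}"
      unfolding bij_betw_def
    proof (intro conjI inj_onI set_eqI iffI)
      fix b c assume bc: "b \<in> {b \<in> edges H. \<psi> b = e}" "c \<in> {b \<in> edges H. \<psi> b = e}" "g b = g c"
      obtain a where a: "a \<in> ends H b" "\<phi> a = v" using ex bc(1) by blast
      obtain a' where a': "a' \<in> ends H c" "\<phi> a' = v" using ex bc(2) by blast
      have "a = a'" using g a a' bc by auto
      then have "b \<in> incident H a" "c \<in> incident H a" "a \<in> verts H"
        using a a' bc H_ends by (auto simp: incident_def)
      with \<psi> bc show "b = c" unfolding bij_betw_def by (metis (mono_tags, lifting) inj_onD mem_Collect_eq)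
    next
      fix a assume "a \<in> g ` {b \<in> edges H. \<psi> b = e}"
      then obtain b where b: "b \<in> edges H" "\<psi> b = e" "a = g b" by auto
      obtain c where c: "c \<in> ends H b" "\<phi> c = v" using ex b by blast
      have "a = c" using g[OF b(1) c] b(3) by simp
      with c b(1) H_ends show "a \<in> {a \<in> verts H. \<phi> a = v}" by blast
    next
      fix a assume a: "a \<in> {a \<in> verts H. \<phi> a = v}"
      then have "e \<in> \<psi> ` incident H a" using \<psi>[of a] e by (auto simp: bij_betw_def incident_def)
      then obtain b where "b \<in> edges H" "a \<in> ends H b" "\<psi> b = e" by (auto simp: incident_def)
      with g a show "a \<in> g ` {b \<in> edges H. \<psi> b = e}" by force
    qed
    then show ?thesis unfolding N_def M_def by (rule bij_betw_same_card)
  qed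
  obtain a0 where a0: "a0 \<in> verts H" using H(2) by auto
  define d where "d = N (\<phi> a0)"
  \<comment> \<open>Fibre sizes agree along each edge, so connectedness makes them constant.\<close>
  have "cut_closed G {v. N v = d}"
    unfolding cut_closed_def
  proof (intro ballI impI)
    fix e assume e: "e \<in> edges G" "ends G e \<inter> {v. N v = d} \<noteq> {}"
    then obtain w where "w \<in> ends G e" "N w = d" by blast
    then have "M e = d" using MN[OF e(1)] by simp
    then show "ends G e \<subseteq> {v. N v = d}" using MN[OF e(1)] by auto
  qed
  then have Nd: "N v = d" if "v \<in> verts G" for v
    using connected_graphD[OF G(2), of "{v. N v = d}" "\<phi> a0" v] \<phi>[OF a0] that by (simp add: d_def)
  have Md: "M e = d" if e: "e \<in> edges G" for e
  proof -
    obtain v w where "ends G e = {v, w}" "v \<in> verts G" using ends_cases[OF G(1) e] by metis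
    then show ?thesis using MN[OF e, of v] Nd by simp
  qed
  have "card (verts H) = (\<Sum>v\<in>verts G. N v)"
    unfolding N_def using H(1) G(1) \<phi>
    by (subst card_eq_sum, subst sum.group[symmetric, of _ "verts G" \<phi>])
      (auto simp: finite_graph_def)
  also have "\<dots> = card (verts G) * d" using Nd by simp
  finally have cV: "card (verts H) = card (verts G) * d" .
  have "card (edges H) = (\<Sum>e\<in>edges G. M e)"
    unfolding M_def using H(3) G(1) \<psi>E
    by (subst card_eq_sum, subst sum.group[symmetric, of _ "edges G" \<psi>])
      (auto simp: finite_graph_def)
  also have "\<dots> = card (edges G) * d" using Md by simp
  finally have "card (verts G) * d = Suc (card (edges G) * d)" using H(4) cV by simp
  \<comment> \<open>\<open>d\<close> divides the numbers of vertices and of edges of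
    \<open>H\<close>, which differ by one.\<close>
  then have "d dvd 1" by (metis Suc_eq_plus1 dvd_add_right_iff dvd_triv_right)
  then have d1: "d = 1" by simp
  have "bij_betw \<phi> (verts H) (verts G)"
    by (rule bij_betw_singleton_fibres) (use \<phi> Nd d1 in \<open>auto simp: N_def\<close>)
  moreover have "bij_betw \<psi> (edges H) (edges G)"
    by (rule bij_betw_singleton_fibres) (use \<psi>E Md d1 in \<open>auto simp: M_def\<close>)
  ultimately show ?thesis using ends by (simp add: is_iso_def)
qed

text \<open>Deleting \<open>\<alpha>\<close> or deleting \<open>\<beta>\<close> leaves
  \<open>y\<close> hanging on one remaining edge, and the two graphs agree away from
  \<open>y\<close>; so one is connected when the other is.\<close>

lemma cyclic_edge_exchange:
  assumes G: "finite_graph G" "connected_graph G"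
    and y: "incident G y = {\<alpha>, \<beta>}" "\<alpha> \<noteq> \<beta>" and \<alpha>: "ends G \<alpha> = {x, y}" "x \<noteq> y"
    and \<beta>: "ends G \<beta> = {y, z}" "y \<noteq> z" and cyc: "cyclic_edge G \<alpha>"
  shows "cyclic_edge G \<beta>"
proof -
  have ed: "\<alpha> \<in> edges G" "\<beta> \<in> edges G" using y by (auto simp: incident_def)
  have v: "x \<in> verts G" "y \<in> verts G" "z \<in> verts G"
    using finite_graph_ends[OF G(1)] ed \<alpha> \<beta> by auto
  have con: "connected_graph (del_edge G \<alpha>)" using cyc by (simp add: cyclic_edge_def)
  have "connected_graph (del_edge G \<beta>)"
  proof (rule connected_graphI[OF finite_graph_del_edge[OF G(1)]])
    fix S assume S: "S \<subseteq> verts (del_edge G \<beta>)" "S \<noteq> {}" "cut_closed (del_edge G \<beta>) S"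
    have xy: "x \<in> S \<longleftrightarrow> y \<in> S" using S(3) \<alpha> ed y(2) unfolding cut_closed_def by auto
    \<comment> \<open>Move \<open>y\<close> to the side of \<open>z\<close>: in \<open>G\<close>
      without \<open>\<alpha>\<close> the vertex \<open>y\<close> is tied to \<open>z\<close>,
      whereas in \<open>G\<close> without \<open>\<beta>\<close> it is tied to
      \<open>x\<close>.\<close>
    define S' where "S' = (if z \<in> S then insert y S else S - {y})"
    have clo: "cut_closed (del_edge G \<alpha>) S'"
      unfolding cut_closed_def
    proof (intro ballI impI)
      fix e assume e: "e \<in> edges (del_edge G \<alpha>)" "ends (del_edge G \<alpha>) e \<inter> S' \<noteq> {}"
      show "ends (del_edge G \<alpha>) e \<subseteq> S'"
      proof (cases "e = \<beta>")
        case True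
        then show ?thesis using e \<beta> by (auto simp: S'_def split: if_splits)
      next
        case False
        then have "e \<notin> incident G y" using y e(1) by auto
        then have "y \<notin> ends G e" using e(1) by (simp add: incident_def)
        moreover have "ends G e \<inter> S \<noteq> {} \<longrightarrow> ends G e \<subseteq> S"
          using S(3) e(1) False unfolding cut_closed_def by simp
        ultimately show ?thesis using e(2) by (auto simp: S'_def split: if_splits)
      qed
    qed
    have all: "verts G \<subseteq> S'" if "s \<in> S'" "s \<in> verts G" for s
      using connected_graphD[OF con clo] that by auto
    show "S = verts (del_edge G \<beta>)"
    proof (cases "z \<in> S")
      case True
      then have "verts G \<subseteq> insert y S" using all[of z] v by (auto simp: S'_def)
      with xy v \<alpha>(2) S(1) show ?thesis by auto
    next
      case False
      obtain s where s: "s \<in> S" using S by auto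
      show ?thesis
      proof (cases "s = y")
        case True
        then have "x \<in> S'" using xy s False \<alpha>(2) by (simp add: S'_def)
        then have "z \<in> S'" using all v by blast
        then show ?thesis using False by (simp add: S'_def)
      next
        case False
        then have "z \<in> S'" using all[of s] s S(1) v \<open>z \<notin> S\<close> by (auto simp: S'_def)
        then show ?thesis using \<open>z \<notin> S\<close> by (simp add: S'_def)
      qed
    qed
  qed
  then show ?thesis by (simp add: cyclic_edge_def)
qed

text \<open>Crossing a bridge \<open>\<beta>\<close> leads into a part of the current branch that no
  longer contains \<open>y\<close>. This is the decreasing measure for walks in trees.\<close>

lemma branch_psubset:
  assumes G: "finite_graph G" "connected_graph G"
    and \<alpha>: "\<alpha> \<in> edges G" "ends G \<alpha> = {x, y}"
    and \<beta>: "\<beta> \<in> edges G" "ends G \<beta> = {y, z}" "\<beta> \<noteq> \<alpha>" "\<not> cyclic_edge G \<beta>"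
  shows "verts (branch G z \<beta>) \<subset> verts (branch G y \<alpha>)"
proof -
  let ?A = "verts (branch G y \<alpha>)" and ?B = "verts (branch G z \<beta>)"
  have v: "y \<in> verts G" "z \<in> verts G" using finite_graph_ends[OF G(1) \<beta>(1)] \<beta>(2) by auto
  have y: "y \<notin> ?B" using noncyclic_iff[OF G \<beta>(1,2)] \<beta>(4) by simp
  have cA: "cut_closed (del_edge G \<alpha>) ?A" and cB: "cut_closed (del_edge G \<beta>) ?B"
    using cut_closed_branch[OF G(1)] by auto
  have yA: "y \<in> ?A" by (rule branch_self[OF v(1)])
  then have "z \<in> ?A" using cA \<beta> unfolding cut_closed_def by auto
  moreover have "cut_closed (del_edge G \<beta>) (?A \<inter> ?B)"
    unfolding cut_closed_def
  proof (intro ballI impI)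
    fix e assume e: "e \<in> edges (del_edge G \<beta>)" "ends (del_edge G \<beta>) e \<inter> (?A \<inter> ?B) \<noteq> {}"
    then have "ends G e \<subseteq> ?B" using cB unfolding cut_closed_def by auto
    \<comment> \<open>An edge inside \<open>?B\<close> avoids \<open>y\<close>, hence is not
      \<open>\<alpha>\<close>, and so cannot leave \<open>?A\<close>.\<close>
    moreover from this have "e \<noteq> \<alpha>" using y \<alpha>(2) by auto
    then have "ends G e \<subseteq> ?A" using cA e unfolding cut_closed_def by auto
    ultimately show "ends (del_edge G \<beta>) e \<subseteq> ?A \<inter> ?B" by simp
  qed
  ultimately have "?B \<subseteq> ?A \<inter> ?B" using branch_self[OF v(2)] by (intro branch_subset) auto
  with yA y show ?thesis by blast
qed

section \<open>Acyclic graphs\<close>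

definition acyclic_graph :: "('v, 'e) graph \<Rightarrow> bool" where
  "acyclic_graph G \<longleftrightarrow> (\<forall>e\<in>edges G. \<not> cyclic_edge G e)"

lemma acyclic_ends_card:
  assumes "finite_graph G" "connected_graph G" "acyclic_graph G" "e \<in> edges G"
  shows "card (ends G e) = 2"
proof (rule ccontr)
  assume "card (ends G e) \<noteq> 2"
  then have "card (ends G e) = 1" using assms by (auto simp: finite_graph_def)
  then obtain x where "ends G e = {x}" by (rule card_1_singletonE)
  then show False using loop_cyclic[OF assms(1,2,4)] assms(3,4) by (simp add: acyclic_graph_def)
qed

lemma acyclic_ends_neq:
  assumes "finite_graph G" "connected_graph G" "acyclic_graph G" "e \<in> edges G" "ends G e = {x, y}"
  shows "x \<noteq> y"
  using acyclic_ends_card[OF assms(1-4)] assms(5) by auto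

text \<open>Induction along directed edges: for an edge crossed from \<open>x\<close> to
  \<open>y\<close> the property may be assumed for all edges leading on from \<open>y\<close>. The
  branch ahead shrinks at each crossing because every edge is a bridge.\<close>

lemma acyclic_walk_induct:
  assumes G: "finite_graph G" "connected_graph G" "acyclic_graph G"
    and \<alpha>: "\<alpha> \<in> edges G" "ends G \<alpha> = {x, y}"
    and step: "\<And>\<alpha> x y. \<alpha> \<in> edges G \<Longrightarrow> ends G \<alpha> = {x, y} \<Longrightarrow> x \<noteq> y \<Longrightarrow>
      (\<And>\<beta> z. \<beta> \<in> edges G \<Longrightarrow> \<beta> \<noteq> \<alpha> \<Longrightarrow> ends G \<beta> = {y, z} \<Longrightarrow> y \<noteq> z \<Longrightarrow> P \<beta> y z) \<Longrightarrow> P \<alpha> x y"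
  shows "P \<alpha> x y"
  using \<alpha>
proof (induction "card (verts (branch G y \<alpha>))" arbitrary: \<alpha> x y rule: less_induct)
  case less
  show ?case
  proof (rule step[OF less.prems acyclic_ends_neq[OF G less.prems]])
    fix \<beta> z assume \<beta>: "\<beta> \<in> edges G" "\<beta> \<noteq> \<alpha>" "ends G \<beta> = {y, z}"
    have "verts (branch G z \<beta>) \<subset> verts (branch G y \<alpha>)"
      using branch_psubset[OF G(1,2) less.prems \<beta>(1,3,2)] G(3) \<beta>(1) by (simp add: acyclic_graph_def)
    then have "card (verts (branch G z \<beta>)) < card (verts (branch G y \<alpha>))"
      by (rule psubset_card_mono[OF finite_branch[OF G(1)]])
    then show "P \<beta> y z" using less.hyps \<beta> by blast
  qed
qed

section \<open>Paths\<close>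

text \<open>In this form an arm of n vertices visibly falls short of 2 by 2/(n+1), and monotonicity
  is immediate.\<close>

lemma rho_alt: "rho n = 2 - 2 / (real n + 1)"
  by (simp add: rho_def field_simps)

lemma rho_lt_2: "rho n < 2"
  by (simp add: rho_alt)

lemma rho_mono: "m \<le> n \<Longrightarrow> rho m \<le> rho n"
  by (simp add: rho_alt frac_le)

text \<open>\<open>rho 0 = 0\<close> lets an empty arm be treated like any other in the path
  formulas.\<close>

lemma rho_0 [simp]: "rho 0 = 0" and rho_1 [simp]: "rho 1 = 1" "rho (Suc 0) = 1"
  by (simp_all add: rho_def)

lemma rho_ge_1: "1 \<le> n \<Longrightarrow> 1 \<le> rho n"
  using rho_mono[of 1 n] by simp

text \<open>Real-valued counterpart of a summand of \<open>rho_degree\<close>, so that linear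
  arithmetic applies. The value of \<open>the_enat\<close> at infinity carries no information;
  contributions represent the degree where all weights are finite.\<close>

definition contrib :: "('v, 'e) graph \<Rightarrow> ('e \<Rightarrow> enat) \<Rightarrow> 'v \<Rightarrow> 'e \<Rightarrow> real" where
  "contrib G f x \<alpha> = real (the_enat (f \<alpha>)) * edge_deriv G f x \<alpha>"

lemma incident_other_end:
  assumes "finite_graph G" "\<alpha> \<in> incident G x"
  obtains y where "\<alpha> \<in> edges G" "ends G \<alpha> = {x, y}" "x \<in> verts G" "y \<in> verts G"
proof -
  have a: "\<alpha> \<in> edges G" "x \<in> ends G \<alpha>" using assms(2) by (auto simp: incident_def)
  obtain u v where "ends G \<alpha> = {u, v}" "u \<in> verts G" "v \<in> verts G" using ends_cases[OF assms(1) a(1)] .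
  then show thesis using that a by (cases "x = u") (auto simp: insert_commute)
qed

lemma edge_deriv_ge_1:
  assumes "finite_graph G" "connected_graph G" "\<alpha> \<in> incident G x"
  shows "1 \<le> edge_deriv G f x \<alpha>"
proof -
  obtain y where y: "\<alpha> \<in> edges G" "ends G \<alpha> = {x, y}"
    using incident_other_end[OF assms(1,3)] by metis
  show ?thesis
  proof (cases "x = y")
    case True
    then show ?thesis using edge_deriv_loop[OF assms(1,2) y(1)] y(2) by simp
  next
    case False
    then show ?thesis
      using edge_deriv_arm[OF assms(1,2) y False] edge_deriv_no_arm[OF assms(1,2) y False]
        rho_ge_1 chain_pos by (metis one_le_numeral)
  qed
qed

lemma edge_deriv_le_2:
  assumes "finite_graph G" "connected_graph G" "\<alpha> \<in> edges G" "ends G \<alpha> = {x, y}" "x \<noteq> y"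
  shows "edge_deriv G f x \<alpha> \<le> 2"
  using edge_deriv_arm[OF assms] edge_deriv_no_arm[OF assms] rho_lt_2
  by (metis order_less_imp_le order_refl)

lemma edge_deriv_leaf:
  assumes "finite_graph G" "connected_graph G" "ends G \<alpha> = {x, y}" "x \<noteq> y" "incident G y = {\<alpha>}"
  shows "edge_deriv G f x \<alpha> = 1"
proof -
  have "\<alpha> \<in> edges G" using assms(5) by (auto simp: incident_def)
  moreover have "arm G f \<alpha> y 1" using assms(5) by (intro chain.stop) (simp add: leaf_edge_def)
  ultimately show ?thesis using edge_deriv_arm[OF assms(1,2) _ assms(3,4)] by fastforce
qed

lemma rho_degree_finite:
  assumes "\<And>\<alpha>. \<alpha> \<in> incident G x \<Longrightarrow> f \<alpha> \<noteq> \<infinity>"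
  shows "rho_degree G f x = ereal (\<Sum>\<alpha>\<in>incident G x. contrib G f x \<alpha>)"
proof -
  have "ereal_of_enat (f \<alpha>) * ereal (edge_deriv G f x \<alpha>) = ereal (contrib G f x \<alpha>)"
    if "\<alpha> \<in> incident G x" for \<alpha>
    using assms[OF that] by (cases "f \<alpha>") (auto simp: contrib_def)
  then show ?thesis unfolding rho_degree_def by (simp flip: sum_ereal)
qed

lemma rho_degree_infinite:
  assumes "finite_graph G" "connected_graph G" "\<alpha> \<in> incident G x" "f \<alpha> = \<infinity>"
  shows "rho_degree G f x = \<infinity>"
proof -
  have "ereal_of_enat (f \<alpha>) * ereal (edge_deriv G f x \<alpha>) = \<infinity>"
    using edge_deriv_ge_1[OF assms(1-3), of f] assms(4) by simp
  then show ?thesis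
    unfolding rho_degree_def using assms(3) finite_incident[OF assms(1)] by (subst sum_Pinfty) blast
qed

section \<open>Arms and degrees on a weighted path\<close>

lemma arm_path_right_weights:
  assumes "arm (path_graph l) h \<alpha> y n" "y = Suc \<alpha>" "1 \<le> \<alpha>" "\<alpha> < l"
  shows "\<forall>k\<in>{Suc \<alpha>..<l}. h k = 1"
  using assms
proof (induction rule: chain.induct)
  case (stop \<alpha> y)
  then have "{\<alpha>, Suc \<alpha>} \<inter> {1..<l} = {\<alpha>}"
    using incident_path_graph[of y l] by (simp add: leaf_edge_def)
  moreover have "Suc \<alpha> \<in> {\<alpha>, Suc \<alpha>} \<inter> {1..<l}" if "Suc \<alpha> < l" using that by simp
  ultimately have "\<not> Suc \<alpha> < l" by (metis n_not_Suc_n singletonD)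
  then show ?case by auto
next
  case (step y \<alpha> \<beta> z n)
  have i: "{\<alpha>, Suc \<alpha>} \<inter> {1..<l} = {\<alpha>, \<beta>}"
    using incident_path_graph[of y l] step.hyps(1) step.prems by simp
  then have \<beta>: "\<beta> = Suc \<alpha>" "\<beta> < l" using step.hyps(2) by auto
  then have "z = Suc \<beta>" using step.hyps(3,4) step.prems by (auto simp: doubleton_eq_iff)
  then have "\<forall>k\<in>{Suc \<beta>..<l}. h k = 1" using step.IH \<beta> by simp
  moreover have "{Suc \<alpha>..<l} = insert \<beta> {Suc \<beta>..<l}" using \<beta> by auto
  ultimately show ?case using step.hyps(5) by simp
qed

text \<open>Read from left to right, an arm can only stop at vertex \<open>l\<close>, so its length
  is fixed and the only condition left is on the weights beyond edge \<open>i\<close>.\<close>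

lemma arm_path_right:
  assumes "1 \<le> i" "i < l"
  shows "arm (path_graph l) h i (Suc i) n \<longleftrightarrow> n = l - i \<and> (\<forall>k\<in>{Suc i..<l}. h k = 1)"
proof -
  have ex: "arm (path_graph l) h i (Suc i) (l - i)" if "\<forall>k\<in>{Suc i..<l}. h k = 1"
    using assms(2) assms(1) that
  proof (induction i rule: strict_inc_induct)
    case (base i)
    then have "leaf_edge (path_graph l) i (Suc i)"
      using incident_path_graph[of "Suc i" l] by (auto simp: leaf_edge_def)
    from chain.stop[of "leaf_edge (path_graph l)", OF this] base show ?case by simp
  next
    case (step i)
    have "arm (path_graph l) h (Suc i) (Suc (Suc i)) (l - Suc i)" using step by simp
    then have "arm (path_graph l) h i (Suc i) (Suc (l - Suc i))"
      using step incident_path_graph[of "Suc i" l]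
      by (intro chain.step[where \<beta> = "Suc i" and z = "Suc (Suc i)"]) auto
    then show ?case using step.hyps by (simp add: Suc_diff_Suc)
  qed
  then show ?thesis
    using arm_path_right_weights[of l h i "Suc i" n] arm_unique[of "path_graph l" h i "Suc i"] assms
    by blast
qed

lemma finite_graph_path: "1 \<le> l \<Longrightarrow> finite_graph (path_graph l)"
  by (auto simp: finite_graph_def card_insert_if)

text \<open>Obtained from \<open>arm_path_right\<close> by reversing the path. Edge \<open>i\<close>
  is now entered at its lower end \<open>i\<close>, so that the arm consists of the vertices 1 to
  \<open>i\<close>.\<close>

lemma arm_path_left:
  assumes "1 \<le> i" "i < l"
  shows "arm (path_graph l) h i i n \<longleftrightarrow> n = i \<and> (\<forall>k\<in>{1..<i}. h k = 1)"
proof -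
  let ?h = "\<lambda>k. h (l - k)"
  have fin: "finite_graph (path_graph l)" using assms by (intro finite_graph_path) simp
  have "arm (path_graph l) h i i n \<longleftrightarrow> arm (path_graph l) ?h (l - i) (Suc (l - i)) n"
  proof
    assume a: "arm (path_graph l) h i i n"
    have "arm (path_graph l) ?h (l - i) (Suc l - i) n"
      by (rule arm_iso[OF a _ path_graph_flip fin]) (use assms in auto)
    then show "arm (path_graph l) ?h (l - i) (Suc (l - i)) n" using assms by (simp add: Suc_diff_le)
  next
    assume a: "arm (path_graph l) ?h (l - i) (Suc (l - i)) n"
    have "arm (path_graph l) h (l - (l - i)) (Suc l - Suc (l - i)) n"
      by (rule arm_iso[OF a _ path_graph_flip fin]) (use assms in auto)
    then show "arm (path_graph l) h i i n" using assms by simp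
  qed
  also have "\<dots> \<longleftrightarrow> n = l - (l - i) \<and> (\<forall>k\<in>{Suc (l - i)..<l}. ?h k = 1)"
    using assms by (intro arm_path_right) auto
  also have "(\<forall>k\<in>{Suc (l - i)..<l}. ?h k = 1) \<longleftrightarrow> (\<forall>k\<in>{1..<i}. h k = 1)"
  proof
    assume r: "\<forall>k\<in>{Suc (l - i)..<l}. ?h k = 1"
    show "\<forall>k\<in>{1..<i}. h k = 1"
    proof
      fix k assume "k \<in> {1..<i}"
      then have "l - k \<in> {Suc (l - i)..<l}" "l - (l - k) = k" using assms by auto
      then show "h k = 1" using r by metis
    qed
  next
    assume r: "\<forall>k\<in>{1..<i}. h k = 1"
    show "\<forall>k\<in>{Suc (l - i)..<l}. ?h k = 1"
    proof
      fix k assume "k \<in> {Suc (l - i)..<l}"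
      then have "l - k \<in> {1..<i}" using assms by auto
      then show "?h k = 1" using r by blast
    qed
  qed
  finally show ?thesis using assms by simp
qed

text \<open>The degree of vertex \<open>i\<close> on a path with \<open>l\<close> vertices and
  weights \<open>k\<close>. Edge \<open>i - 1\<close> looks left over \<open>i - 1\<close> vertices,
  edge \<open>i\<close> looks right over \<open>l - i\<close>; a multiple edge strictly beyond
  either of them destroys that arm and replaces its \<open>rho\<close> by 2.\<close>

definition path_rho :: "nat \<Rightarrow> (nat \<Rightarrow> nat) \<Rightarrow> nat \<Rightarrow> real" where
  "path_rho l k i =
     (if 1 < i then k (i - 1) * (if \<forall>j\<in>{1..<i - 1}. k j = 1 then rho (i - 1) else 2) else 0) +
     (if i < l then k i * (if \<forall>j\<in>{Suc i..<l}. k j = 1 then rho (l - i) else 2) else 0)"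

lemma rho_degree_path:
  assumes con: "connected_graph (path_graph l)" and i: "1 \<le> i" "i \<le> l"
    and h: "\<And>j. j \<in> {1..<l} \<Longrightarrow> h j = enat (k j)"
  shows "rho_degree (path_graph l) h i = ereal (path_rho l k i)"
proof -
  let ?P = "path_graph l"
  have fin: "finite_graph ?P" using i by (intro finite_graph_path) simp
  have w: "h j = 1 \<longleftrightarrow> k j = 1" if "j \<in> {1..<l}" for j using h[OF that] by (simp add: one_enat_def)
  have R: "contrib ?P h i i = k i * (if \<forall>j\<in>{Suc i..<l}. k j = 1 then rho (l - i) else 2)" if il: "i < l"
  proof -
    have "edge_deriv ?P h i i = (if \<forall>j\<in>{Suc i..<l}. h j = 1 then rho (l - i) else 2)"
      using edge_deriv_arm[OF fin con, of i i "Suc i" h] edge_deriv_no_arm[OF fin con, of i i "Suc i" h]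
        arm_path_right[of i l h] i il by auto
    then show ?thesis using w h[of i] i il by (auto simp: contrib_def)
  qed
  have L: "contrib ?P h i (i - 1) = k (i - 1) * (if \<forall>j\<in>{1..<i - 1}. k j = 1 then rho (i - 1) else 2)" if il: "1 < i"
  proof -
    obtain m where m: "i = Suc m" "1 \<le> m" "m < l" using i il by (cases i) auto
    have e: "ends ?P m = {Suc m, m}" by auto
    have "edge_deriv ?P h (Suc m) m = (if \<forall>j\<in>{1..<m}. h j = 1 then rho m else 2)"
      using edge_deriv_arm[OF fin con _ e, of h] edge_deriv_no_arm[OF fin con _ e, of h]
        arm_path_left[of m l h] m by auto
    then show ?thesis using w h[of m] m by (auto simp: contrib_def)
  qed
  have inc: "incident ?P i = (if 1 < i then {i - 1} else {}) \<union> (if i < l then {i} else {})"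
    unfolding incident_path_graph[OF i] using i by auto
  have "rho_degree ?P h i = ereal (\<Sum>\<alpha>\<in>incident ?P i. contrib ?P h i \<alpha>)"
    using h by (intro rho_degree_finite) (auto simp: incident_def)
  also have "(\<Sum>\<alpha>\<in>incident ?P i. contrib ?P h i \<alpha>) = path_rho l k i"
    unfolding inc path_rho_def using R L by auto
  finally show ?thesis .
qed

text \<open>Connectedness of the model graphs is inherited along the isomorphism, which is why it
  appears as a hypothesis in the computations below.\<close>

lemma rho_image_path:
  assumes "f_iso G f (path_graph l) h" "finite_graph G" "connected_graph G" "1 \<le> l"
    and "\<And>j. j \<in> {1..<l} \<Longrightarrow> h j = enat (k j)"
  shows "rho_degree G f ` verts G = (\<lambda>i. ereal (path_rho l k i)) ` {1..l}"
  using f_iso_transfer[OF assms(1-3)] rho_degree_path[OF _ _ _ assms(5), of l] by (force intro!: image_cong)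

lemma path_rho_A: "path_rho l (\<lambda>_. 1) i < 4"
  using rho_lt_2[of "i - 1"] rho_lt_2[of "l - i"] by (simp add: path_rho_def)

text \<open>At vertex 1 the double edge enters an arm and gives \<open>2 * rho (l - 1)\<close>;
  everywhere else the left side gives at most 2 and the right side less than 2.\<close>

lemma path_rho_B:
  assumes "2 \<le> l" "1 \<le> i" "i \<le> l"
  shows "path_rho l ((\<lambda>_. 1)(1 := 2)) i < 4"
proof -
  consider "i = 1" | "i = 2" | "i > 2" using assms(2) by linarith
  then show ?thesis
    using assms rho_lt_2[of "l - i"] by cases (auto simp: path_rho_def)
qed

lemma path_rho_C:
  assumes "2 \<le> l" "1 \<le> i" "i \<le> Suc l"
  shows "path_rho (Suc l) ((\<lambda>_. 1)(1 := 2, l := 2)) i \<le> 4"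
    "path_rho (Suc l) ((\<lambda>_. 1)(1 := 2, l := 2)) 1 = 4"
proof -
  \<comment> \<open>The far double edge spoils the arm seen from vertex 1, whose only edge then
    counts 2 * 2.\<close>
  have b: "l \<in> {2..<Suc l}" using assms by auto
  consider "i = 1" | "i = Suc l" | "i = 2" "i = l" | "i = 2" "i < l" | "2 < i" "i = l" | "2 < i" "i < l"
    using assms by linarith
  then show "path_rho (Suc l) ((\<lambda>_. 1)(1 := 2, l := 2)) i \<le> 4"
    using assms rho_lt_2[of "l - i"] rho_lt_2[of "i - 1"] by cases (auto simp: path_rho_def)
  show "path_rho (Suc l) ((\<lambda>_. 1)(1 := 2, l := 2)) 1 = 4"
    using assms b by (auto simp: path_rho_def)
qed

text \<open>In order: \<open>F_4\<close>, \<open>G_2\<close>, then the extended \<open>G_2\<close>,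
  the extended \<open>F_4\<close> and \<open>BA_2\<close>, each of the last three with a vertex
  where 4 is attained.\<close>

lemma path_rho_small:
  "i \<in> {1..4} \<Longrightarrow> path_rho 4 ((\<lambda>_. 1)(2 := 2)) i < 4"
  "i \<in> {1..2} \<Longrightarrow> path_rho 2 ((\<lambda>_. 1)(1 := 3)) i < 4"
  "i \<in> {1..3} \<Longrightarrow> path_rho 3 ((\<lambda>_. 1)(2 := 3)) i \<le> 4" "path_rho 3 ((\<lambda>_. 1)(2 := 3)) 2 = 4"
  "i \<in> {1..5} \<Longrightarrow> path_rho 5 ((\<lambda>_. 1)(3 := 2)) i \<le> 4" "path_rho 5 ((\<lambda>_. 1)(3 := 2)) 3 = 4"
  "i \<in> {1..2} \<Longrightarrow> path_rho 2 ((\<lambda>_. 1)(1 := 4)) i \<le> 4" "path_rho 2 ((\<lambda>_. 1)(1 := 4)) 1 = 4"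
  by (force simp: path_rho_def rho_def le_Suc_eq numeral_eq_Suc)+

section \<open>Tripods, forks and cycles\<close>

definition arm_len :: "nat \<Rightarrow> nat \<Rightarrow> nat \<Rightarrow> nat \<Rightarrow> nat" where
  "arm_len p q r i = (if i = 1 then p else if i = 2 then q else r)"

lemma arm_len_simps [simp]:
  "arm_len p q r 1 = p" "arm_len p q r (Suc 0) = p" "arm_len p q r 2 = q" "arm_len p q r 3 = r"
  by (simp_all add: arm_len_def)

lemma tripod_simps:
  "edges (tripod p q r) = {(i, j). i \<in> {1, 2, 3} \<and> 1 \<le> j \<and> j \<le> arm_len p q r i}"
  "verts (tripod p q r) = insert (0, 0) (edges (tripod p q r))"
  "ends (tripod p q r) (i, j) = {(i, j), if j = 1 then (0, 0) else (i, j - 1)}"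
  by (auto simp: tripod_def arm_len_def Let_def)

lemma incident_tripod_centre:
  assumes "1 \<le> p" "1 \<le> q" "1 \<le> r"
  shows "incident (tripod p q r) (0, 0) = {(1, 1), (2, 1), (3, 1)}"
  using assms by (auto simp: incident_def tripod_simps split: if_splits)

lemma incident_tripod_arm:
  assumes "(i, j) \<in> edges (tripod p q r)"
  shows "incident (tripod p q r) (i, j) =
    {(i, j)} \<union> (if j < arm_len p q r i then {(i, Suc j)} else {})"
  using assms by (auto simp: incident_def tripod_simps split: if_splits)

lemma card_edges_tripod:
  "finite (edges (tripod p q r))" "card (edges (tripod p q r)) = p + q + r"
proof -
  have e: "edges (tripod p q r) = {1} \<times> {1..p} \<union> ({2} \<times> {1..q} \<union> {3} \<times> {1..r})"
    by (auto simp: tripod_def Let_def)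
  show "finite (edges (tripod p q r))" unfolding e by simp
  have d: "{1::nat} \<times> {1..p} \<inter> ({2} \<times> {1..q} \<union> {3} \<times> {1..r}) = {}" "{2::nat} \<times> {1..q} \<inter> {3} \<times> {1..r} = {}"
    by auto
  show "card (edges (tripod p q r)) = p + q + r"
    unfolding e using card_Un_disjoint[OF _ _ d(1)] card_Un_disjoint[OF _ _ d(2)]
    by (simp add: card_cartesian_product)
qed

lemma card_verts_tripod: "card (verts (tripod p q r)) = Suc (card (edges (tripod p q r)))"
  unfolding tripod_simps(2) using card_edges_tripod[of p q r] by (subst card_insert_disjoint) (auto simp: tripod_simps(1))

lemma ends_tripod:
  assumes "b \<in> edges (tripod p q r)"
  shows "ends (tripod p q r) b \<subseteq> verts (tripod p q r)" "card (ends (tripod p q r) b) = 2"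
  using assms by (cases b; auto simp: tripod_simps)+

lemma finite_graph_tripod: "finite_graph (tripod p q r)"
  using card_edges_tripod[of p q r] ends_tripod[of _ p q r]
  by (auto simp: finite_graph_def tripod_simps(2))

lemma arm_tripod:
  assumes "(i, j) \<in> edges (tripod p q r)"
  shows "arm (tripod p q r) unit_weight (i, j) (i, j) (Suc (arm_len p q r i - j))"
proof -
  have "j \<le> arm_len p q r i" using assms by (simp add: tripod_simps)
  then show ?thesis using assms
  proof (induction j rule: inc_induct)
    case base
    then have "leaf_edge (tripod p q r) (i, arm_len p q r i) (i, arm_len p q r i)"
      using incident_tripod_arm[OF base] by (simp add: leaf_edge_def)
    from chain.stop[of "leaf_edge (tripod p q r)", OF this] show ?case by simp
  next
    case (step j)
    let ?e = "(i, Suc j)"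
    have e: "?e \<in> edges (tripod p q r)" using step by (simp add: tripod_simps)
    show ?case
    proof (rule chain.step)
      show "incident (tripod p q r) (i, j) = {(i, j), ?e}"
        using incident_tripod_arm[OF step.prems] step.hyps by auto
      show "ends (tripod p q r) ?e = {(i, j), ?e}"
        using step.prems by (auto simp: tripod_simps)
      show "arm (tripod p q r) unit_weight ?e ?e (arm_len p q r i - j)"
        using step.IH[OF e] step.hyps by (simp add: Suc_diff_Suc)
    qed auto
  qed
qed

lemma one_ne_infinity [simp]: "(1::enat) \<noteq> \<infinity>" "the_enat 1 = 1"
  by (simp_all add: one_enat_def)

lemma edge_deriv_tripod_outward:
  assumes "connected_graph (tripod p q r)" "(i, j) \<in> edges (tripod p q r)"
  shows "edge_deriv (tripod p q r) unit_weight (if j = 1 then (0, 0) else (i, j - 1)) (i, j) =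
    rho (Suc (arm_len p q r i - j))"
  by (rule edge_deriv_arm[OF finite_graph_tripod assms _ _ arm_tripod[OF assms(2)]])
    (use assms(2) in \<open>(cases "j = 1"; auto simp: tripod_simps)+\<close>)

lemma rho_degree_tripod_centre:
  assumes "connected_graph (tripod p q r)" and pos: "1 \<le> p" "1 \<le> q" "1 \<le> r"
  shows "rho_degree (tripod p q r) unit_weight (0, 0) = ereal (rho p + rho q + rho r)"
proof -
  have "edge_deriv (tripod p q r) unit_weight (0, 0) (i, 1) = rho (arm_len p q r i)"
    if "i \<in> {1, 2, 3}" for i
  proof -
    have "(i, 1) \<in> edges (tripod p q r)" "1 \<le> arm_len p q r i"
      using that pos by (auto simp: tripod_simps)
    then show ?thesis using edge_deriv_tripod_outward[OF assms(1), of i 1] by simp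
  qed
  from this[of 1] this[of 2] this[of 3] show ?thesis
    using incident_tripod_centre[OF pos] by (simp add: rho_degree_finite contrib_def)
qed

text \<open>Away from the centre there are at most two edges: the outward one enters an arm and
  stays strictly below 2, the inward one gives at most 2.\<close>

lemma rho_degree_tripod_arm:
  assumes con: "connected_graph (tripod p q r)" and e: "(i, j) \<in> edges (tripod p q r)"
  shows "rho_degree (tripod p q r) unit_weight (i, j) < 4"
proof -
  let ?T = "tripod p q r"
  have "edge_deriv ?T unit_weight (i, j) (i, j) \<le> 2"
    by (rule edge_deriv_le_2[OF finite_graph_tripod con e, where y = "if j = 1 then (0, 0) else (i, j - 1)"])
      (use e in \<open>(cases "j = 1"; auto simp: tripod_simps)+\<close>)
  moreover have "edge_deriv ?T unit_weight (i, j) (i, Suc j) < 2" if "j < arm_len p q r i"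
  proof -
    have "(i, Suc j) \<in> edges ?T" using e that by (auto simp: tripod_simps)
    from edge_deriv_tripod_outward[OF con this] e rho_lt_2 show ?thesis by (simp add: tripod_simps)
  qed
  ultimately show ?thesis
    using incident_tripod_arm[OF e]
    by (cases "j < arm_len p q r i") (auto simp: rho_degree_finite contrib_def)
qed

lemma rho_image_tripod:
  assumes "f_iso G f (tripod p q r) unit_weight" "finite_graph G" "connected_graph G"
    and pos: "1 \<le> p" "1 \<le> q" "1 \<le> r"
  shows "ereal (rho p + rho q + rho r) \<in> rho_degree G f ` verts G"
    "\<And>t. t \<in> rho_degree G f ` verts G \<Longrightarrow> t = ereal (rho p + rho q + rho r) \<or> t < 4"
proof -
  note tr = f_iso_transfer[OF assms(1-3)]
  show "ereal (rho p + rho q + rho r) \<in> rho_degree G f ` verts G"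
    unfolding tr(3)[symmetric] using rho_degree_tripod_centre[OF tr(2) pos]
    by (force simp: tripod_simps(2))
  show "t = ereal (rho p + rho q + rho r) \<or> t < 4" if "t \<in> rho_degree G f ` verts G" for t
    using that rho_degree_tripod_centre[OF tr(2) pos] rho_degree_tripod_arm[OF tr(2)]
    unfolding tr(3)[symmetric] tripod_simps(2) by auto
qed

section \<open>Forks and double forks\<close>

lemma fork_graph_simps:
  "verts (fork_graph m) = {1..m} \<union> {m + 1, m + 2}"
  "edges (fork_graph m) = {1..<m} \<union> {m + 1, m + 2}"
  "ends (fork_graph m) b = (if b = m + 1 \<or> b = m + 2 then {1, b} else {b, Suc b})"
  by (auto simp: fork_graph_def add_leaf_def)

lemma double_fork_graph_simps:
  "verts (double_fork_graph m) = {1..m} \<union> {m + 1, m + 2, m + 3, m + 4}"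
  "edges (double_fork_graph m) = {1..<m} \<union> {m + 1, m + 2, m + 3, m + 4}"
  "ends (double_fork_graph m) b =
    (if b = m + 1 \<or> b = m + 2 then {1, b} else if b = m + 3 \<or> b = m + 4 then {m, b} else {b, Suc b})"
  by (auto simp: double_fork_graph_def add_leaf_def fork_graph_simps)

lemma incident_fork_graph:
  assumes "2 \<le> m"
  shows "incident (fork_graph m) 1 = {1, m + 1, m + 2}"
    "1 < i \<Longrightarrow> i < m \<Longrightarrow> incident (fork_graph m) i = {i - 1, i}"
    "incident (fork_graph m) m = {m - 1}"
    "i = m + 1 \<or> i = m + 2 \<Longrightarrow> incident (fork_graph m) i = {i}"
  using assms by (auto simp: incident_def fork_graph_simps split: if_splits)

lemma in_incident_double_fork_graph:
  "b \<in> incident (double_fork_graph m) i \<longleftrightarrow>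
    1 \<le> b \<and> b < m \<and> (i = b \<or> i = Suc b) \<or> (b = m + 1 \<or> b = m + 2) \<and> (i = 1 \<or> i = b) \<or>
    (b = m + 3 \<or> b = m + 4) \<and> (i = m \<or> i = b)"
  by (simp add: incident_def double_fork_graph_simps)

lemma incident_double_fork_graph:
  assumes "2 \<le> m"
  shows "incident (double_fork_graph m) 1 = {1, m + 1, m + 2}"
    "1 < i \<Longrightarrow> i < m \<Longrightarrow> incident (double_fork_graph m) i = {i - 1, i}"
    "incident (double_fork_graph m) m = {m - 1, m + 3, m + 4}"
    "i \<in> {m + 1, m + 2, m + 3, m + 4} \<Longrightarrow> incident (double_fork_graph m) i = {i}"
  using assms unfolding set_eq_iff in_incident_double_fork_graph insert_iff empty_iff by presburger+

lemma incident_double_fork_graph_1: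
  "incident (double_fork_graph 1) 1 = {2, 3, 4, 5}"
  "i \<in> {2, 3, 4, 5} \<Longrightarrow> incident (double_fork_graph 1) i = {i}"
proof -
  have "edges (double_fork_graph 1) = {2, 3, 4, 5}" by (simp add: double_fork_graph_simps eval_nat_numeral)
  moreover have "ends (double_fork_graph 1) b = {1, b}" if "b \<in> {2, 3, 4, 5}" for b
    using that by (elim insertE emptyE) (simp_all add: double_fork_graph_simps)
  ultimately have inc: "incident (double_fork_graph 1) i = {b \<in> {2, 3, 4, 5}. i \<in> {1, b}}" for i
    unfolding incident_def by blast
  show "incident (double_fork_graph 1) 1 = {2, 3, 4, 5}" unfolding inc by blast
  show "i \<in> {2, 3, 4, 5} \<Longrightarrow> incident (double_fork_graph 1) i = {i}" unfolding inc by auto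
qed

lemma fork_graph_tree:
  assumes "1 \<le> m"
  shows "finite (verts (fork_graph m))" "verts (fork_graph m) \<noteq> {}" "finite (edges (fork_graph m))"
    "card (verts (fork_graph m)) = Suc (card (edges (fork_graph m)))"
    "b \<in> edges (fork_graph m) \<Longrightarrow>
      ends (fork_graph m) b \<subseteq> verts (fork_graph m) \<and> card (ends (fork_graph m) b) = 2"
  using assms by (auto simp: fork_graph_simps card_Un_disjoint)

lemma double_fork_graph_tree:
  assumes "1 \<le> m"
  shows "finite (verts (double_fork_graph m))" "verts (double_fork_graph m) \<noteq> {}"
    "finite (edges (double_fork_graph m))"
    "card (verts (double_fork_graph m)) = Suc (card (edges (double_fork_graph m)))"
    "b \<in> edges (double_fork_graph m) \<Longrightarrow>
      ends (double_fork_graph m) b \<subseteq> verts (double_fork_graph m) \<and>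
      card (ends (double_fork_graph m) b) = 2"
  using assms by (auto simp: double_fork_graph_simps card_Un_disjoint)

text \<open>A walk descending the stem of a fork runs into the branch vertex \<open>1\<close>.\<close>

lemma no_arm_towards_fork:
  assumes "arm G h \<alpha> y n" "\<alpha> = y" "1 \<le> y" "y < m"
    and one: "incident G 1 = {1, a, b}" "a \<noteq> 1" "b \<noteq> 1" "a \<noteq> b"
    and stem: "\<And>i. 1 < i \<Longrightarrow> i < m \<Longrightarrow> incident G i = {i - 1, i}"
    and ends: "\<And>i. 1 \<le> i \<Longrightarrow> i < m \<Longrightarrow> ends G i = {i, Suc i}"
  shows False
  using assms(1-4)
proof (induction rule: chain.induct)
  case (stop \<alpha> y)
  then have inc: "incident G y = {y}" by (simp add: leaf_edge_def)
  show ?case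
  proof (cases "y = 1")
    case True
    then show False using inc one by (metis insertCI singletonD)
  next
    case False
    then have "y - 1 \<in> incident G y" "y - 1 \<noteq> y" using stem[of y] stop.prems by auto
    then show False using inc by simp
  qed
next
  case (step y \<alpha> \<beta> z n)
  have "y \<noteq> 1"
  proof
    assume "y = 1"
    then have "a = \<beta>" "b = \<beta>" using step.hyps(1) step.prems(1) one by blast+
    then show False using one by simp
  qed
  then have y: "1 < y" using step.prems by simp
  then have "{y, \<beta>} = {y - 1, y}" using step.hyps(1) step.prems stem[of y] by simp
  then have "\<beta> = y - 1" using y by (auto simp: doubleton_eq_iff)
  moreover from this have "z = y - 1" using step.hyps(3,4) ends[of "y - 1"] y step.prems
    by (auto simp: doubleton_eq_iff)
  moreover have "1 \<le> y - 1" "y - 1 < m" using y step.prems by linarith+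
  ultimately show ?case using step.IH by blast
qed

text \<open>The value 4 is attained at vertex \<open>m\<close>: two leaves give 1 each and the stem,
  which runs into the other fork, gives 2. For \<open>m = 1\<close> both forks share the vertex 1
  and four leaves give 4.\<close>

lemma rho_image_double_fork:
  assumes "f_iso G f (double_fork_graph m) unit_weight" "finite_graph G" "connected_graph G" and m: "1 \<le> m"
  shows "4 \<in> rho_degree G f ` verts G" "\<And>t. t \<in> rho_degree G f ` verts G \<Longrightarrow> t \<le> 4"
proof -
  let ?D = "double_fork_graph m" and ?h = "unit_weight :: nat \<Rightarrow> enat"
  note tr = f_iso_transfer[OF assms(1-3)]
  note tree = double_fork_graph_tree[OF m]
  have deg: "rho_degree ?D ?h x = ereal (\<Sum>b\<in>incident ?D x. edge_deriv ?D ?h x b)" for x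
    by (simp add: rho_degree_finite contrib_def)
  have le2: "edge_deriv ?D ?h x b \<le> 2" if b: "b \<in> incident ?D x" for x b
  proof -
    obtain y where y: "b \<in> edges ?D" "ends ?D b = {x, y}" by (rule incident_other_end[OF tr(1) b])
    then have "x \<noteq> y" using tree(5)[OF y(1)] by auto
    then show ?thesis using edge_deriv_le_2[OF tr(1,2) y] by simp
  qed
  have leaf: "edge_deriv ?D ?h x i = 1" if "i \<in> {m + 1, m + 2} \<and> x = 1 \<or> i \<in> {m + 3, m + 4} \<and> x = m" for x i
  proof (rule edge_deriv_leaf[OF tr(1,2)])
    show "ends ?D i = {x, i}" "x \<noteq> i" using that m by (auto simp: double_fork_graph_simps)
    show "incident ?D i = {i}"
    proof (cases "m = 1")
      case True
      then have "i \<in> {2, 3, 4, 5}" using that by auto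
      then show ?thesis unfolding True by (rule incident_double_fork_graph_1(2))
    next
      case False
      then show ?thesis using that m by (intro incident_double_fork_graph(4)) auto
    qed
  qed
  have *: "(\<exists>x\<in>verts ?D. rho_degree ?D ?h x = 4) \<and> (\<forall>x\<in>verts ?D. rho_degree ?D ?h x \<le> 4)"
  proof (cases "m = 1")
    case True
    have "rho_degree ?D ?h 1 = 4"
      unfolding deg using incident_double_fork_graph_1(1) leaf True by simp
    moreover have "rho_degree ?D ?h x \<le> 4" if "x \<in> {2, 3, 4, 5}" for x
      unfolding deg using incident_double_fork_graph_1(2)[OF that] le2[of x x] True by simp
    moreover have "verts ?D = {1, 2, 3, 4, 5}" using True by (auto simp: double_fork_graph_simps)
    ultimately show ?thesis by auto
  next
    case False
    then have m2: "2 \<le> m" using m by simp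
    note inc = incident_double_fork_graph[OF m2]
    have "edge_deriv ?D ?h m (m - 1) = 2"
    proof (rule edge_deriv_no_arm[OF tr(1,2)])
      show "ends ?D (m - 1) = {m, m - 1}" using m2 by (auto simp: double_fork_graph_simps)
      show "\<not> arm ?D ?h (m - 1) (m - 1) n" for n
        using no_arm_towards_fork[of ?D ?h "m - 1" "m - 1" n m "m + 1" "m + 2", OF _ refl _ _ inc(1) _ _ _ inc(2)] m2
          le_diff_conv2[of 1 m 1]
        by (auto simp: double_fork_graph_simps)
    qed (use m2 in \<open>auto simp: double_fork_graph_simps\<close>)
    moreover have "m - 1 \<noteq> m + 3" "m - 1 \<noteq> m + 4" by linarith+
    ultimately have "rho_degree ?D ?h m = 4" unfolding deg using inc(3) leaf m2 by simp
    moreover have "rho_degree ?D ?h 1 \<le> 4"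
      unfolding deg using inc(1) leaf m2 le2[of 1 1] by simp
    moreover have "rho_degree ?D ?h x \<le> 4" if "1 < x" "x < m" for x
      unfolding deg using inc(2)[OF that] le2[of x x] le2[of "x - 1" x] that by simp
    moreover have "rho_degree ?D ?h x \<le> 4" if "x \<in> {m + 1, m + 2, m + 3, m + 4}" for x
      unfolding deg using inc(4)[OF that] le2[of x x] by simp
    moreover have "x = 1 \<or> x = m \<or> (1 < x \<and> x < m) \<or> x \<in> {m + 1, m + 2, m + 3, m + 4}"
      if "x \<in> verts ?D" for x
      using that by (auto simp: double_fork_graph_simps)
    moreover have "m \<in> verts ?D" using m by (auto simp: double_fork_graph_simps)
    ultimately show ?thesis by (metis order_refl)
  qed
  show "4 \<in> rho_degree G f ` verts G" "\<And>t. t \<in> rho_degree G f ` verts G \<Longrightarrow> t \<le> 4"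
    unfolding tr(3)[symmetric] using * by (force, blast)
qed

text \<open>The value 4 is attained at the far vertex \<open>m\<close>, where the only edge is
  double and looks at the fork. Seen from its other end the double edge enters a leaf and costs 2,
  like a simple stem edge without an arm.\<close>

lemma rho_image_fork:
  assumes "f_iso G f (fork_graph m) (unit_weight(m - 1 := 2))" "finite_graph G" "connected_graph G"
    and m: "2 \<le> m"
  shows "4 \<in> rho_degree G f ` verts G" "\<And>t. t \<in> rho_degree G f ` verts G \<Longrightarrow> t \<le> 4"
proof -
  let ?D = "fork_graph m" and ?h = "unit_weight(m - 1 := 2) :: nat \<Rightarrow> enat"
  note tr = f_iso_transfer[OF assms(1-3)]
  note tree = fork_graph_tree[of m]
  note inc = incident_fork_graph[OF m]
  have the2: "the_enat 2 = 2" "(2::enat) \<noteq> \<infinity>" by (simp_all add: numeral_eq_enat)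
  have deg: "rho_degree ?D ?h x =
    ereal (\<Sum>b\<in>incident ?D x. (if b = m - 1 then 2 else 1) * edge_deriv ?D ?h x b)" for x
    by (subst rho_degree_finite) (auto simp: contrib_def the2 simp del: not_infinity_eq intro!: sum.cong)
  have le2: "edge_deriv ?D ?h x b \<le> 2" if b: "b \<in> incident ?D x" for x b
  proof -
    obtain y where y: "b \<in> edges ?D" "ends ?D b = {x, y}" by (rule incident_other_end[OF tr(1) b])
    then have "x \<noteq> y" using tree(5)[OF _ y(1)] m by auto
    then show ?thesis using edge_deriv_le_2[OF tr(1,2) y] by simp
  qed
  have leaf: "edge_deriv ?D ?h 1 i = 1" if "i \<in> {m + 1, m + 2}" for i
  proof (rule edge_deriv_leaf[OF tr(1,2)])
    show "ends ?D i = {1, i}" "1 \<noteq> i" using that m by (auto simp: fork_graph_simps)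
    show "incident ?D i = {i}" using inc(4) that by blast
  qed
  have stem: "edge_deriv ?D ?h (m - 1) (m - 1) = 1"
  proof (rule edge_deriv_leaf[OF tr(1,2) _ _ inc(3)])
    show "ends ?D (m - 1) = {m - 1, m}" using m by (auto simp: fork_graph_simps)
  qed (use m in simp)
  have "edge_deriv ?D ?h m (m - 1) = 2"
  proof (rule edge_deriv_no_arm[OF tr(1,2)])
    show "ends ?D (m - 1) = {m, m - 1}" using m by (auto simp: fork_graph_simps)
    show "\<not> arm ?D ?h (m - 1) (m - 1) n" for n
      using no_arm_towards_fork[of ?D ?h "m - 1" "m - 1" n m "m + 1" "m + 2", OF _ refl _ _ inc(1) _ _ _ inc(2)] m
        le_diff_conv2[of 1 m 1]
      by (auto simp: fork_graph_simps)
  qed (use m in \<open>auto simp: fork_graph_simps\<close>)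
  then have top: "rho_degree ?D ?h m = 4" unfolding deg using inc(3) by simp
  have one: "rho_degree ?D ?h 1 \<le> 4"
  proof -
    have ne: "1 \<noteq> m + 1" "1 \<noteq> m + 2" "m + 1 \<noteq> m - 1" "m + 2 \<noteq> m - 1" using m by linarith+
    \<comment> \<open>For \<open>m = 2\<close> the stem edge at vertex 1 is the double edge itself,
      hence the case distinction.\<close>
    have "(if 1 = m - 1 then 2 else 1) * edge_deriv ?D ?h 1 1 \<le> 2"
      using stem le2[of 1 1] inc(1) by (cases "1 = m - 1") auto
    then show ?thesis unfolding deg inc(1) using ne leaf[of "m + 1"] leaf[of "m + 2"] by simp
  qed
  have inner: "rho_degree ?D ?h x \<le> 4" if x: "1 < x" "x < m" for x
  proof -
    have ne: "x - 1 \<noteq> x" "x - 1 \<noteq> m - 1" using x by linarith+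
    have "(if x = m - 1 then 2 else 1) * edge_deriv ?D ?h x x \<le> 2"
      using stem le2[of x x] inc(2)[OF x] by (cases "x = m - 1") auto
    moreover have "edge_deriv ?D ?h x (x - 1) \<le> 2" using le2[of "x - 1" x] inc(2)[OF x] by blast
    ultimately show ?thesis unfolding deg inc(2)[OF x] using ne by simp
  qed
  have leaves: "rho_degree ?D ?h x \<le> 4" if "x = m + 1 \<or> x = m + 2" for x
    unfolding deg using inc(4)[OF that] le2[of x x] that by auto
  have "x = 1 \<or> x = m \<or> (1 < x \<and> x < m) \<or> (x = m + 1 \<or> x = m + 2)"
    if "x \<in> verts ?D" for x
    using that by (auto simp: fork_graph_simps)
  with top one inner leaves have "\<forall>x\<in>verts ?D. rho_degree ?D ?h x \<le> 4" by (metis order_refl)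
  moreover have "m \<in> verts ?D" using m by (auto simp: fork_graph_simps)
  ultimately show "4 \<in> rho_degree G f ` verts G" "\<And>t. t \<in> rho_degree G f ` verts G \<Longrightarrow> t \<le> 4"
    unfolding tr(3)[symmetric] using top by (force, blast)
qed

text \<open>The weak conclusion suffices in both uses: a cycle with at least two vertices has no
  leaf, and a tree with degrees at most two gets a vertex to start from.\<close>

lemma arm_imp_leaf: "arm G f \<alpha> y n \<Longrightarrow> \<exists>v e. incident G v = {e}"
  by (induction rule: chain.induct) (auto simp: leaf_edge_def)

section \<open>Cycles\<close>

lemma cycle_graph_simps:
  "verts (cycle_graph l) = {1..l}" "edges (cycle_graph l) = {1..l}"
  "ends (cycle_graph l) b = {b, if b = l then 1 else Suc b}"
  by (auto simp: cycle_graph_def)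

lemma incident_cycle_graph:
  assumes "1 \<le> x" "x \<le> l"
  shows "incident (cycle_graph l) x = {x, if x = 1 then l else x - 1}"
  using assms by (auto simp: incident_def cycle_graph_simps split: if_splits)

text \<open>For \<open>l = 1\<close> the loop counts 4. Otherwise each vertex meets two distinct
  edges, also in the two-vertex cycle with parallel edges, and neither enters an arm because there
  is no leaf.\<close>

lemma rho_image_cycle:
  assumes "f_iso G f (cycle_graph l) unit_weight" "finite_graph G" "connected_graph G" and l: "1 \<le> l"
  shows "rho_degree G f ` verts G = {4}"
proof -
  let ?C = "cycle_graph l" and ?h = "unit_weight :: nat \<Rightarrow> enat"
  note tr = f_iso_transfer[OF assms(1-3)]
  have deg: "rho_degree ?C ?h x = ereal (\<Sum>b\<in>incident ?C x. edge_deriv ?C ?h x b)" for x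
    by (simp add: rho_degree_finite contrib_def)
  have "rho_degree ?C ?h x = 4" if x: "1 \<le> x" "x \<le> l" for x
  proof (cases "l = 1")
    case True
    have "edge_deriv ?C ?h 1 1 = 4"
      using True by (intro edge_deriv_loop[OF tr(1,2)]) (auto simp: cycle_graph_simps)
    then show ?thesis unfolding deg incident_cycle_graph[OF x] using x True by simp
  next
    case False
    have two: "edge_deriv ?C ?h x b = 2" if b: "b \<in> incident ?C x" for b
    proof -
      obtain y where y: "b \<in> edges ?C" "ends ?C b = {x, y}"
        by (rule incident_other_end[OF tr(1) b])
      have "x \<noteq> y"
      proof
        assume "x = y"
        define c where "c = (if b = l then 1 else Suc b)"
        have "{b, c} = {x, y}" using y(2) unfolding cycle_graph_simps(3) c_def .
        then have "b = c" using \<open>x = y\<close> by (simp add: doubleton_eq_iff)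
        then show False using False by (simp add: c_def split: if_splits)
      qed
      moreover have "\<not> arm ?C ?h b y n" for n
      proof
        assume "arm ?C ?h b y n"
        from arm_imp_leaf[OF this] obtain v e where v: "incident ?C v = {e}" by (elim exE)
        then have "e \<in> edges ?C" "v \<in> ends ?C e" by (auto simp: incident_def)
        then have "1 \<le> v" "v \<le> l" using l by (auto simp: cycle_graph_simps split: if_splits)
        then have "v \<in> incident ?C v" "(if v = 1 then l else v - 1) \<in> incident ?C v"
          using incident_cycle_graph by auto
        then have "(if v = 1 then l else v - 1) = v" using v by (metis singletonD)
        then show False using False \<open>1 \<le> v\<close> by (cases "v = 1") auto
      qed
      ultimately show ?thesis by (rule edge_deriv_no_arm[OF tr(1,2) y])
    qed
    have "x \<noteq> (if x = 1 then l else x - 1)" using x False by auto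
    then show ?thesis unfolding deg using two incident_cycle_graph[OF x] by simp
  qed
  then show ?thesis unfolding tr(3)[symmetric] using l by (force simp: cycle_graph_simps)
qed

section \<open>The degrees of the schemes\<close>

lemma generates_dynkin_imp_lt:
  assumes dyn: "generates_dynkin G f" and G: "finite_graph G" "connected_graph G"
    and t: "t \<in> rho_degree G f ` verts G"
  shows "t < 4"
proof -
  have path: "t < 4" if iso: "f_iso G f (path_graph l) h" and l: "1 \<le> l" and h: "\<And>j. h j = enat (k j)"
    and lt: "\<And>i. 1 \<le> i \<Longrightarrow> i \<le> l \<Longrightarrow> path_rho l k i < 4" for l h k
  proof -
    have "t \<in> (\<lambda>i. ereal (path_rho l k i)) ` {1..l}" using rho_image_path[OF iso G l, of k] h t by simp
    then show ?thesis using lt by auto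
  qed
  have trip: "t < 4" if "f_iso G f (tripod p q r) unit_weight" "1 \<le> p" "1 \<le> q" "1 \<le> r"
    "rho p + rho q + rho r < 4" for p q r
    using rho_image_tripod(2)[OF that(1) G that(2-4) t] that(5) by auto
  consider (A) l where "l \<ge> 1" "f_iso G f (path_graph l) unit_weight"
    | (B) l where "l \<ge> 2" "f_iso G f (path_graph l) (unit_weight(1 := 2))"
    | (D) l where "l \<ge> 4" "f_iso G f (tripod 1 1 (l - 3)) unit_weight"
    | (E6) "f_iso G f (tripod 1 2 2) unit_weight"
    | (E7) "f_iso G f (tripod 1 2 3) unit_weight"
    | (E8) "f_iso G f (tripod 1 2 4) unit_weight"
    | (F4) "f_iso G f (path_graph 4) (unit_weight(2 := 2))"
    | (G2) "f_iso G f (path_graph 2) (unit_weight(1 := 3))"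
    using dyn unfolding generates_dynkin_def by blast
  then show ?thesis
  proof cases
    case A
    show ?thesis
      by (rule path[OF A(2,1), of "\<lambda>_. 1"]) (auto simp: one_enat_def path_rho_A[simplified])
  next
    case B
    show ?thesis
      by (rule path[OF B(2), of "(\<lambda>_. 1)(1 := 2)"])
        (use B(1) path_rho_B in \<open>auto simp: one_enat_def numeral_eq_enat\<close>)
  next
    case D
    show ?thesis using D(1) rho_lt_2[of "l - 3"] by (intro trip[OF D(2)]) auto
  next
    case E6
    show ?thesis by (rule trip[OF E6]) (auto simp: rho_def)
  next
    case E7
    show ?thesis by (rule trip[OF E7]) (auto simp: rho_def)
  next
    case E8
    show ?thesis by (rule trip[OF E8]) (auto simp: rho_def)
  next
    case F4
    show ?thesis
      by (rule path[OF F4, of "(\<lambda>_. 1)(2 := 2)"])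
        (use path_rho_small(1) in \<open>auto simp: one_enat_def numeral_eq_enat\<close>)
  next
    case G2
    show ?thesis
      by (rule path[OF G2, of "(\<lambda>_. 1)(1 := 3)"])
        (use path_rho_small(2) in \<open>auto simp: one_enat_def numeral_eq_enat\<close>)
  qed
qed

lemma generates_extended_dynkin_imp:
  assumes ext: "generates_extended_dynkin G f" and G: "finite_graph G" "connected_graph G"
  shows "4 \<in> rho_degree G f ` verts G \<and> (\<forall>t\<in>rho_degree G f ` verts G. t \<le> 4)" (is ?P)
proof -
  have path: ?P if iso: "f_iso G f (path_graph l) h" and h: "\<And>j. h j = enat (k j)"
    and le: "\<And>i. i \<in> {1..l} \<Longrightarrow> path_rho l k i \<le> 4" and i0: "i0 \<in> {1..l}" "path_rho l k i0 = 4" for l h k i0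
  proof -
    have "1 \<le> l" using i0 by auto
    from rho_image_path[OF iso G this, of k] h
    have im: "rho_degree G f ` verts G = (\<lambda>i. ereal (path_rho l k i)) ` {1..l}" by simp
    have "4 = ereal (path_rho l k i0)" using i0(2) by simp
    then show ?thesis unfolding im using le i0(1) by (auto intro: rev_image_eqI)
  qed
  \<comment> \<open>The extended tripods solve the equation exactly: 4/3 + 4/3 + 4/3, 1 + 3/2 + 3/2
    and 1 + 4/3 + 5/3.\<close>
  have trip: ?P if "f_iso G f (tripod p q r) unit_weight" "1 \<le> p" "1 \<le> q" "1 \<le> r"
    "rho p + rho q + rho r = 4" for p q r
  proof -
    note im = rho_image_tripod[OF that(1) G that(2-4)]
    have "ereal (rho p + rho q + rho r) = 4" using that(5) by simp
    then show ?thesis using im by (metis less_imp_le order_refl)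
  qed
  consider (A) l where "l \<ge> 1" "f_iso G f (cycle_graph l) unit_weight"
    | (C) l where "l \<ge> 2" "f_iso G f (path_graph (l + 1)) (unit_weight(1 := 2, l := 2))"
    | (D) l where "l \<ge> 4" "f_iso G f (double_fork_graph (l - 3)) unit_weight"
    | (B) l where "l \<ge> 3" "f_iso G f (fork_graph (l - 1)) (unit_weight(l - 2 := 2))"
    | (G2) "f_iso G f (path_graph 3) (unit_weight(2 := 3))"
    | (E6) "f_iso G f (tripod 2 2 2) unit_weight"
    | (E7) "f_iso G f (tripod 1 3 3) unit_weight"
    | (E8) "f_iso G f (tripod 1 2 5) unit_weight"
    | (F4) "f_iso G f (path_graph 5) (unit_weight(3 := 2))"
    | (BA) "f_iso G f (path_graph 2) (unit_weight(1 := 4))"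
    using ext unfolding generates_extended_dynkin_def by blast
  then show ?thesis
  proof cases
    case A
    show ?thesis using rho_image_cycle[OF A(2) G A(1)] by simp
  next
    case C
    show ?thesis
      by (rule path[OF C(2), of "(\<lambda>_. 1)(1 := 2, l := 2)" 1])
        (use C(1) path_rho_C in \<open>auto simp: one_enat_def numeral_eq_enat\<close>)
  next
    case D
    then show ?thesis using rho_image_double_fork[OF D(2) G] by auto
  next
    case B
    have "f_iso G f (fork_graph (l - 1)) (unit_weight(l - 1 - 1 := 2))"
      using B(2) by (simp add: numeral_2_eq_2)
    from rho_image_fork[OF this G] B(1) show ?thesis by auto
  next
    case G2
    show ?thesis
      by (rule path[OF G2, of "(\<lambda>_. 1)(2 := 3)" 2])
        (use path_rho_small(3,4) in \<open>auto simp: one_enat_def numeral_eq_enat\<close>)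
  next
    case E6
    show ?thesis by (rule trip[OF E6]) (auto simp: rho_def)
  next
    case E7
    show ?thesis by (rule trip[OF E7]) (auto simp: rho_def)
  next
    case E8
    show ?thesis by (rule trip[OF E8]) (auto simp: rho_def)
  next
    case F4
    show ?thesis
      by (rule path[OF F4, of "(\<lambda>_. 1)(3 := 2)" 3])
        (use path_rho_small(5,6) in \<open>auto simp: one_enat_def numeral_eq_enat\<close>)
  next
    case BA
    show ?thesis
      by (rule path[OF BA, of "(\<lambda>_. 1)(1 := 4)" 1])
        (use path_rho_small(7,8) in \<open>auto simp: one_enat_def numeral_eq_enat\<close>)
  qed
qed

section \<open>Weights on a path under the bound four\<close>

lemma rho_numeral: "rho 2 = 4/3" "rho 3 = 3/2" "rho 4 = 8/5" "rho 6 = 12/7"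
  by (simp_all add: rho_def)

lemma rho_ge_0: "0 \<le> rho n"
  using rho_mono[of 0 n] by simp

text \<open>A single edge of multiplicity \<open>K\<close> with \<open>m\<close> vertices on one
  side and \<open>n\<close> on the other; the last two hypotheses are the degree bounds at its ends.
  Bounding \<open>K * rho a\<close> alone limits \<open>K\<close> to 4 and, for \<open>K = 3\<close>
  and \<open>K = 4\<close>, the sizes; the remaining pairs are removed with the second
  summand.\<close>

lemma one_multiple_edge_cases:
  assumes K: "2 \<le> K" and mn: "1 \<le> m" "1 \<le> n"
    and le: "real K * rho n + rho (m - 1) \<le> 4" "real K * rho m + rho (n - 1) \<le> 4"
  shows "K = 2 \<and> (m = 1 \<or> n = 1 \<or> m = 2 \<and> n = 2 \<or> m = 2 \<and> n = 3 \<or> m = 3 \<and> n = 2) \<or>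
    K = 3 \<and> (m = 1 \<and> n = 1 \<or> m = 1 \<and> n = 2 \<or> m = 2 \<and> n = 1) \<or> K = 4 \<and> m = 1 \<and> n = 1"
proof -
  have bound: "real K * rho a \<le> 4" if "a \<le> m \<or> a \<le> n" for a
  proof -
    have "rho a \<le> rho m \<or> rho a \<le> rho n" using that rho_mono by blast
    then have "real K * rho a \<le> real K * rho m \<or> real K * rho a \<le> real K * rho n"
      by (auto intro: mult_left_mono)
    then show ?thesis using le rho_ge_0[of "m - 1"] rho_ge_0[of "n - 1"] by linarith
  qed
  have "real K \<le> 4" using bound[of 1] mn by simp
  then consider "K = 2" | "K = 3" | "K = 4" using K by linarith
  then show ?thesis
  proof cases
    case 1
    have "m = 1 \<or> n = 1 \<or> m = 2 \<and> n = 2 \<or> m = 2 \<and> n = 3 \<or> m = 3 \<and> n = 2"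
    proof (rule ccontr)
      assume "\<not> ?thesis"
      \<comment> \<open>Minimal pairs to exclude for \<open>K = 2\<close>: some degree would be at
        least 3 + 4/3 in the first case and at least 16/5 + 1 in the other two.\<close>
      then consider "3 \<le> m" "3 \<le> n" | "m = 2" "4 \<le> n" | "n = 2" "4 \<le> m" using mn by linarith
      then show False
      proof cases
        case 1
        then have "rho 3 \<le> rho n" "rho 2 \<le> rho (m - 1)" by (intro rho_mono; linarith)+
        then show False using le(1) \<open>K = 2\<close> by (simp add: rho_numeral)
      next
        case 2
        then show False using le(1) \<open>K = 2\<close> rho_mono[of 4 n] by (simp add: rho_numeral)
      next
        case 3
        then show False using le(2) \<open>K = 2\<close> rho_mono[of 4 m] by (simp add: rho_numeral)
      qed
    qed
    with 1 show ?thesis by blast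
  next
    case 2
    have "\<not> 3 \<le> m" "\<not> 3 \<le> n" using bound[of 3] 2 by (auto simp: rho_numeral)
    then have "m \<le> 2 \<and> n \<le> 2" by linarith
    moreover have "\<not> (m = 2 \<and> n = 2)" using le(1) 2 by (auto simp: rho_numeral)
    ultimately show ?thesis using 2 mn by (simp; linarith)
  next
    case 3
    have "\<not> 2 \<le> m" "\<not> 2 \<le> n" using bound[of 2] 3 by (auto simp: rho_numeral)
    then have "m \<le> 1 \<and> n \<le> 1" by linarith
    then show ?thesis using 3 mn by simp
  qed
qed

text \<open>A multiple edge \<open>j\<close> beyond an edge at \<open>i\<close> turns the
  contribution of that edge into twice its weight, and an edge on the opposite side of
  \<open>i\<close> adds at least 1.\<close>

lemma path_rho_parts:
  assumes "\<forall>j\<in>{1..<l}. 1 \<le> k j" "1 \<le> i" "i \<le> l"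
  shows "i < l \<Longrightarrow> j \<in> {Suc i..<l} \<Longrightarrow> k j \<noteq> 1 \<Longrightarrow> 1 < i \<Longrightarrow> 2 * real (k i) + 1 \<le> path_rho l k i"
    "i < l \<Longrightarrow> j \<in> {Suc i..<l} \<Longrightarrow> k j \<noteq> 1 \<Longrightarrow> 2 * real (k i) \<le> path_rho l k i"
    "1 < i \<Longrightarrow> j \<in> {1..<i - 1} \<Longrightarrow> k j \<noteq> 1 \<Longrightarrow> i < l \<Longrightarrow> 2 * real (k (i - 1)) + 1 \<le> path_rho l k i"
    "1 < i \<Longrightarrow> j \<in> {1..<i - 1} \<Longrightarrow> k j \<noteq> 1 \<Longrightarrow> 2 * real (k (i - 1)) \<le> path_rho l k i"
proof -
  define L where "L = (if 1 < i then k (i - 1) * (if \<forall>j\<in>{1..<i - 1}. k j = 1 then rho (i - 1) else 2) else 0)"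
  define R where "R = (if i < l then k i * (if \<forall>j\<in>{Suc i..<l}. k j = 1 then rho (l - i) else 2) else 0)"
  have LR: "path_rho l k i = L + R" by (simp add: path_rho_def L_def R_def)
  have prod: "1 \<le> real a * (if P then rho b else 2)" if "1 \<le> a" "1 \<le> b" for a b P
    using mult_mono[of 1 "real a" 1 "if P then rho b else 2"] that rho_ge_1[of b] by simp
  have L1: "1 \<le> L" if "1 < i"
  proof -
    have "i - 1 \<in> {1..<l}" using assms that by auto
    then show ?thesis using prod[of "k (i - 1)" "i - 1"] bspec[OF assms(1), of "i - 1"] that by (simp add: L_def)
  qed
  have R1: "1 \<le> R" if "i < l"
    using prod[of "k i" "l - i"] bspec[OF assms(1), of i] assms(2) that by (simp add: R_def)
  have L0: "0 \<le> L" using L1 by (cases "1 < i") (auto simp: L_def)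
  have R0: "0 \<le> R" using R1 by (cases "i < l") (auto simp: R_def)
  have Rbad: "R = 2 * real (k i)" if "i < l" "j \<in> {Suc i..<l}" "k j \<noteq> 1"
    using that by (auto simp: R_def)
  have Lbad: "L = 2 * real (k (i - 1))" if "1 < i" "j \<in> {1..<i - 1}" "k j \<noteq> 1"
    using that by (auto simp: L_def)
  show "i < l \<Longrightarrow> j \<in> {Suc i..<l} \<Longrightarrow> k j \<noteq> 1 \<Longrightarrow> 1 < i \<Longrightarrow> 2 * real (k i) + 1 \<le> path_rho l k i"
    unfolding LR using Rbad L1 by simp
  show "i < l \<Longrightarrow> j \<in> {Suc i..<l} \<Longrightarrow> k j \<noteq> 1 \<Longrightarrow> 2 * real (k i) \<le> path_rho l k i"
    unfolding LR using Rbad L0 by simp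
  show "1 < i \<Longrightarrow> j \<in> {1..<i - 1} \<Longrightarrow> k j \<noteq> 1 \<Longrightarrow> i < l \<Longrightarrow> 2 * real (k (i - 1)) + 1 \<le> path_rho l k i"
    unfolding LR using Lbad R1 by simp
  show "1 < i \<Longrightarrow> j \<in> {1..<i - 1} \<Longrightarrow> k j \<noteq> 1 \<Longrightarrow> 2 * real (k (i - 1)) \<le> path_rho l k i"
    unfolding LR using Lbad R0 by simp
qed

text \<open>Two multiple edges spoil each other's arms. Seen from its outer end each counts at least
  2 * 2, so it has weight two and no other edge fits at that end: both are end edges.\<close>

lemma two_multiple_edges:
  assumes k: "\<forall>j\<in>{1..<l}. 1 \<le> k j" and le: "\<forall>i\<in>{1..l}. path_rho l k i \<le> 4"
    and ij: "i \<in> {1..<l}" "j \<in> {1..<l}" "i < j" "k i \<noteq> 1" "k j \<noteq> 1"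
  shows "i = 1 \<and> k i = 2 \<and> Suc j = l \<and> k j = 2"
proof -
  have "1 \<le> k i" "1 \<le> k j" using k ij(1,2) by blast+
  then have k2: "2 \<le> k i" "2 \<le> k j" using ij(4,5) by linarith+
  have le_ij: "path_rho l k i \<le> 4" "path_rho l k (Suc j) \<le> 4" using le ij by auto
  note parts_i = path_rho_parts[where l = l and k = k and i = i and j = j, OF k]
  note parts_j = path_rho_parts[where l = l and k = k and i = "Suc j" and j = i, OF k]
  have "2 * real (k i) \<le> 4" using parts_i(2) le_ij ij by auto
  moreover have "2 * real (k j) \<le> 4" using parts_j(4) le_ij ij by auto
  moreover have "i = 1"
  proof (rule ccontr)
    assume "i \<noteq> 1"
    then have "1 < i" using ij(1) by simp
    then have "2 * real (k i) + 1 \<le> 4" using parts_i(1) le_ij ij by auto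
    then show False using k2 by linarith
  qed
  moreover have "Suc j = l"
  proof (rule ccontr)
    assume "Suc j \<noteq> l"
    then have "Suc j < l" using ij(2) by simp
    then have "2 * real (k j) + 1 \<le> 4" using parts_j(3) le_ij ij by auto
    then show False using k2 by linarith
  qed
  moreover have "real (k i) \<le> 2" "real (k j) \<le> 2" using calculation by linarith+
  ultimately show ?thesis using k2 ij by simp
qed

lemma path_weights_cases:
  assumes k_ge: "\<forall>j\<in>{1..<l}. 1 \<le> k j" and le_4: "\<forall>i\<in>{1..l}. path_rho l k i \<le> 4"
  obtains (none) "\<forall>j\<in>{1..<l}. k j = 1"
  | (one) i where "i \<in> {1..<l}" "\<forall>j\<in>{1..<l}. j \<noteq> i \<longrightarrow> k j = 1"
      "k i = 2 \<and> (i = 1 \<or> i = l - 1 \<or> l = 4 \<and> i = 2 \<or> l = 5 \<and> i = 2 \<or> l = 5 \<and> i = 3) \<or>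
       k i = 3 \<and> (l = 2 \<or> l = 3) \<or> k i = 4 \<and> l = 2"
  | (two) "3 \<le> l" "k 1 = 2" "k (l - 1) = 2" "\<forall>j\<in>{1..<l}. j \<noteq> 1 \<longrightarrow> j \<noteq> l - 1 \<longrightarrow> k j = 1"
proof (cases "\<exists>i\<in>{1..<l}. k i \<noteq> 1")
  case False
  then show thesis using none by blast
next
  case True

  from True obtain i where i: "i \<in> {1..<l}" "k i \<noteq> 1" by blast
  show thesis
  proof (cases "\<exists>j\<in>{1..<l}. j \<noteq> i \<and> k j \<noteq> 1")
    case True
    then obtain a b where ab: "a \<in> {1..<l}" "b \<in> {1..<l}" "a < b" "k a \<noteq> 1" "k b \<noteq> 1"
      using i by (metis linorder_neqE_nat)
    have r: "a = 1" "k 1 = 2" "Suc b = l" "k b = 2"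
      using two_multiple_edges[OF k_ge le_4 ab] by auto
    \<comment> \<open>A third multiple edge would, paired with edge 1, also have to be the last
      edge.\<close>
    have "k j = 1" if j: "j \<in> {1..<l}" "j \<noteq> 1" "j \<noteq> l - 1" for j
    proof (rule ccontr)
      assume "k j \<noteq> 1"
      moreover have "a < j" "j \<noteq> b" using j r by auto
      ultimately have "Suc j = l" using two_multiple_edges[OF k_ge le_4 ab(1) j(1)] ab by blast
      then show False using j by auto
    qed
    moreover have "b = l - 1" "3 \<le> l" using r ab by auto
    ultimately show thesis using r by (intro two) auto
  next
    case False
    then have one: "k j = 1" if "j \<in> {1..<l}" "j \<noteq> i" for j using that by blast
    have "i < l" "1 \<le> i" using i by auto
    \<comment> \<open>For \<open>i = 1\<close> the left summand is \<open>rho 0 = 0\<close>, and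
      likewise on the right for \<open>Suc i = l\<close>. Thus
      \<open>one_multiple_edge_cases\<close> applies with \<open>m = i\<close> and
      \<open>n = l - i\<close>.\<close>
    have "path_rho l k i = real (k i) * rho (l - i) + rho (i - 1)"
    proof (cases "i = 1")
      case False
      then have "i - 1 \<in> {1..<l}" "i - 1 \<noteq> i" using i(1) by auto
      then have "k (i - 1) = 1" by (rule one)
      then show ?thesis using i False one by (auto simp: path_rho_def)
    qed (use i one in \<open>auto simp: path_rho_def\<close>)
    moreover have "path_rho l k (Suc i) = real (k i) * rho i + rho (l - i - 1)"
    proof (cases "Suc i = l")
      case False
      then have "k (Suc i) = 1" using one[of "Suc i"] i by auto
      then show ?thesis using i False one by (auto simp: path_rho_def)
    qed (use i one in \<open>auto simp: path_rho_def\<close>)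
    ultimately have "real (k i) * rho (l - i) + rho (i - 1) \<le> 4" "real (k i) * rho i + rho (l - i - 1) \<le> 4"
      using bspec[OF le_4, of i] bspec[OF le_4, of "Suc i"] i by auto
    moreover have "1 \<le> k i" using k_ge i(1) by blast
    then have "2 \<le> k i" using i(2) by simp
    ultimately have "k i = 2 \<and> (i = 1 \<or> l - i = 1 \<or> i = 2 \<and> l - i = 2 \<or> i = 2 \<and> l - i = 3 \<or> i = 3 \<and> l - i = 2) \<or>
      k i = 3 \<and> (i = 1 \<and> l - i = 1 \<or> i = 1 \<and> l - i = 2 \<or> i = 2 \<and> l - i = 1) \<or> k i = 4 \<and> i = 1 \<and> l - i = 1"
      using \<open>i < l\<close> \<open>1 \<le> i\<close> by (intro one_multiple_edge_cases) auto
    moreover have "K = 2 \<and> (i = 1 \<or> l - i = 1 \<or> i = 2 \<and> l - i = 2 \<or> i = 2 \<and> l - i = 3 \<or> i = 3 \<and> l - i = 2) \<or>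
      K = 3 \<and> (i = 1 \<and> l - i = 1 \<or> i = 1 \<and> l - i = 2 \<or> i = 2 \<and> l - i = 1) \<or> K = 4 \<and> i = 1 \<and> l - i = 1 \<Longrightarrow>
      K = 2 \<and> (i = 1 \<or> i = l - 1 \<or> l = 4 \<and> i = 2 \<or> l = 5 \<and> i = 2 \<or> l = 5 \<and> i = 3) \<or>
       K = 3 \<and> (l = 2 \<or> l = 3) \<or> K = 4 \<and> l = 2" for K :: nat
      using \<open>i < l\<close> by presburger
    ultimately show thesis using one by (intro that(2)[OF i(1)]) auto
  qed
qed

lemma f_iso_path_flip: "1 \<le> l \<Longrightarrow> f_iso (path_graph l) h (path_graph l) (\<lambda>i. h (l - i))"
  unfolding f_iso_def using path_graph_flip[of l] by (intro exI conjI) auto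

lemma path_generates:
  assumes iso: "f_iso G f (path_graph l) (\<lambda>i. enat (k i))" and G: "finite_graph G" "connected_graph G" and l: "1 \<le> l"
    and k: "\<And>j. j \<in> {1..<l} \<Longrightarrow> 1 \<le> k j" and le: "\<And>x. x \<in> verts G \<Longrightarrow> rho_degree G f x \<le> 4"
  shows "generates_dynkin G f \<or> generates_extended_dynkin G f"
proof -
  have "path_rho l k i \<le> 4" if "i \<in> {1..l}" for i
  proof -
    have "ereal (path_rho l k i) \<in> rho_degree G f ` verts G"
      unfolding rho_image_path[OF iso G l refl] using that by blast
    then show ?thesis using le by (metis ereal_less_eq(3) imageE numeral_eq_ereal)
  qed
  then have le': "\<forall>i\<in>{1..l}. path_rho l k i \<le> 4" by blast
  have k': "\<forall>j\<in>{1..<l}. 1 \<le> k j" using k by blast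
  show ?thesis
  proof (cases rule: path_weights_cases[OF k' le', case_names none one two])
    case none
    then have "f_iso G f (path_graph l) unit_weight" using none
      by (intro f_iso_cong[OF iso G(1)]) (auto simp: one_enat_def)
    then show ?thesis using l by (auto simp: generates_dynkin_def)
  next
    case (one i)
    have w: "f_iso G f (path_graph l) (unit_weight(i := enat (k i)))"
      by (intro f_iso_cong[OF iso G(1)]) (use one(2) in \<open>auto simp: one_enat_def\<close>)
    \<comment> \<open>The asymmetric diagrams may be met in either orientation; reversing the path
      moves the multiple edge from \<open>i\<close> to \<open>l - i\<close>.\<close>
    have w': "f_iso G f (path_graph l) (unit_weight(l - i := enat (k i)))"
    proof (rule f_iso_cong[OF f_iso_trans[OF w f_iso_path_flip[OF l]] G(1)])
      show "(unit_weight(i := enat (k i))) (l - b) = (unit_weight(l - i := enat (k i))) b"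
        if "b \<in> edges (path_graph l)" for b using that one(1) by auto
    qed
    have "2 \<le> l" using one(1) by auto
    consider "k i = 2" "i = 1" | "k i = 2" "i = l - 1" | "k i = 2" "l = 4" "i = 2"
      | "k i = 2" "l = 5" "i = 2" | "k i = 2" "l = 5" "i = 3"
      | "k i = 3" "l = 2" | "k i = 3" "l = 3" | "k i = 4" "l = 2"
      using one(3) by blast
    then show ?thesis
    proof cases
      case 1
      then show ?thesis using w \<open>2 \<le> l\<close> by (auto simp: generates_dynkin_def numeral_eq_enat)
    next
      case 2
      then have "l - i = 1" using \<open>2 \<le> l\<close> by simp
      then show ?thesis using w' 2 \<open>2 \<le> l\<close> by (auto simp: generates_dynkin_def numeral_eq_enat)
    next
      case 3
      then show ?thesis using w by (auto simp: generates_dynkin_def numeral_eq_enat)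
    next
      case 4
      then show ?thesis using w' by (auto simp: generates_extended_dynkin_def numeral_eq_enat)
    next
      case 5
      then show ?thesis using w by (auto simp: generates_extended_dynkin_def numeral_eq_enat)
    next
      case 6
      then have "i = 1" using one(1) by auto
      then show ?thesis using w 6 by (auto simp: generates_dynkin_def numeral_eq_enat)
    next
      case 7
      then have "i = 1 \<or> i = 2" using one(1) by auto
      then show ?thesis using w w' 7 by (auto simp: generates_extended_dynkin_def numeral_eq_enat)
    next
      case 8
      then have "i = 1" using one(1) by auto
      then show ?thesis using w 8 by (auto simp: generates_extended_dynkin_def numeral_eq_enat)
    qed
  next
    case two
    have "f_iso G f (path_graph l) (unit_weight(1 := 2, l - 1 := 2))"
      by (intro f_iso_cong[OF iso G(1)]) (use two(2-4) in \<open>auto simp: one_enat_def numeral_eq_enat\<close>)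
    moreover have "l = (l - 1) + 1" "2 \<le> l - 1" using two(1) by auto
    ultimately have "\<exists>n\<ge>2. f_iso G f (path_graph (n + 1)) (unit_weight(1 := 2, n := 2))" by metis
    then show ?thesis by (auto simp: generates_extended_dynkin_def)
  qed
qed

section \<open>Two-regular graphs\<close>

lemma card_le_2_cases:
  assumes "finite A" "a \<in> A" "card A \<le> 2"
  shows "A = {a} \<or> (\<exists>b. b \<noteq> a \<and> A = {a, b})"
proof -
  have "card (A - {a}) \<le> 1" using assms by (simp add: card_Diff_singleton)
  then have "card (A - {a}) = 0 \<or> card (A - {a}) = 1" by linarith
  then consider "A - {a} = {}" | b where "A - {a} = {b}"
    using assms(1) by (metis card_0_eq card_1_singletonE finite_Diff)
  then show ?thesis using assms(2) by cases blast+
qed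

text \<open>Unit weights strip the arm of its weight condition, so only the shape matters: in a tree
  with degrees at most two every walk runs on until a leaf.\<close>

lemma acyclic_unit_arm:
  assumes G: "finite_graph G" "connected_graph G" "acyclic_graph G"
    and deg: "\<And>v. v \<in> verts G \<Longrightarrow> card (incident G v) \<le> 2"
    and \<alpha>: "\<alpha> \<in> edges G" "ends G \<alpha> = {x, y}"
  shows "\<exists>n. arm G unit_weight \<alpha> y n"
  using G \<alpha>
proof (rule acyclic_walk_induct)
  fix \<alpha> x y
  assume \<alpha>: "\<alpha> \<in> edges G" "ends G \<alpha> = {x, y}" "x \<noteq> y"
    and IH: "\<And>\<beta> z. \<beta> \<in> edges G \<Longrightarrow> \<beta> \<noteq> \<alpha> \<Longrightarrow> ends G \<beta> = {y, z} \<Longrightarrow> y \<noteq> z \<Longrightarrow>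
      \<exists>n. arm G unit_weight \<beta> z n"
  have y: "y \<in> verts G" using finite_graph_ends[OF G(1) \<alpha>(1)] \<alpha>(2) by simp
  have "\<alpha> \<in> incident G y" using \<alpha> by (simp add: incident_def)
  from card_le_2_cases[OF finite_incident[OF G(1)] this deg[OF y]]
  show "\<exists>n. arm G unit_weight \<alpha> y n"
  proof (elim disjE exE conjE)
    assume "incident G y = {\<alpha>}"
    then have "leaf_edge G \<alpha> y" by (simp add: leaf_edge_def)
    from chain.stop[of "leaf_edge G", OF this] show ?thesis by blast
  next
    fix \<beta> assume \<beta>: "\<beta> \<noteq> \<alpha>" "incident G y = {\<alpha>, \<beta>}"
    then have "\<beta> \<in> incident G y" by simp
    then obtain z where z: "\<beta> \<in> edges G" "ends G \<beta> = {y, z}" by (rule incident_other_end[OF G(1)])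
    have yz: "y \<noteq> z" by (rule acyclic_ends_neq[OF G z])
    obtain n where "arm G unit_weight \<beta> z n" using IH[OF z(1) \<beta>(1) z(2) yz] by blast
    then have "arm G unit_weight \<alpha> y (Suc n)" using \<beta> z yz by (intro chain.step[OF \<beta>(2)]) auto
    then show ?thesis by blast
  qed
qed

text \<open>After the deletion \<open>x\<close> has degree one, so its edge is a bridge. By
  \<open>cyclic_edge_exchange\<close> a bridge cannot be followed by a cyclic edge across a vertex
  of degree two, and connectedness spreads this over the whole graph.\<close>

lemma regular_del_edge_acyclic:
  assumes G: "finite_graph G" "connected_graph G"
    and deg: "\<And>v. v \<in> verts G \<Longrightarrow> card (incident G v) = 2"
    and ends2: "\<And>e. e \<in> edges G \<Longrightarrow> card (ends G e) = 2"
    and \<alpha>: "\<alpha> \<in> edges G" "cyclic_edge G \<alpha>" "ends G \<alpha> = {x, y}"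
  shows "acyclic_graph (del_edge G \<alpha>)"
proof -
  let ?H = "del_edge G \<alpha>"
  have H: "finite_graph ?H" "connected_graph ?H"
    using finite_graph_del_edge[OF G(1)] \<alpha>(2) by (auto simp: cyclic_edge_def)
  have v: "x \<in> verts G" using finite_graph_ends[OF G(1) \<alpha>(1)] \<alpha>(3) by simp
  define S where "S = {v. \<forall>e\<in>incident ?H v. \<not> cyclic_edge ?H e}"
  have "x \<in> S"
    unfolding S_def mem_Collect_eq
  proof
    fix e assume e: "e \<in> incident ?H x"
    have "\<alpha> \<in> incident G x" using \<alpha> by (simp add: incident_def)
    then have "card (incident ?H x) = 1"
      using deg[OF v] finite_incident[OF G(1)] by (simp add: card_Diff_singleton)
    then have inc: "incident ?H x = {e}" using e by (metis card_1_singletonE singletonD)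
    obtain z where z: "e \<in> edges ?H" "ends ?H e = {x, z}" by (rule incident_other_end[OF H(1) e])
    have "x \<noteq> z" using ends2[of e] z by auto
    \<comment> \<open>With its last edge removed \<open>x\<close> is isolated, so the other end of
      \<open>e\<close> cannot be reached from it.\<close>
    have "cut_closed (del_edge ?H e) {x}"
      using inc unfolding cut_closed_def incident_def by auto
    then have "verts (branch ?H x e) \<subseteq> {x}" by (rule branch_subset) simp
    then have "z \<notin> verts (branch ?H x e)" using \<open>x \<noteq> z\<close> by blast
    then show "\<not> cyclic_edge ?H e" using noncyclic_iff[OF H z(1), of z x] z(2) by (simp add: insert_commute)
  qed
  moreover have "cut_closed ?H S"
    unfolding cut_closed_def
  proof (intro ballI impI)
    fix e assume e: "e \<in> edges ?H" "ends ?H e \<inter> S \<noteq> {}"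
    then obtain a where a: "a \<in> ends G e" "a \<in> S" by auto
    have "e \<in> incident ?H a" using a e by (simp add: incident_def)
    then have nc: "\<not> cyclic_edge ?H e" using a(2) by (simp add: S_def)
    show "ends ?H e \<subseteq> S"
    proof
      fix b assume b: "b \<in> ends ?H e"
      show "b \<in> S"
      proof (cases "b = a")
        case False
        then have eab: "ends ?H e = {b, a}" using ends2[of e] e(1) a b by (auto simp: card_2_iff)
        have bv: "b \<in> verts G" using finite_graph_ends[OF G(1), of e] e(1) b by auto
        show ?thesis
          unfolding S_def mem_Collect_eq
        proof (intro ballI notI)
          fix g assume g: "g \<in> incident ?H b" "cyclic_edge ?H g"
          obtain w where w: "g \<in> edges ?H" "ends ?H g = {b, w}" by (rule incident_other_end[OF H(1) g(1)])
          have "g \<noteq> e" using g nc by blast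
          have "e \<in> incident ?H b" using e b by (simp add: incident_def)
          have "card (incident ?H b) \<le> 2"
            using deg[OF bv] card_mono[OF finite_incident[OF G(1)], of "incident ?H b" b] by auto
          from card_le_2_cases[OF finite_incident[OF H(1)] g(1) this]
          have "incident ?H b = {g, e}"
          proof
            assume "incident ?H b = {g}"
            then have "e \<in> {g}" using \<open>e \<in> incident ?H b\<close> by (simp only:)
            then show ?thesis using \<open>g \<noteq> e\<close> by simp
          next
            assume "\<exists>c. c \<noteq> g \<and> incident ?H b = {g, c}"
            then obtain c where c: "incident ?H b = {g, c}" by blast
            then have "e \<in> {g, c}" using \<open>e \<in> incident ?H b\<close> by (simp only:)
            then show ?thesis using \<open>g \<noteq> e\<close> c by simp
          qed
          moreover have "w \<noteq> b" using ends2[of g] w by auto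
          ultimately have "cyclic_edge ?H e"
            using cyclic_edge_exchange[OF H, of b g e w a] w eab False g(2) \<open>g \<noteq> e\<close>
            by (simp add: insert_commute)
          with nc show False ..
        qed
      qed (use a in simp)
    qed
  qed
  ultimately have all: "v \<in> S" if "v \<in> verts G" for v
    using connected_graphD[OF H(2), of S x v] that v by simp
  show ?thesis
    unfolding acyclic_graph_def
  proof
    fix e assume e: "e \<in> edges ?H"
    obtain a b where ab: "ends ?H e = {a, b}" "a \<in> verts ?H" using ends_cases[OF H(1) e] by metis
    have "e \<in> incident ?H a" using e ab by (auto simp: incident_def)
    then show "\<not> cyclic_edge ?H e" using all[of a] ab(2) unfolding S_def by simp
  qed
qed

text \<open>Deleting a cyclic edge of a 2-regular graph leaves a path between the ends of that edge.\<close>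

lemma regular_cyclic_is_cycle:
  assumes G: "finite_graph G" "connected_graph G"
    and deg: "\<And>v. v \<in> verts G \<Longrightarrow> card (incident G v) = 2"
    and ends2: "\<And>e. e \<in> edges G \<Longrightarrow> card (ends G e) = 2"
    and \<alpha>: "\<alpha> \<in> edges G" "cyclic_edge G \<alpha>"
  shows "\<exists>l\<ge>1. \<exists>\<phi> \<psi>. is_iso \<phi> \<psi> (cycle_graph l) G"
proof -
  let ?H = "del_edge G \<alpha>"
  obtain x y where xy: "ends G \<alpha> = {x, y}" "x \<in> verts G" "y \<in> verts G" using ends_cases[OF G(1) \<alpha>(1)] .
  have "x \<noteq> y" using ends2[OF \<alpha>(1)] xy by auto
  have H: "finite_graph ?H" "connected_graph ?H"
    using finite_graph_del_edge[OF G(1)] \<alpha>(2) by (auto simp: cyclic_edge_def)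
  have acyc: "acyclic_graph ?H" by (rule regular_del_edge_acyclic[OF G deg ends2 \<alpha> xy(1)])
  have degH: "card (incident ?H v) \<le> 2" if "v \<in> verts ?H" for v
    using deg[of v] that card_mono[OF finite_incident[OF G(1)], of "incident ?H v" v] by auto
  have "\<alpha> \<in> incident G x" using \<alpha> xy by (simp add: incident_def)
  then have "card (incident ?H x) = 1"
    using deg[OF xy(2)] finite_incident[OF G(1)] by (simp add: card_Diff_singleton)
  then obtain \<beta> where \<beta>: "incident ?H x = {\<beta>}" by (rule card_1_singletonE)
  then have "\<beta> \<in> incident ?H x" by simp
  then obtain z where z: "\<beta> \<in> edges ?H" "ends ?H \<beta> = {x, z}" by (rule incident_other_end[OF H(1)])
  have "x \<noteq> z" using ends2[of \<beta>] z by auto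
  obtain n where arm: "arm ?H unit_weight \<beta> z n"
    using acyclic_unit_arm[OF H acyc degH z] by blast
  obtain u e where ue: "e 0 = \<beta>" "u 0 = x" "u 1 = z"
    "\<And>i. i < n \<Longrightarrow> ends ?H (e i) = {u i, u (Suc i)}"
    "\<And>i. 0 < i \<Longrightarrow> i < n \<Longrightarrow> incident ?H (u i) = {e (i - 1), e i}"
    "incident ?H (u n) = {e (n - 1)}" and inj: "inj_on u {..n}" "inj_on e {..<n}"
    using arm_seq[OF arm z(2) \<open>x \<noteq> z\<close> z(1)] by metis
  have n: "1 \<le> n" by (rule chain_pos[OF arm])
  have inc: "incident ?H (u i) \<subseteq> e ` {..<n} \<and> incident ?H (u i) \<noteq> {}" if i: "i \<le> n" for i
  proof -
    consider "i = 0" | "0 < i" "i < n" | "i = n" using i by linarith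
    then show ?thesis
    proof cases
      case 1
      then show ?thesis using \<beta> ue(1,2) n by auto
    next
      case 2
      then have "e (i - 1) \<in> e ` {..<n}" "e i \<in> e ` {..<n}" by auto
      then show ?thesis using ue(5)[OF 2] by simp
    next
      case 3
      then show ?thesis using ue(6) n by auto
    qed
  qed
  have eH: "e i \<in> edges ?H" if "i < n" for i
  proof (cases "i = 0")
    case False
    then have "e i \<in> incident ?H (u i)" using ue(5)[of i] that by simp
    then show ?thesis by (simp add: incident_def)
  qed (use z ue in simp)
  have uv: "u i \<in> verts G" if "i \<le> n" for i
  proof -
    obtain b where "b \<in> incident ?H (u i)" using inc[OF \<open>i \<le> n\<close>] by blast
    then show ?thesis by (rule incident_other_end[OF H(1)]) simp
  qed
  \<comment> \<open>The walk stops at a vertex that lost an edge by the deletion; it is not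
    \<open>x\<close>, so it is \<open>y\<close>.\<close>
  have "card (incident ?H (u n)) = 1" using ue(6) by simp
  moreover have "card (incident G (u n)) = 2" by (rule deg[OF uv[OF order_refl]])
  ultimately have "incident ?H (u n) \<noteq> incident G (u n)" by (metis numeral_eq_one_iff semiring_norm(85))
  then have "\<alpha> \<in> incident G (u n)" unfolding del_edge_simps by blast
  then have "u n \<in> {x, y}" using xy by (simp add: incident_def)
  moreover have "u n \<noteq> x" using inj_onD[OF inj(1), of 0 n] ue(2) n by auto
  ultimately have un: "u n = y" by simp
  \<comment> \<open>The visited vertices exhaust \<open>G\<close>: all edges at them,
    \<open>\<alpha>\<close> included, stay among them.\<close>
  have "cut_closed G (u ` {..n})"
    unfolding cut_closed_def
  proof (intro ballI impI)
    fix b assume b: "b \<in> edges G" "ends G b \<inter> u ` {..n} \<noteq> {}"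
    show "ends G b \<subseteq> u ` {..n}"
    proof (cases "b = \<alpha>")
      case True
      have "u 0 \<in> u ` {..n}" "u n \<in> u ` {..n}" by auto
      then show ?thesis using True xy un ue(2) by simp
    next
      case False
      obtain i where i: "i \<le> n" "u i \<in> ends G b" using b(2) by auto
      then have "b \<in> incident ?H (u i)" using b(1) False by (simp add: incident_def)
      then obtain j where "j < n" "b = e j" using inc[OF i(1)] by auto
      then show ?thesis using ue(4)[of j] by auto
    qed
  qed
  then have cover: "verts G = u ` {..n}"
    using connected_graphD[OF G(2), of "u ` {..n}" x] uv xy(2) ue(2) by force
  have "edges G \<subseteq> insert \<alpha> (e ` {..<n})"
  proof
    fix b assume b: "b \<in> edges G"
    show "b \<in> insert \<alpha> (e ` {..<n})"
    proof (cases "b = \<alpha>")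
      case False
      obtain v w where "ends G b = {v, w}" "v \<in> verts G" using ends_cases[OF G(1) b] by metis
      then obtain i where "i \<le> n" "u i \<in> ends G b" using cover by auto
      then have "b \<in> incident ?H (u i)" using b False by (simp add: incident_def)
      then show ?thesis using inc[OF \<open>i \<le> n\<close>] by auto
    qed simp
  qed
  then have edges: "edges G = insert \<alpha> (e ` {..<n})" using eH \<alpha>(1) by auto
  have \<alpha>_new: "\<alpha> \<notin> e ` {..<n}" using eH by auto
  \<comment> \<open>The cycle is numbered from 1 whereas the walk starts at 0; the closing edge
    \<open>Suc n\<close> is \<open>\<alpha>\<close>.\<close>
  let ?\<phi> = "\<lambda>i. u (i - 1)" and ?\<psi> = "\<lambda>i. if i = Suc n then \<alpha> else e (i - 1)"
  have "is_iso ?\<phi> ?\<psi> (cycle_graph (Suc n)) G"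
    unfolding is_iso_def
  proof (intro conjI ballI)
    have sh: "bij_betw (\<lambda>i. i - 1) {1..Suc n} {..n}"
      by (rule bij_betw_byWitness[where f' = Suc]) auto
    have "bij_betw u {..n} (verts G)" using inj cover by (simp add: bij_betw_def)
    from bij_betw_trans[OF sh this] show "bij_betw ?\<phi> (verts (cycle_graph (Suc n))) (verts G)"
      by (simp add: cycle_graph_simps comp_def)
    have sh: "bij_betw (\<lambda>i. i - 1) {1..n} {..<n}"
      by (rule bij_betw_byWitness[where f' = Suc]) auto
    have "bij_betw e {..<n} (e ` {..<n})" using inj by (simp add: bij_betw_def)
    from bij_betw_trans[OF sh this] have "bij_betw ?\<psi> {1..n} (e ` {..<n})"
      by (subst bij_betw_cong[where g = "e \<circ> (\<lambda>i. i - 1)"]) auto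
    moreover have "bij_betw ?\<psi> {Suc n} {\<alpha>}" by (simp add: bij_betw_def)
    ultimately have "bij_betw ?\<psi> ({1..n} \<union> {Suc n}) (e ` {..<n} \<union> {\<alpha>})"
      using \<alpha>_new by (intro bij_betw_combine) auto
    moreover have "{1..n} \<union> {Suc n} = {1..Suc n}" by auto
    ultimately show "bij_betw ?\<psi> (edges (cycle_graph (Suc n))) (edges G)"
      by (simp add: cycle_graph_simps edges)
    fix i assume i: "i \<in> edges (cycle_graph (Suc n))"
    show "ends G (?\<psi> i) = ?\<phi> ` ends (cycle_graph (Suc n)) i"
    proof (cases "i = Suc n")
      case True
      then show ?thesis using xy ue(2) un by (auto simp: cycle_graph_simps)
    next
      case False
      then show ?thesis using i ue(4)[of "i - 1"] by (auto simp: cycle_graph_simps)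
    qed
  qed
  then show ?thesis by (intro exI[of _ "Suc n"]) auto
qed

section \<open>Recognising the tree-shaped schemes\<close>

lemma incident_vert: "finite_graph G \<Longrightarrow> \<alpha> \<in> incident G x \<Longrightarrow> x \<in> verts G"
  using finite_graph_ends by (fastforce simp: incident_def)

text \<open>The form in which coverings are used: for every model it remains to compare incidence
  sets vertex by vertex. Nonempty incidence sets put the images \<open>\<phi> a\<close> among the
  vertices of \<open>G\<close>.\<close>

lemma acyclic_covering_is_iso:
  assumes H: "finite (verts H)" "verts H \<noteq> {}" "finite (edges H)" "card (verts H) = Suc (card (edges H))"
    and H_ends: "\<And>b. b \<in> edges H \<Longrightarrow> ends H b \<subseteq> verts H \<and> card (ends H b) = 2"
    and G: "finite_graph G" "connected_graph G" "acyclic_graph G"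
    and \<psi>: "\<And>a. a \<in> verts H \<Longrightarrow> incident H a \<noteq> {} \<and> bij_betw \<psi> (incident H a) (incident G (\<phi> a))"
    and ends: "\<And>b. b \<in> edges H \<Longrightarrow> ends G (\<psi> b) = \<phi> ` ends H b"
  shows "is_iso \<phi> \<psi> H G"
proof (rule covering_is_iso[OF H H_ends G(1,2) acyclic_ends_card[OF G]])
  show "\<phi> a \<in> verts G" if a: "a \<in> verts H" for a
  proof -
    obtain b where "b \<in> incident H a" using \<psi>[OF a] by blast
    then have "\<psi> b \<in> incident G (\<phi> a)" using \<psi>[OF a] by (auto simp: bij_betw_def)
    then show ?thesis by (rule incident_vert[OF G(1)])
  qed
qed (use \<psi> ends in auto)

lemma bij_betw_doubleton: "f a \<noteq> f b \<Longrightarrow> bij_betw f {a, b} {f a, f b}"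
  by (auto simp: bij_betw_def)

lemma bij_betw_tripleton: "f a \<noteq> f b \<Longrightarrow> f a \<noteq> f c \<Longrightarrow> f b \<noteq> f c \<Longrightarrow> bij_betw f {a, b, c} {f a, f b, f c}"
  by (auto simp: bij_betw_def)

lemma bij_betw_singleton: "bij_betw f {a} {f a}"
  by (auto simp: bij_betw_def)

lemma incident_path_graph_Suc:
  assumes "1 \<le> n"
  shows "incident (path_graph (Suc n)) 1 = {1}"
    "1 < i \<Longrightarrow> i \<le> n \<Longrightarrow> incident (path_graph (Suc n)) i = {i - 1, i}"
    "incident (path_graph (Suc n)) (Suc n) = {n}"
  using assms by (auto simp: incident_def)

text \<open>An arm entered from a leaf is the whole graph, since no further edge leaves it
  anywhere.\<close>

lemma pendant_arm_is_path:
  assumes G: "finite_graph G" "connected_graph G" "acyclic_graph G"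
    and x: "incident G x = {\<alpha>}" and \<alpha>: "ends G \<alpha> = {x, y}" and arm: "arm G f \<alpha> y n"
  shows "\<exists>\<phi> \<psi>. is_iso \<phi> \<psi> (path_graph (Suc n)) G"
proof -
  have \<alpha>E: "\<alpha> \<in> edges G" using x by (auto simp: incident_def)
  have xy: "x \<noteq> y" by (rule acyclic_ends_neq[OF G \<alpha>E \<alpha>])
  obtain u e where ue: "e 0 = \<alpha>" "u 0 = x"
    "\<And>i. i < n \<Longrightarrow> ends G (e i) = {u i, u (Suc i)}"
    "\<And>i. 0 < i \<Longrightarrow> i < n \<Longrightarrow> incident G (u i) = {e (i - 1), e i}"
    "incident G (u n) = {e (n - 1)}" "inj_on e {..<n}"
    using arm_seq[OF arm \<alpha> xy \<alpha>E] by metis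
  have n: "1 \<le> n" by (rule chain_pos[OF arm])
  let ?P = "path_graph (Suc n)" and ?\<phi> = "\<lambda>i. u (i - 1)" and ?\<psi> = "\<lambda>i. e (i - 1)"
  have "is_iso ?\<phi> ?\<psi> ?P G"
  proof (rule acyclic_covering_is_iso[OF _ _ _ _ _ G])
    fix i assume i: "i \<in> verts ?P"
    consider "i = 1" | "1 < i" "i \<le> n" | "i = Suc n" using i by auto linarith
    then show "incident ?P i \<noteq> {} \<and> bij_betw ?\<psi> (incident ?P i) (incident G (?\<phi> i))"
    proof cases
      case 1
      then show ?thesis using x ue(1,2) incident_path_graph_Suc(1)[OF n] by (simp add: bij_betw_def)
    next
      case 2
      have "incident ?P i = {i - 1, i}" by (rule incident_path_graph_Suc(2)[OF n 2])
      moreover have "incident G (?\<phi> i) = {?\<psi> (i - 1), ?\<psi> i}" using ue(4)[of "i - 1"] 2 by simp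
      moreover have "?\<psi> (i - 1) \<noteq> ?\<psi> i"
      proof
        assume "?\<psi> (i - 1) = ?\<psi> i"
        moreover have "i - 1 - 1 \<in> {..<n}" "i - 1 \<in> {..<n}" using 2 by auto
        ultimately have "i - 1 - 1 = i - 1" using inj_onD[OF ue(6)] by blast
        then show False using 2 by linarith
      qed
      ultimately show ?thesis using bij_betw_doubleton[of ?\<psi> "i - 1" i] by simp
    next
      case 3
      then show ?thesis using ue(5) incident_path_graph_Suc(3)[OF n] by (simp add: bij_betw_def)
    qed
  next
    fix i assume i: "i \<in> edges ?P"
    then have "1 \<le> i" "i - 1 < n" by auto
    then show "ends G (?\<psi> i) = ?\<phi> ` ends ?P i" using ue(3)[of "i - 1"] by simp
  qed auto
  then show ?thesis by blast
qed

lemma three_arms_is_tripod: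
  fixes \<alpha> :: "nat \<Rightarrow> 'e" and y :: "nat \<Rightarrow> 'v"
  assumes G: "finite_graph G" "connected_graph G" "acyclic_graph G"
    and x: "incident G x = {\<alpha> 1, \<alpha> 2, \<alpha> 3}" "\<alpha> 1 \<noteq> \<alpha> 2" "\<alpha> 1 \<noteq> \<alpha> 3" "\<alpha> 2 \<noteq> \<alpha> 3"
    and arms: "\<And>i. i \<in> {1, 2, 3} \<Longrightarrow>
      ends G (\<alpha> i) = {x, y i} \<and> arm G f (\<alpha> i) (y i) (arm_len p q r i) \<and> f (\<alpha> i) = 1"
  shows "f_iso G f (tripod p q r) unit_weight"
proof -
  let ?T = "tripod p q r" and ?n = "arm_len p q r"
  \<comment> \<open>One predicate for the description of an arm, so that the three arms can be
    chosen simultaneously.\<close>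
  define Q where "Q i u e \<longleftrightarrow> e 0 = \<alpha> i \<and> u 0 = x \<and>
    (\<forall>j<?n i. ends G (e j) = {u j, u (Suc j)} \<and> f (e j) = 1) \<and>
    (\<forall>j. 0 < j \<longrightarrow> j < ?n i \<longrightarrow> incident G (u j) = {e (j - 1), e j}) \<and>
    incident G (u (?n i)) = {e (?n i - 1)} \<and> inj_on e {..<?n i}" for i and u :: "nat \<Rightarrow> 'v" and e :: "nat \<Rightarrow> 'e"
  have "\<exists>u e. Q i u e" if i: "i \<in> {1, 2, 3}" for i
  proof -
    have aE: "\<alpha> i \<in> edges G" using i x(1) by (auto simp: incident_def)
    note a = arms[OF i]
    have "x \<noteq> y i" using acyclic_ends_neq[OF G aE] a by blast
    from arm_seq[OF conjunct1[OF conjunct2[OF a]] conjunct1[OF a] this aE]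
    obtain u e where ue: "e 0 = \<alpha> i" "u 0 = x"
      "\<And>j. j < ?n i \<Longrightarrow> ends G (e j) = {u j, u (Suc j)}"
      "\<And>j. 0 < j \<Longrightarrow> j < ?n i \<Longrightarrow> incident G (u j) = {e (j - 1), e j}"
      "\<And>j. 0 < j \<Longrightarrow> j < ?n i \<Longrightarrow> f (e j) = 1"
      "incident G (u (?n i)) = {e (?n i - 1)}" "inj_on e {..<?n i}" by metis
    have "f (e j) = 1" if "j < ?n i" for j
      using ue(1) ue(5)[of j] a that by (cases "j = 0") auto
    then have "Q i u e" unfolding Q_def using ue by blast
    then show ?thesis by blast
  qed
  then have "\<forall>i\<in>{1, 2, 3}. \<exists>ue. Q i (fst ue) (snd ue)" by simp
  from bchoice[OF this] obtain W where W: "\<forall>i\<in>{1, 2, 3}. Q i (fst (W i)) (snd (W i))" by (elim exE)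
  define U E where "U i = fst (W i)" and "E i = snd (W i)" for i
  have UE: "Q i (U i) (E i)" if "i \<in> {1, 2, 3}" for i using W that unfolding U_def E_def by blast
  have pos: "1 \<le> ?n i" if "i \<in> {1, 2, 3}" for i
    by (rule chain_pos[OF arms[OF that, THEN conjunct2, THEN conjunct1]])
  have pqr: "1 \<le> p" "1 \<le> q" "1 \<le> r" using pos[of 1] pos[of 2] pos[of 3] by simp_all
  \<comment> \<open>All three sequences start at \<open>x\<close>, which is why position 0 of each
    arm goes there; the edge \<open>(i, j)\<close> is named after its far end, hence the shift in
    \<open>\<psi>\<close>.\<close>
  define \<phi> where "\<phi> = (\<lambda>(i, j). if j = 0 then x else U i j)"
  define \<psi> where "\<psi> = (\<lambda>(i, j). E i (j - 1))"
  have "is_iso \<phi> \<psi> ?T G"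
  proof (rule acyclic_covering_is_iso[OF _ _ _ _ _ G])
    fix a assume "a \<in> verts ?T"
    then consider "a = (0, 0)" | i j where "a = (i, j)" "(i, j) \<in> edges ?T"
      unfolding tripod_simps(2) by (cases a) auto
    then show "incident ?T a \<noteq> {} \<and> bij_betw \<psi> (incident ?T a) (incident G (\<phi> a))"
    proof cases
      case 1
      have "\<psi> (i, 1) = \<alpha> i" if "i \<in> {1, 2, 3}" for i using UE[OF that] by (simp add: \<psi>_def Q_def)
      then have "\<psi> (1, 1) = \<alpha> 1" "\<psi> (2, 1) = \<alpha> 2" "\<psi> (3, 1) = \<alpha> 3" by blast+
      then show ?thesis
        using bij_betw_tripleton[of \<psi> "(1, 1)" "(2, 1)" "(3, 1)"] x incident_tripod_centre[OF pqr] 1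
        by (simp add: \<phi>_def)
    next
      case 2
      then have ij: "i \<in> {1, 2, 3}" "1 \<le> j" "j \<le> ?n i" by (auto simp: tripod_simps)
      note Qi = UE[OF ij(1), unfolded Q_def]
      show ?thesis
      proof (cases "j < ?n i")
        case True
        then have "incident ?T a = {(i, j), (i, Suc j)}" using incident_tripod_arm[OF 2(2)] 2(1) by auto
        moreover have "incident G (\<phi> a) = {\<psi> (i, j), \<psi> (i, Suc j)}"
          using Qi ij True 2(1) by (auto simp: \<phi>_def \<psi>_def)
        moreover have "\<psi> (i, j) \<noteq> \<psi> (i, Suc j)"
        proof
          assume "\<psi> (i, j) = \<psi> (i, Suc j)"
          then have "E i (j - 1) = E i j" by (simp add: \<psi>_def)
          moreover have "inj_on (E i) {..<?n i}" using Qi by blast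
          moreover have "j - 1 \<in> {..<?n i}" "j \<in> {..<?n i}" using True by auto
          ultimately have "j - 1 = j" using inj_onD by metis
          then show False using ij(2) by linarith
        qed
        ultimately show ?thesis using bij_betw_doubleton[of \<psi> "(i, j)" "(i, Suc j)"] by simp
      next
        case False
        then have "j = ?n i" using ij by simp
        moreover from this have "incident ?T a = {(i, j)}" using incident_tripod_arm[OF 2(2)] 2(1) by auto
        ultimately show ?thesis using Qi 2(1) ij(2) by (simp add: \<phi>_def \<psi>_def bij_betw_def)
      qed
    qed
  next
    fix b assume b: "b \<in> edges ?T"
    obtain i j where ij: "b = (i, j)" by (cases b)
    then have r: "i \<in> {1, 2, 3}" "1 \<le> j" "j - 1 < ?n i" using b by (auto simp: tripod_simps)
    have "ends G (E i (j - 1)) = {U i (j - 1), U i (Suc (j - 1))}" "U i 0 = x"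
      using UE[OF r(1), unfolded Q_def] r(3) by blast+
    then show "ends G (\<psi> b) = \<phi> ` ends ?T b"
      using r(2) ij by (auto simp: \<phi>_def \<psi>_def tripod_simps)
  qed (use card_edges_tripod[of p q r] card_verts_tripod[of p q r] ends_tripod[of _ p q r]
    in \<open>auto simp: tripod_simps(2)\<close>)
  moreover have "f (\<psi> b) = 1" if b: "b \<in> edges ?T" for b
  proof -
    obtain i j where ij: "b = (i, j)" by (cases b)
    then have r: "i \<in> {1, 2, 3}" "j - 1 < ?n i" using b by (auto simp: tripod_simps)
    then show ?thesis using UE[OF r(1), unfolded Q_def] ij by (simp add: \<psi>_def)
  qed
  ultimately show ?thesis using finite_graph_tripod by (intro f_iso_from[of \<phi> \<psi>]) auto
qed

text \<open>The stem is given by two sequences in the numbering of \<open>fork_graph\<close>; the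
  leaves take the numbers above \<open>m\<close>. With \<open>2 \<le> m\<close> the branch vertex
  and the top of the stem have different numbers.\<close>

lemma fork_stem_iso:
  assumes G: "finite_graph G" "connected_graph G" "acyclic_graph G" and m: "2 \<le> m"
    and one: "incident G (u 1) = {e 1, a, b}" "e 1 \<noteq> a" "e 1 \<noteq> b" "a \<noteq> b"
    and a: "ends G a = {u 1, y}" "incident G y = {a}" and b: "ends G b = {u 1, z}" "incident G z = {b}"
    and stem: "\<And>i. 1 < i \<Longrightarrow> i < m \<Longrightarrow> incident G (u i) = {e (i - 1), e i} \<and> e (i - 1) \<noteq> e i"
    and ends: "\<And>i. 1 \<le> i \<Longrightarrow> i < m \<Longrightarrow> ends G (e i) = {u i, u (Suc i)}"
    and top: "incident G (u m) = {e (m - 1)}"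
  shows "is_iso (u(m + 1 := y, m + 2 := z)) (e(m + 1 := a, m + 2 := b)) (fork_graph m) G"
    (is "is_iso ?\<phi> ?\<psi> ?F G")
proof (rule acyclic_covering_is_iso[OF _ _ _ _ _ G])
  note inc = incident_fork_graph[OF m]
  fix i assume "i \<in> verts ?F"
  then consider "i = 1" | "1 < i" "i < m" | "i = m" | "i = m + 1" | "i = m + 2"
    by (auto simp: fork_graph_simps) linarith
  then show "incident ?F i \<noteq> {} \<and> bij_betw ?\<psi> (incident ?F i) (incident G (?\<phi> i))"
  proof cases
    case 1
    then show ?thesis using inc(1) one m bij_betw_tripleton[of ?\<psi> 1 "m + 1" "m + 2"] by simp
  next
    case 2
    then have "i - 1 \<noteq> m + 1" "i - 1 \<noteq> m + 2" by linarith+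
    then show ?thesis using inc(2)[OF 2] stem[OF 2] 2 bij_betw_doubleton[of ?\<psi> "i - 1" i] by simp
  next
    case 3
    have "m - 1 \<noteq> m + 1" "m - 1 \<noteq> m + 2" by linarith+
    then show ?thesis using inc(3) top 3 bij_betw_singleton[of ?\<psi> "m - 1"] by simp
  next
    case 4
    then show ?thesis using inc(4)[of i] a(2) bij_betw_singleton[of ?\<psi> i] by simp
  next
    case 5
    then show ?thesis using inc(4)[of i] b(2) bij_betw_singleton[of ?\<psi> i] by simp
  qed
next
  fix i assume "i \<in> edges ?F"
  then consider "1 \<le> i" "i < m" | "i = m + 1" | "i = m + 2" by (auto simp: fork_graph_simps)
  then show "ends G (?\<psi> i) = ?\<phi> ` ends ?F i"
    using a(1) b(1) ends[of i] m by cases (simp_all add: fork_graph_simps)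
qed (use m fork_graph_tree[of m] in auto)

lemma double_fork_stem_iso:
  assumes G: "finite_graph G" "connected_graph G" "acyclic_graph G" and m: "2 \<le> m"
    and one: "incident G (u 1) = {e 1, a, b}" "e 1 \<noteq> a" "e 1 \<noteq> b" "a \<noteq> b"
    and a: "ends G a = {u 1, y}" "incident G y = {a}" and b: "ends G b = {u 1, z}" "incident G z = {b}"
    and stem: "\<And>i. 1 < i \<Longrightarrow> i < m \<Longrightarrow> incident G (u i) = {e (i - 1), e i} \<and> e (i - 1) \<noteq> e i"
    and ends: "\<And>i. 1 \<le> i \<Longrightarrow> i < m \<Longrightarrow> ends G (e i) = {u i, u (Suc i)}"
    and top: "incident G (u m) = {e (m - 1), c, d}" "e (m - 1) \<noteq> c" "e (m - 1) \<noteq> d" "c \<noteq> d"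
    and c: "ends G c = {u m, v}" "incident G v = {c}" and d: "ends G d = {u m, w}" "incident G w = {d}"
  shows "is_iso (u(m + 1 := y, m + 2 := z, m + 3 := v, m + 4 := w))
    (e(m + 1 := a, m + 2 := b, m + 3 := c, m + 4 := d)) (double_fork_graph m) G"
    (is "is_iso ?\<phi> ?\<psi> ?F G")
proof (rule acyclic_covering_is_iso[OF _ _ _ _ _ G])
  note inc = incident_double_fork_graph[OF m]
  fix i assume "i \<in> verts ?F"
  then consider "i = 1" | "1 < i" "i < m" | "i = m" | "i = m + 1" | "i = m + 2" | "i = m + 3" | "i = m + 4"
    by (auto simp: double_fork_graph_simps) linarith
  then show "incident ?F i \<noteq> {} \<and> bij_betw ?\<psi> (incident ?F i) (incident G (?\<phi> i))"
  proof cases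
    case 1
    then show ?thesis using inc(1) one m bij_betw_tripleton[of ?\<psi> 1 "m + 1" "m + 2"] by simp
  next
    case 2
    then have "i - 1 \<noteq> m + 1" "i - 1 \<noteq> m + 2" "i - 1 \<noteq> m + 3" "i - 1 \<noteq> m + 4" by linarith+
    then show ?thesis using inc(2)[OF 2] stem[OF 2] 2 bij_betw_doubleton[of ?\<psi> "i - 1" i] by simp
  next
    case 3
    have "m - 1 \<noteq> m + 1" "m - 1 \<noteq> m + 2" "m - 1 \<noteq> m + 3" "m - 1 \<noteq> m + 4" by linarith+
    then show ?thesis using inc(3) top 3 bij_betw_tripleton[of ?\<psi> "m - 1" "m + 3" "m + 4"] by simp
  next
    case 4
    then show ?thesis using inc(4)[of i] a(2) bij_betw_singleton[of ?\<psi> i] by simp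
  next
    case 5
    then show ?thesis using inc(4)[of i] b(2) bij_betw_singleton[of ?\<psi> i] by simp
  next
    case 6
    then show ?thesis using inc(4)[of i] c(2) bij_betw_singleton[of ?\<psi> i] by simp
  next
    case 7
    then show ?thesis using inc(4)[of i] d(2) bij_betw_singleton[of ?\<psi> i] by simp
  qed
next
  fix i assume "i \<in> edges ?F"
  then consider "1 \<le> i" "i < m" | "i = m + 1" | "i = m + 2" | "i = m + 3" | "i = m + 4"
    by (auto simp: double_fork_graph_simps)
  then show "ends G (?\<psi> i) = ?\<phi> ` ends ?F i"
    using a(1) b(1) c(1) d(1) ends[of i] m by cases (simp_all add: double_fork_graph_simps)
qed (use m double_fork_graph_tree[of m] in auto)

text \<open>The degenerate double fork, where the stem has a single vertex and both forks are
  attached to it.\<close>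

lemma four_leaves_iso:
  assumes G: "finite_graph G" "connected_graph G" "acyclic_graph G"
    and x: "card (incident G x) = 4"
    and leaf: "\<And>\<alpha>. \<alpha> \<in> incident G x \<Longrightarrow> \<exists>y. ends G \<alpha> = {x, y} \<and> incident G y = {\<alpha>}"
  shows "\<exists>\<phi> \<psi>. is_iso \<phi> \<psi> (double_fork_graph 1) G"
proof -
  have c4: "card {2, 3, 4, 5 :: nat} = card (incident G x)" using x by simp
  then obtain \<psi> where \<psi>: "bij_betw \<psi> {2, 3, 4, 5 :: nat} (incident G x)"
    using finite_same_card_bij[OF _ finite_incident[OF G(1)] c4] by blast
  have \<psi>x: "\<psi> i \<in> incident G x" if "i \<in> {2, 3, 4, 5 :: nat}" for i using \<psi> that by (auto simp: bij_betw_def)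
  then have "\<forall>i\<in>{2, 3, 4, 5 :: nat}. \<exists>y. ends G (\<psi> i) = {x, y} \<and> incident G y = {\<psi> i}"
    using leaf by blast
  from bchoice[OF this] obtain Y
    where Y: "\<And>i. i \<in> {2, 3, 4, 5 :: nat} \<Longrightarrow> ends G (\<psi> i) = {x, Y i} \<and> incident G (Y i) = {\<psi> i}" by blast
  let ?D = "double_fork_graph 1" and ?\<phi> = "Y(1 := x)"
  have D: "verts ?D = insert 1 {2, 3, 4, 5}" "edges ?D = {2, 3, 4, 5}"
    by (auto simp: double_fork_graph_simps)
  have "is_iso ?\<phi> \<psi> ?D G"
  proof (rule acyclic_covering_is_iso[OF _ _ _ _ _ G])
    fix i assume "i \<in> verts ?D"
    then consider "i = 1" | "i \<in> {2, 3, 4, 5 :: nat}" unfolding D by blast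
    then show "incident ?D i \<noteq> {} \<and> bij_betw \<psi> (incident ?D i) (incident G (?\<phi> i))"
    proof cases
      case 1
      then show ?thesis using incident_double_fork_graph_1(1) \<psi> by simp
    next
      case 2
      then have "?\<phi> i = Y i" by auto
      then show ?thesis
        using incident_double_fork_graph_1(2)[OF 2] Y[OF 2] bij_betw_singleton[of \<psi> i] by simp
    qed
  next
    fix i assume "i \<in> edges ?D"
    then have i: "i \<in> {2, 3, 4, 5 :: nat}" unfolding D .
    then have "ends ?D i = {1, i}" "i \<noteq> 1" by (elim insertE emptyE; simp add: double_fork_graph_simps)+
    then show "ends G (\<psi> i) = ?\<phi> ` ends ?D i" using Y[OF i] by (simp add: insert_commute)
  qed (use double_fork_graph_tree[of 1] in auto)
  then show ?thesis by blast
qed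

section \<open>Graphs of small degree\<close>

lemma arm_1_leaf:
  assumes "arm G f \<alpha> y 1"
  shows "incident G y = {\<alpha>}"
  using assms
proof (cases rule: chain.cases)
  case stop
  then show ?thesis by (simp add: leaf_edge_def)
next
  case (step \<beta> z n)
  then show ?thesis using chain_pos[of G f _ \<beta> z n] by auto
qed

text \<open>Used contrapositively: if no arm lies behind an edge of a walk, none lies behind the
  next one.\<close>

lemma arm_next:
  assumes "arm G f \<beta> y n" "incident G y = {\<beta>, \<alpha>}" "\<beta> \<noteq> \<alpha>" "ends G \<alpha> = {y, x}"
  shows "\<exists>m. arm G f \<alpha> x m"
  using assms(1)
proof (cases rule: chain.cases)
  case stop
  then show ?thesis using assms(2,3) by (auto simp: leaf_edge_def)
next
  case (step \<gamma> z m)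
  then have "{\<beta>, \<gamma>} = {\<beta>, \<alpha>}" using assms(2) by simp
  then have "\<gamma> = \<alpha>" using assms(3) by (auto simp: doubleton_eq_iff)
  moreover from this have "z = x" using step(4) assms(4) by (auto simp: doubleton_eq_iff)
  ultimately show ?thesis using step by blast
qed

lemma rho_le_iff: "rho m \<le> rho n \<longleftrightarrow> m \<le> n"
proof
  assume "rho m \<le> rho n"
  then have "2 / (real n + 1) \<le> 2 / (real m + 1)" by (simp add: rho_alt)
  then have "real m + 1 \<le> real n + 1" by (simp add: field_simps)
  then show "m \<le> n" by simp
qed (rule rho_mono)

text \<open>Only the weak bound 4 is assumed; which of the two lists a graph belongs to is settled
  afterwards by its degrees.\<close>

locale small_f_graph =
  fixes G :: "('v, 'e) graph" and f :: "'e \<Rightarrow> enat"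
  assumes G: "finite_graph G" "connected_graph G"
    and f_ge_1: "\<And>e. e \<in> edges G \<Longrightarrow> 1 \<le> f e"
    and rho_le_4: "\<And>x. x \<in> verts G \<Longrightarrow> rho_degree G f x \<le> 4"
begin

abbreviation wt :: "'e \<Rightarrow> nat" where
  "wt e \<equiv> the_enat (f e)"

section \<open>Contributions under the bound four\<close>

lemma f_wt:
  assumes "e \<in> edges G"
  shows "f e = enat (wt e)" "1 \<le> wt e"
proof -
  obtain x y where "ends G e = {x, y}" "x \<in> verts G" using ends_cases[OF G(1) assms] by metis
  then have "e \<in> incident G x" using assms by (simp add: incident_def)
  have "f e \<noteq> \<infinity>"
  proof
    assume "f e = \<infinity>"
    then have "rho_degree G f x = \<infinity>" by (rule rho_degree_infinite[OF G \<open>e \<in> incident G x\<close>])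
    then show False using rho_le_4[OF \<open>x \<in> verts G\<close>] by simp
  qed
  then show "f e = enat (wt e)" by auto
  then show "1 \<le> wt e" using f_ge_1[OF assms] by (metis enat_ord_simps(1) one_enat_def)
qed

lemma sum_contrib: "x \<in> verts G \<Longrightarrow> (\<Sum>e\<in>incident G x. contrib G f x e) \<le> 4"
  using rho_degree_finite[of G x f] rho_le_4[of x] f_wt(1)
  by (metis enat.distinct(1) ereal_less_eq(3) incident_iff numeral_eq_ereal)

lemma contrib_ge:
  assumes "e \<in> incident G x"
  shows "real (wt e) \<le> contrib G f x e" "1 \<le> contrib G f x e"
proof -
  have d: "1 \<le> edge_deriv G f x e" by (rule edge_deriv_ge_1[OF G assms])
  then show "real (wt e) \<le> contrib G f x e"
    unfolding contrib_def using mult_left_mono[OF d, of "real (wt e)"] by simp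
  moreover have "1 \<le> wt e" using f_wt(2) assms by (simp add: incident_def)
  ultimately show "1 \<le> contrib G f x e" by linarith
qed

lemma sum_contrib_subset:
  assumes "x \<in> verts G" "A \<subseteq> incident G x"
  shows "(\<Sum>e\<in>A. contrib G f x e) \<le> 4"
proof -
  have "(\<Sum>e\<in>A. contrib G f x e) \<le> (\<Sum>e\<in>incident G x. contrib G f x e)"
    using assms(2) contrib_ge(2) by (intro sum_mono2[OF finite_incident[OF G(1)]]) force+
  then show ?thesis using sum_contrib[OF assms(1)] by linarith
qed

lemma card_incident_le_4:
  assumes "x \<in> verts G"
  shows "card (incident G x) \<le> 4"
proof -
  have "(\<Sum>e\<in>incident G x. 1 :: real) \<le> (\<Sum>e\<in>incident G x. contrib G f x e)"
    using contrib_ge(2) by (intro sum_mono) auto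
  then show ?thesis using sum_contrib[OF assms] by simp
qed

lemma contrib_loop: "e \<in> edges G \<Longrightarrow> ends G e = {x} \<Longrightarrow> 4 \<le> contrib G f x e"
  using edge_deriv_loop[OF G, of e x f] f_wt(2)[of e] by (simp add: contrib_def)

lemma contrib_no_arm:
  assumes "e \<in> edges G" "ends G e = {x, y}" "x \<noteq> y" "\<And>n. \<not> arm G f e y n"
  shows "contrib G f x e = 2 * wt e"
  using edge_deriv_no_arm[OF G assms] by (simp add: contrib_def)

text \<open>A contribution is at least the weight, and equals twice the weight if there is no arm;
  below 2 this leaves weight one and an arm.\<close>

lemma contrib_lt_2:
  assumes "e \<in> edges G" "ends G e = {x, y}" "x \<noteq> y" "contrib G f x e < 2"
  obtains n where "f e = 1" "arm G f e y n" "contrib G f x e = rho n"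
proof -
  have x: "e \<in> incident G x" using assms by (simp add: incident_def)
  have "wt e = 1" using contrib_ge(1)[OF x] assms(4) f_wt(2)[OF assms(1)] by linarith
  obtain n where n: "arm G f e y n"
    using contrib_no_arm[OF assms(1-3)] assms(4) \<open>wt e = 1\<close> by fastforce
  have "contrib G f x e = rho n"
    using edge_deriv_arm[OF G assms(1-3) n] \<open>wt e = 1\<close> by (simp add: contrib_def)
  moreover have "f e = 1" using f_wt(1)[OF assms(1)] \<open>wt e = 1\<close> by (simp add: one_enat_def)
  ultimately show thesis using that n by blast
qed

lemma contrib_le_1:
  assumes "e \<in> edges G" "ends G e = {x, y}" "x \<noteq> y" "contrib G f x e \<le> 1"
  shows "f e = 1" "incident G y = {e}"
proof -
  have "contrib G f x e < 2" using assms(4) by simp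
  with assms(1-3) obtain n where n: "f e = 1" "arm G f e y n" "contrib G f x e = rho n"
    by (rule contrib_lt_2)
  show "f e = 1" by (rule n(1))
  have "\<not> 2 \<le> n" using n(3) assms(4) rho_mono[of 2 n] by (auto simp: rho_numeral)
  then have "n = 1" using chain_pos[OF n(2)] by linarith
  then show "incident G y = {e}" using arm_1_leaf[of G f e y] n(2) by simp
qed

text \<open>Weight two leaves a derivative of at most 1, which only a leaf has, since
  \<open>rho 2 = 4/3\<close>.\<close>

lemma contrib_le_2:
  assumes "e \<in> edges G" "ends G e = {x, y}" "x \<noteq> y" "contrib G f x e \<le> 2"
  shows "f e = 1 \<or> f e = 2 \<and> incident G y = {e}"
proof -
  have x: "e \<in> incident G x" using assms by (simp add: incident_def)
  have "real (wt e) \<le> 2" using contrib_ge(1)[OF x] assms(4) by linarith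
  then consider "wt e = 1" | "wt e = 2" using f_wt(2)[OF assms(1)] by linarith
  then show ?thesis
  proof cases
    case 1
    then show ?thesis using f_wt(1)[OF assms(1)] by (simp add: one_enat_def)
  next
    case 2
    obtain n where n: "arm G f e y n"
      using contrib_no_arm[OF assms(1-3)] assms(4) 2 by fastforce
    then have "2 * rho n \<le> 2"
      using edge_deriv_arm[OF G assms(1-3) n] 2 assms(4) by (simp add: contrib_def)
    then have "\<not> 2 \<le> n" using rho_mono[of 2 n] by (auto simp: rho_numeral)
    then have "n = 1" using chain_pos[OF n] by linarith
    then have "incident G y = {e}" using arm_1_leaf[of G f e y] n by simp
    then show ?thesis using f_wt(1)[OF assms(1)] 2 by (simp add: numeral_eq_enat)
  qed
qed

text \<open>Besides an edge that takes 2 only 2 is left, and every other edge takes at least 1: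
  either a single edge remains, or two that take exactly 1.\<close>

lemma incident_beside_heavy:
  assumes y: "y \<in> verts G" "\<alpha> \<in> incident G y" "2 \<le> contrib G f y \<alpha>" "incident G y \<noteq> {\<alpha>}"
  obtains (one) \<beta> where "incident G y = {\<alpha>, \<beta>}" "\<beta> \<noteq> \<alpha>" "contrib G f y \<alpha> + contrib G f y \<beta> \<le> 4"
  | (two) \<beta> \<gamma> where "incident G y = {\<alpha>, \<beta>, \<gamma>}" "\<beta> \<noteq> \<alpha>" "\<gamma> \<noteq> \<alpha>" "\<gamma> \<noteq> \<beta>"
      "contrib G f y \<beta> \<le> 1" "contrib G f y \<gamma> \<le> 1"
proof -
  obtain \<beta> where \<beta>: "\<beta> \<in> incident G y" "\<beta> \<noteq> \<alpha>" using y(2,4) by blast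
  show thesis
  proof (cases "incident G y = {\<alpha>, \<beta>}")
    case True
    have "contrib G f y \<alpha> + contrib G f y \<beta> \<le> 4"
      using sum_contrib_subset[OF y(1), of "{\<alpha>, \<beta>}"] y(2) \<beta> by simp
    then show thesis by (rule one[OF True \<beta>(2)])
  next
    case False
    then obtain \<gamma> where \<gamma>: "\<gamma> \<in> incident G y" "\<gamma> \<noteq> \<alpha>" "\<gamma> \<noteq> \<beta>" using y(2) \<beta> by blast
    have "contrib G f y \<alpha> + contrib G f y \<beta> + contrib G f y \<gamma> \<le> 4"
      using sum_contrib_subset[OF y(1), of "{\<alpha>, \<beta>, \<gamma>}"] y(2) \<beta> \<gamma> by (auto simp: add.assoc)
    then have le1: "contrib G f y \<beta> \<le> 1" "contrib G f y \<gamma> \<le> 1"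
      using y(3) contrib_ge(2)[OF \<beta>(1)] contrib_ge(2)[OF \<gamma>(1)] by linarith+
    have "incident G y = {\<alpha>, \<beta>, \<gamma>}"
    proof (rule ccontr)
      assume "incident G y \<noteq> {\<alpha>, \<beta>, \<gamma>}"
      then obtain \<delta> where \<delta>: "\<delta> \<in> incident G y" "\<delta> \<notin> {\<alpha>, \<beta>, \<gamma>}" using y(2) \<beta> \<gamma> by blast
      have "contrib G f y \<alpha> + contrib G f y \<beta> + contrib G f y \<gamma> + contrib G f y \<delta> \<le> 4"
        using sum_contrib_subset[OF y(1), of "{\<alpha>, \<beta>, \<gamma>, \<delta>}"] y(2) \<beta> \<gamma> \<delta>
        by (auto simp: add.assoc)
      then show False
        using y(3) contrib_ge(2)[OF \<beta>(1)] contrib_ge(2)[OF \<gamma>(1)] contrib_ge(2)[OF \<delta>(1)] by linarith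
    qed
    then show thesis by (rule two[OF _ \<beta>(2) \<gamma>(2,3) le1])
  qed
qed

section \<open>Loops and cyclic edges\<close>

lemma loop_case:
  assumes e: "e \<in> edges G" "ends G e = {x}"
  shows "generates_extended_dynkin G f"
proof -
  have x: "x \<in> verts G" "e \<in> incident G x"
    using finite_graph_ends[OF G(1) e(1)] e by (auto simp: incident_def)
  have "wt e = 1"
  proof -
    have "contrib G f x e \<le> 4" using sum_contrib_subset[of x "{e}"] x by simp
    moreover have "contrib G f x e = 4 * wt e" using edge_deriv_loop[OF G e, of f] by (simp add: contrib_def)
    ultimately show ?thesis using f_wt(2)[OF e(1)] by linarith
  qed
  then have fe: "f e = 1" using f_wt(1)[OF e(1)] by (simp add: one_enat_def)
  have inc: "incident G x = {e}"
  proof (rule ccontr)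
    assume "incident G x \<noteq> {e}"
    then obtain b where b: "b \<in> incident G x" "b \<noteq> e" using x by blast
    have "contrib G f x e + contrib G f x b \<le> 4"
      using sum_contrib_subset[of x "{e, b}"] x b by simp
    then show False using contrib_ge(2)[OF b(1)] contrib_loop[OF e] by linarith
  qed
  \<comment> \<open>The loop alone uses up the bound, so nothing connects \<open>x\<close> to
    another vertex.\<close>
  have "cut_closed G {x}"
    unfolding cut_closed_def
  proof (intro ballI impI)
    fix b assume b: "b \<in> edges G" "ends G b \<inter> {x} \<noteq> {}"
    then have "b \<in> incident G x" by (auto simp: incident_def)
    then show "ends G b \<subseteq> {x}" using inc e by simp
  qed
  then have V: "verts G = {x}" using connected_graphD[OF G(2), of "{x}" x] x by blast
  have E: "edges G = {e}"
  proof -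
    have "b \<in> incident G x" if "b \<in> edges G" for b
      using ends_cases[OF G(1) that] V that by (metis incident_iff insertCI singletonD)
    then show ?thesis using inc e by blast
  qed
  have "is_iso (\<lambda>_. x) (\<lambda>_. e) (cycle_graph 1) G"
    using V E e by (auto simp: is_iso_def cycle_graph_simps bij_betw_def)
  moreover have "finite_graph (cycle_graph 1)" by (auto simp: finite_graph_def cycle_graph_simps)
  ultimately have "f_iso G f (cycle_graph 1) unit_weight"
    by (rule f_iso_from) (simp add: fe)
  then show ?thesis unfolding generates_extended_dynkin_def by blast
qed

text \<open>A cyclic edge enters no arm at either end, so at \<open>y\<close> it counts twice its
  weight. Two further edges at \<open>y\<close> would have to be leaves, and the branch at
  \<open>y\<close> would consist of \<open>y\<close> and the two leaf vertices without reaching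
  \<open>x\<close>, making \<open>\<alpha>\<close> a bridge. So one edge remains, which is cyclic by
  \<open>cyclic_edge_exchange\<close>.\<close>

lemma cyclic_neighbour:
  assumes \<alpha>: "\<alpha> \<in> edges G" "ends G \<alpha> = {x, y}" "x \<noteq> y" "cyclic_edge G \<alpha>"
    and no_loops: "\<And>e. e \<in> edges G \<Longrightarrow> card (ends G e) = 2"
  obtains \<beta> where "incident G y = {\<alpha>, \<beta>}" "\<alpha> \<noteq> \<beta>" "cyclic_edge G \<beta>" "f \<alpha> = 1"
proof -
  have y: "y \<in> verts G" "\<alpha> \<in> incident G y"
    using finite_graph_ends[OF G(1) \<alpha>(1)] \<alpha> by (auto simp: incident_def)
  have yx: "ends G \<alpha> = {y, x}" "y \<noteq> x" using \<alpha> by auto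
  have no_arm: "\<not> arm G f \<alpha> y n" for n
    using arm_branch_iso(1)[OF G(1) _ \<alpha>(1,2,3), of f n] noncyclic_iff[OF G \<alpha>(1,2)] \<alpha>(4) by blast
  have no_arm': "\<not> arm G f \<alpha> x n" for n
    using arm_branch_iso(1)[OF G(1) _ \<alpha>(1) yx, of f n] noncyclic_iff[OF G \<alpha>(1) yx(1)] \<alpha>(4) by blast
  have c\<alpha>: "contrib G f y \<alpha> = 2 * wt \<alpha>" by (rule contrib_no_arm[OF \<alpha>(1) yx no_arm'])
  have w\<alpha>: "1 \<le> wt \<alpha>" by (rule f_wt(2)[OF \<alpha>(1)])
  have heavy: "2 \<le> contrib G f y \<alpha>" using c\<alpha> w\<alpha> by simp
  have neq: "incident G y \<noteq> {\<alpha>}"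
    using no_arm chain.stop[of "leaf_edge G" \<alpha> y G f] by (auto simp: leaf_edge_def)
  show thesis
  proof (cases rule: incident_beside_heavy[OF y heavy neq, case_names one two])
    case (one \<beta>)
    have \<beta>: "\<beta> \<in> incident G y" using one(1) by simp
    obtain z where z: "\<beta> \<in> edges G" "ends G \<beta> = {y, z}" by (rule incident_other_end[OF G(1) \<beta>])
    have "y \<noteq> z" using no_loops[OF z(1)] z by auto
    then have "cyclic_edge G \<beta>"
      using cyclic_edge_exchange[OF G one(1) _ \<alpha>(2,3) z(2) _ \<alpha>(4)] one(2) by simp
    \<comment> \<open>The second edge takes at least 1, so twice the weight is at most 3.\<close>
    moreover have "wt \<alpha> = 1" using one(3) c\<alpha> w\<alpha> contrib_ge(2)[OF \<beta>] by linarith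
    then have "f \<alpha> = 1" using f_wt(1)[OF \<alpha>(1)] by (simp add: one_enat_def)
    ultimately show thesis using that one(1,2) by blast
  next
    case (two \<beta> \<gamma>)
    have bc: "\<beta> \<in> incident G y" "\<gamma> \<in> incident G y" using two(1) by auto
    obtain z where z: "\<beta> \<in> edges G" "ends G \<beta> = {y, z}" by (rule incident_other_end[OF G(1) bc(1)])
    obtain w where w: "\<gamma> \<in> edges G" "ends G \<gamma> = {y, w}" by (rule incident_other_end[OF G(1) bc(2)])
    have ne: "y \<noteq> z" "y \<noteq> w" using no_loops[OF z(1)] no_loops[OF w(1)] z w by auto
    have leaves: "incident G z = {\<beta>}" "incident G w = {\<gamma>}"
      using contrib_le_1(2)[OF z ne(1) two(5)] contrib_le_1(2)[OF w ne(2) two(6)] .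
    have "cut_closed (del_edge G \<alpha>) {y, z, w}"
      unfolding cut_closed_def
    proof (intro ballI impI)
      fix b assume b: "b \<in> edges (del_edge G \<alpha>)" "ends (del_edge G \<alpha>) b \<inter> {y, z, w} \<noteq> {}"
      then have "b \<in> incident G y \<or> b \<in> incident G z \<or> b \<in> incident G w" by (auto simp: incident_def)
      then have "b = \<beta> \<or> b = \<gamma>" using b(1) two(1) leaves by auto
      then show "ends (del_edge G \<alpha>) b \<subseteq> {y, z, w}" using z w by auto
    qed
    then have "verts (branch G y \<alpha>) \<subseteq> {y, z, w}" by (rule branch_subset) simp
    moreover have "\<alpha> \<in> incident G x" using \<alpha> by (simp add: incident_def)
    then have "x \<noteq> z" "x \<noteq> w" using leaves two(2,3) by auto
    ultimately show thesis using noncyclic_iff[OF G \<alpha>(1,2)] \<alpha>(3,4) by auto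
  qed
qed

text \<open>Cyclicity passes from edge to edge through vertices of degree two, so it reaches every
  edge; what remains is a connected 2-regular graph with unit weights.\<close>

lemma cyclic_case:
  assumes \<alpha>: "\<alpha> \<in> edges G" "cyclic_edge G \<alpha>"
    and no_loops: "\<And>e. e \<in> edges G \<Longrightarrow> card (ends G e) = 2"
  shows "generates_extended_dynkin G f"
proof -
  define S where "S = {v. \<exists>e\<in>incident G v. cyclic_edge G e}"
  have inc: "card (incident G v) = 2 \<and> (\<forall>e\<in>incident G v. cyclic_edge G e \<and> f e = 1)" if v: "v \<in> S" for v
  proof -
    obtain e where e: "e \<in> incident G v" "cyclic_edge G e" using v by (auto simp: S_def)
    obtain w where w: "e \<in> edges G" "ends G e = {v, w}" by (rule incident_other_end[OF G(1) e(1)])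
    have wv: "ends G e = {w, v}" "w \<noteq> v" using w no_loops[OF w(1)] by auto
    obtain b where b: "incident G v = {e, b}" "e \<noteq> b" "cyclic_edge G b" "f e = 1"
      by (rule cyclic_neighbour[OF w(1) wv e(2) no_loops])
    have bv: "b \<in> incident G v" using b(1) by simp
    obtain w' where w': "b \<in> edges G" "ends G b = {v, w'}" by (rule incident_other_end[OF G(1) bv])
    have wv': "ends G b = {w', v}" "w' \<noteq> v" using w' no_loops[OF w'(1)] by auto
    \<comment> \<open>\<open>cyclic_neighbour\<close> determines only the weight of the edge it
      starts from; a second use, starting from \<open>b\<close>, covers the other one.\<close>
    obtain b' where "f b = 1" by (rule cyclic_neighbour[OF w'(1) wv' b(3) no_loops])
    then show ?thesis using b e by simp
  qed
  have "cut_closed G S"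
    unfolding cut_closed_def
  proof (intro ballI impI)
    fix e assume e: "e \<in> edges G" "ends G e \<inter> S \<noteq> {}"
    then obtain v where "v \<in> S" "e \<in> incident G v" by (auto simp: incident_def)
    then have "cyclic_edge G e" using inc by blast
    then show "ends G e \<subseteq> S" using e(1) by (auto simp: S_def incident_def)
  qed
  moreover obtain x y where xy: "ends G \<alpha> = {x, y}" "x \<in> verts G" using ends_cases[OF G(1) \<alpha>(1)] by metis
  moreover have "x \<in> S" using \<alpha> xy by (auto simp: S_def incident_def)
  ultimately have all: "v \<in> S" if "v \<in> verts G" for v
    using connected_graphD[OF G(2), of S x v] that by blast
  have f1: "f e = 1" if e: "e \<in> edges G" for e
  proof -
    obtain v w where "ends G e = {v, w}" "v \<in> verts G" using ends_cases[OF G(1) e] by metis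
    then show ?thesis using inc[OF all[of v]] e by (simp add: incident_def)
  qed
  obtain l \<phi> \<psi> where l: "1 \<le> l" and iso: "is_iso \<phi> \<psi> (cycle_graph l) G"
    using regular_cyclic_is_cycle[OF G _ no_loops \<alpha>] inc all by blast
  have "\<psi> b \<in> edges G" if "b \<in> edges (cycle_graph l)" for b
    using iso that by (auto simp: is_iso_def bij_betw_def)
  moreover have "finite_graph (cycle_graph l)"
    using l by (auto simp: finite_graph_def cycle_graph_simps card_insert_if)
  ultimately have "f_iso G f (cycle_graph l) unit_weight" using f1 by (intro f_iso_from[OF iso]) auto
  then show ?thesis using l unfolding generates_extended_dynkin_def by blast
qed

section \<open>Trees with a vertex of degree three or four\<close>

definition light_leaf :: "'v \<Rightarrow> 'e \<Rightarrow> bool" where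
  "light_leaf x e \<longleftrightarrow> f e = 1 \<and> (\<exists>y. ends G e = {x, y} \<and> incident G y = {e})"

lemma light_leafI:
  assumes "acyclic_graph G" "e \<in> incident G x" "contrib G f x e \<le> 1"
  shows "light_leaf x e"
proof -
  obtain y where y: "e \<in> edges G" "ends G e = {x, y}" by (rule incident_other_end[OF G(1) assms(2)])
  have "x \<noteq> y" by (rule acyclic_ends_neq[OF G assms(1) y])
  from contrib_le_1[OF y this assms(3)] y(2) show ?thesis by (auto simp: light_leaf_def)
qed

lemma degree_4_case:
  assumes acyc: "acyclic_graph G" and x: "x \<in> verts G" "card (incident G x) = 4"
  shows "generates_extended_dynkin G f"
proof -
  have leaf: "light_leaf x e" if e: "e \<in> incident G x" for e
  proof (rule light_leafI[OF acyc e])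
    have fin: "finite (incident G x)" by (rule finite_incident[OF G(1)])
    have "(\<Sum>b\<in>incident G x - {e}. 1 :: real) \<le> (\<Sum>b\<in>incident G x - {e}. contrib G f x b)"
      using contrib_ge(2) by (intro sum_mono) auto
    moreover have "card (incident G x - {e}) = 3" using x(2) e fin by (simp add: card_Diff_singleton)
    moreover have "(\<Sum>b\<in>incident G x. contrib G f x b) =
        contrib G f x e + (\<Sum>b\<in>incident G x - {e}. contrib G f x b)" by (rule sum.remove[OF fin e])
    ultimately show "contrib G f x e \<le> 1" using sum_contrib[OF x(1)] by simp
  qed
  then have "\<exists>y. ends G \<alpha> = {x, y} \<and> incident G y = {\<alpha>}" if "\<alpha> \<in> incident G x" for \<alpha>
    using that by (auto simp: light_leaf_def)
  from four_leaves_iso[OF G acyc x(2) this] obtain \<phi> \<psi>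
    where iso: "is_iso \<phi> \<psi> (double_fork_graph 1) G" by blast
  have fin: "finite_graph (double_fork_graph 1)"
    using double_fork_graph_tree[of 1] by (auto simp: finite_graph_def)
  have "f (\<psi> b) = 1" if b: "b \<in> edges (double_fork_graph 1)" for b
  proof -
    have "1 \<in> ends (double_fork_graph 1) b" using b by (auto simp: double_fork_graph_simps)
    then have "b \<in> incident (double_fork_graph 1) 1" using b by (simp add: incident_def)
    moreover have "1 \<in> verts (double_fork_graph 1)" by (simp add: double_fork_graph_simps)
    ultimately have "\<psi> b \<in> incident G (\<phi> 1)"
      using is_iso_incident[OF iso _ finite_graph_ends[OF fin]] by blast
    \<comment> \<open>\<open>four_leaves_iso\<close> only asserts that an isomorphism exists; the
      centre is recovered as the one vertex of degree four.\<close>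
    moreover have "\<phi> 1 = x"
    proof (rule ccontr)
      assume ne: "\<phi> 1 \<noteq> x"
      have "x \<in> \<phi> ` verts (double_fork_graph 1)" using iso x(1) by (simp add: is_iso_def bij_betw_def)
      moreover have "verts (double_fork_graph 1) = insert 1 {2, 3, 4, 5}" by (auto simp: double_fork_graph_simps)
      ultimately obtain i where i: "i \<in> {2, 3, 4, 5}" "x = \<phi> i" using ne by auto
      have "incident G x = \<psi> ` incident (double_fork_graph 1) i"
        unfolding i(2) using i(1)
        by (intro is_iso_incident[OF iso _ finite_graph_ends[OF fin]]) (auto simp: double_fork_graph_simps)
      then show False using incident_double_fork_graph_1(2)[OF i(1)] x(2) by simp
    qed
    ultimately show ?thesis using leaf by (simp add: light_leaf_def)
  qed
  then have "f_iso G f (double_fork_graph 1) unit_weight" by (intro f_iso_from[OF iso fin]) simp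
  then have "f_iso G f (double_fork_graph (4 - 3)) unit_weight" by simp
  then show ?thesis unfolding generates_extended_dynkin_def by (metis order_refl)
qed

lemma tripod_generates:
  assumes iso: "f_iso G f (tripod p q r) unit_weight" and pqr: "1 \<le> p" "p \<le> q" "q \<le> r"
    and le: "rho p + rho q + rho r \<le> 4"
  shows "generates_dynkin G f \<or> generates_extended_dynkin G f"
proof -
  \<comment> \<open>Monotonicity reduces the classification to minimal excluded triples: (3,3,3),
    (1,4,4), (1,2,6), (1,3,4) and (2,2,3), each with sum above 4.\<close>
  have mono: "\<not> 4 < rho a + rho b + rho c" if "a \<le> p" "b \<le> q" "c \<le> r" for a b c
    using rho_mono[OF that(1)] rho_mono[OF that(2)] rho_mono[OF that(3)] le by linarith
  have "\<not> (3 \<le> p)" using mono[of 3 3 3] pqr by (auto simp: rho_numeral)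
  then consider "p = 1" | "p = 2" using pqr by linarith
  then show ?thesis
  proof cases
    case 1
    have "\<not> 4 \<le> q" using mono[of 1 4 4] pqr by (auto simp: rho_numeral)
    then consider "q = 1" | "q = 2" | "q = 3" using pqr by linarith
    then show ?thesis
    proof cases
      assume "q = 1"
      then have "f_iso G f (tripod 1 1 (r + 3 - 3)) unit_weight" "4 \<le> r + 3" using iso 1 pqr by auto
      then show ?thesis unfolding generates_dynkin_def by blast
    next
      assume "q = 2"
      have "\<not> 6 \<le> r" using mono[of 1 2 6] pqr \<open>q = 2\<close> by (auto simp: rho_numeral)
      then consider "r = 2" | "r = 3" | "r = 4" | "r = 5" using pqr \<open>q = 2\<close> by linarith
      then show ?thesis
        using iso 1 \<open>q = 2\<close> unfolding generates_dynkin_def generates_extended_dynkin_def by cases blast+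
    next
      assume "q = 3"
      have "\<not> 4 \<le> r" using mono[of 1 3 4] pqr \<open>q = 3\<close> by (auto simp: rho_numeral)
      then have "r = 3" using pqr \<open>q = 3\<close> by linarith
      then show ?thesis using iso 1 \<open>q = 3\<close> unfolding generates_extended_dynkin_def by blast
    qed
  next
    case 2
    have "\<not> 3 \<le> r" using mono[of 2 2 3] pqr 2 by (auto simp: rho_numeral)
    then have "q = 2" "r = 2" using pqr 2 by linarith+
    then show ?thesis using iso 2 unfolding generates_extended_dynkin_def by blast
  qed
qed

lemma sorted_arms_case:
  assumes acyc: "acyclic_graph G" and x: "x \<in> verts G"
    and inc: "incident G x = {a, b, c}" "a \<noteq> b" "a \<noteq> c" "b \<noteq> c"
    and lt: "contrib G f x a < 2" "contrib G f x b < 2" "contrib G f x c < 2"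
  obtains p q r where "f_iso G f (tripod p q r) unit_weight" "1 \<le> p" "1 \<le> q" "1 \<le> r"
    "contrib G f x a = rho p" "contrib G f x b = rho q" "contrib G f x c = rho r"
proof -
  have arm: "\<exists>y n. ends G e = {x, y} \<and> arm G f e y n \<and> f e = 1 \<and> contrib G f x e = rho n"
    if e: "e \<in> incident G x" "contrib G f x e < 2" for e
  proof -
    obtain y where y: "e \<in> edges G" "ends G e = {x, y}" by (rule incident_other_end[OF G(1) e(1)])
    have "x \<noteq> y" by (rule acyclic_ends_neq[OF G acyc y])
    obtain n where "f e = 1" "arm G f e y n" "contrib G f x e = rho n"
      by (rule contrib_lt_2[OF y \<open>x \<noteq> y\<close> e(2)])
    then show ?thesis using y by blast
  qed
  obtain ya p where A: "ends G a = {x, ya}" "arm G f a ya p" "f a = 1" "contrib G f x a = rho p"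
    using arm[of a] inc(1) lt(1) by blast
  obtain yb q where B: "ends G b = {x, yb}" "arm G f b yb q" "f b = 1" "contrib G f x b = rho q"
    using arm[of b] inc(1) lt(2) by blast
  obtain yc r where C: "ends G c = {x, yc}" "arm G f c yc r" "f c = 1" "contrib G f x c = rho r"
    using arm[of c] inc(1) lt(3) by blast
  define \<alpha> where "\<alpha> i = (if i = 1 then a else if i = 2 then b else c)" for i :: nat
  define y where "y i = (if i = 1 then ya else if i = 2 then yb else yc)" for i :: nat
  have "f_iso G f (tripod p q r) unit_weight"
  proof (rule three_arms_is_tripod[OF G acyc, where x = x and \<alpha> = \<alpha> and y = y])
    show "incident G x = {\<alpha> 1, \<alpha> 2, \<alpha> 3}" using inc by (simp add: \<alpha>_def)
    show "ends G (\<alpha> i) = {x, y i} \<and> arm G f (\<alpha> i) (y i) (arm_len p q r i) \<and> f (\<alpha> i) = 1"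
      if "i \<in> {1, 2, 3}" for i
      using that A B C by (elim insertE emptyE) (simp_all add: \<alpha>_def y_def)
  qed (use inc in \<open>simp_all add: \<alpha>_def\<close>)
  then show thesis using chain_pos[OF A(2)] chain_pos[OF B(2)] chain_pos[OF C(2)] A(4) B(4) C(4)
    by (rule that)
qed

lemma three_arms_case:
  assumes acyc: "acyclic_graph G" and x: "x \<in> verts G" "card (incident G x) = 3"
    and lt: "\<And>e. e \<in> incident G x \<Longrightarrow> contrib G f x e < 2"
  shows "generates_dynkin G f \<or> generates_extended_dynkin G f"
proof -
  let ?c = "contrib G f x"
  \<comment> \<open>Sorting the edges by contribution sorts the arms by length, since
    \<open>rho\<close> is strictly increasing.\<close>
  have "\<exists>a b c. incident G x = {a, b, c} \<and> a \<noteq> b \<and> a \<noteq> c \<and> b \<noteq> c \<and> ?c a \<le> ?c b \<and> ?c b \<le> ?c c"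
  proof -
    obtain a b c where abc: "incident G x = {a, b, c}" "a \<noteq> b" "a \<noteq> c" "b \<noteq> c"
      using x(2) by (auto simp: card_3_iff)
    have perms: "incident G x = {a, c, b}" "incident G x = {b, a, c}" "incident G x = {b, c, a}"
      "incident G x = {c, a, b}" "incident G x = {c, b, a}" using abc(1) by auto
    consider "?c a \<le> ?c b" "?c b \<le> ?c c" | "?c a \<le> ?c c" "?c c \<le> ?c b" | "?c b \<le> ?c a" "?c a \<le> ?c c"
      | "?c b \<le> ?c c" "?c c \<le> ?c a" | "?c c \<le> ?c a" "?c a \<le> ?c b" | "?c c \<le> ?c b" "?c b \<le> ?c a"
      by linarith
    then show ?thesis using abc perms by cases metis+
  qed
  then obtain a b c where abc: "incident G x = {a, b, c}" "a \<noteq> b" "a \<noteq> c" "b \<noteq> c"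
    and ord: "?c a \<le> ?c b" "?c b \<le> ?c c" by blast
  have lts: "?c a < 2" "?c b < 2" "?c c < 2" using lt abc(1) by auto
  obtain p q r where iso: "f_iso G f (tripod p q r) unit_weight" and pos: "1 \<le> p" "1 \<le> q" "1 \<le> r"
    and c: "?c a = rho p" "?c b = rho q" "?c c = rho r"
    by (rule sorted_arms_case[OF acyc x(1) abc lts])

  have "rho p + rho q + rho r \<le> 4"
    using sum_contrib[OF x(1)] abc c by (simp add: add.assoc)
  moreover have "p \<le> q" "q \<le> r" using ord unfolding c rho_le_iff .
  ultimately show ?thesis using tripod_generates[OF iso pos(1)] by blast
qed

text \<open>The stem runs from the branch vertex \<open>u 0\<close> along simple edges to
  \<open>u n\<close> and ends with the double edge \<open>e n\<close>. For \<open>n = 0\<close> the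
  double edge sits at the branch vertex itself; the scheme is the extended \<open>B_l\<close> with
  \<open>l = n + 3\<close>.\<close>

lemma fork_case:
  assumes acyc: "acyclic_graph G"
    and one: "incident G (u 0) = {e 0, a, b}" "e 0 \<noteq> a" "e 0 \<noteq> b" "a \<noteq> b"
    and leaves: "light_leaf (u 0) a" "light_leaf (u 0) b"
    and stem: "\<And>i. 0 < i \<Longrightarrow> i \<le> n \<Longrightarrow> incident G (u i) = {e (i - 1), e i} \<and> e (i - 1) \<noteq> e i"
    and ends: "\<And>i. i \<le> n \<Longrightarrow> ends G (e i) = {u i, u (Suc i)}"
    and top: "incident G (u (Suc n)) = {e n}"
    and w: "\<And>i. i < n \<Longrightarrow> f (e i) = 1" "f (e n) = 2"
  shows "generates_extended_dynkin G f"
proof -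
  obtain y z where yz: "ends G a = {u 0, y}" "incident G y = {a}" "ends G b = {u 0, z}" "incident G z = {b}"
    and f1: "f a = 1" "f b = 1" using leaves by (auto simp: light_leaf_def)
  let ?m = "n + 2" and ?u = "\<lambda>i. u (i - 1)" and ?e = "\<lambda>i. e (i - 1)"
  let ?\<psi> = "?e(?m + 1 := a, ?m + 2 := b)"
  have iso: "is_iso (?u(?m + 1 := y, ?m + 2 := z)) ?\<psi> (fork_graph ?m) G"
  proof (rule fork_stem_iso[OF G acyc])
    show "incident G (u (i - 1)) = {e (i - 1 - 1), e (i - 1)} \<and> e (i - 1 - 1) \<noteq> e (i - 1)"
      if "1 < i" "i < ?m" for i using stem[of "i - 1"] that by simp
    show "ends G (e (i - 1)) = {u (i - 1), u (Suc i - 1)}" if "1 \<le> i" "i < ?m" for i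
      using ends[of "i - 1"] that by simp
  qed (use one yz top in simp_all)
  have fin: "finite_graph (fork_graph ?m)"
    using fork_graph_tree[of ?m] by (auto simp: finite_graph_def)
  have "f_iso G f (fork_graph ?m) (unit_weight(n + 1 := 2))"
  proof (rule f_iso_from[OF iso fin])
    fix i assume "i \<in> edges (fork_graph ?m)"
    then consider "1 \<le> i" "i \<le> n" | "i = n + 1" | "i = ?m + 1" | "i = ?m + 2"
      by (auto simp: fork_graph_simps) linarith
    then show "(unit_weight(n + 1 := 2)) i = f (?\<psi> i)"
      using f1 w by cases auto
  qed
  moreover have "?m = n + 3 - 1" "n + 1 = n + 3 - 2" "3 \<le> n + 3" by simp_all
  ultimately have "\<exists>l\<ge>3. f_iso G f (fork_graph (l - 1)) (unit_weight(l - 2 := 2))" by metis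
  then show ?thesis unfolding generates_extended_dynkin_def by blast
qed

text \<open>The scheme is the extended \<open>D_l\<close> with \<open>l = n + 4\<close>; coinciding
  forks, the case \<open>n = 0\<close>, mean a vertex of degree four and belong to
  \<open>degree_4_case\<close>.\<close>

lemma double_fork_case:
  assumes acyc: "acyclic_graph G" and n: "1 \<le> n"
    and one: "incident G (u 0) = {e 0, a, b}" "e 0 \<noteq> a" "e 0 \<noteq> b" "a \<noteq> b"
    and leaves: "light_leaf (u 0) a" "light_leaf (u 0) b" "light_leaf (u n) c" "light_leaf (u n) d"
    and stem: "\<And>i. 0 < i \<Longrightarrow> i < n \<Longrightarrow> incident G (u i) = {e (i - 1), e i} \<and> e (i - 1) \<noteq> e i"
    and ends: "\<And>i. i < n \<Longrightarrow> ends G (e i) = {u i, u (Suc i)}"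
    and top: "incident G (u n) = {e (n - 1), c, d}" "e (n - 1) \<noteq> c" "e (n - 1) \<noteq> d" "c \<noteq> d"
    and w: "\<And>i. i < n \<Longrightarrow> f (e i) = 1"
  shows "generates_extended_dynkin G f"
proof -
  obtain y z where yz: "ends G a = {u 0, y}" "incident G y = {a}" "ends G b = {u 0, z}" "incident G z = {b}"
    and f1: "f a = 1" "f b = 1" using leaves(1,2) by (auto simp: light_leaf_def)
  obtain v t where vt: "ends G c = {u n, v}" "incident G v = {c}" "ends G d = {u n, t}" "incident G t = {d}"
    and f1': "f c = 1" "f d = 1" using leaves(3,4) by (auto simp: light_leaf_def)
  let ?m = "Suc n" and ?u = "\<lambda>i. u (i - 1)" and ?e = "\<lambda>i. e (i - 1)"
  let ?\<psi> = "?e(?m + 1 := a, ?m + 2 := b, ?m + 3 := c, ?m + 4 := d)"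
  have iso: "is_iso (?u(?m + 1 := y, ?m + 2 := z, ?m + 3 := v, ?m + 4 := t)) ?\<psi> (double_fork_graph ?m) G"
  proof (rule double_fork_stem_iso[OF G acyc])
    show "incident G (u (i - 1)) = {e (i - 1 - 1), e (i - 1)} \<and> e (i - 1 - 1) \<noteq> e (i - 1)"
      if "1 < i" "i < ?m" for i using stem[of "i - 1"] that by simp
    show "ends G (e (i - 1)) = {u (i - 1), u (Suc i - 1)}" if "1 \<le> i" "i < ?m" for i
      using ends[of "i - 1"] that by simp
  qed (use n one yz vt top in simp_all)
  have fin: "finite_graph (double_fork_graph ?m)"
    using double_fork_graph_tree[of ?m] by (auto simp: finite_graph_def)
  have "f_iso G f (double_fork_graph ?m) unit_weight"
  proof (rule f_iso_from[OF iso fin])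
    fix i assume "i \<in> edges (double_fork_graph ?m)"
    then consider "1 \<le> i" "i \<le> n" | "i = ?m + 1" | "i = ?m + 2" | "i = ?m + 3" | "i = ?m + 4"
      by (auto simp: double_fork_graph_simps)
    then show "1 = f (?\<psi> i)"
      using f1 f1' w[of "i - 1"] by cases auto
  qed
  moreover have "?m = n + 4 - 3" "4 \<le> n + 4" by simp_all
  ultimately have "\<exists>l\<ge>4. f_iso G f (double_fork_graph (l - 3)) unit_weight" by metis
  then show ?thesis unfolding generates_extended_dynkin_def by blast
qed

text \<open>How a walk that does not end in an arm can stop: at a vertex carrying two leaves, or at one
  carrying a leaf edge of weight two.\<close>

definition fork_end :: "'e \<Rightarrow> 'v \<Rightarrow> bool" where
  "fork_end e y \<longleftrightarrow>
    (\<exists>p q. incident G y = {e, p, q} \<and> e \<noteq> p \<and> e \<noteq> q \<and> p \<noteq> q \<and> light_leaf y p \<and> light_leaf y q) \<or>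
    (\<exists>g z. incident G y = {e, g} \<and> e \<noteq> g \<and> f g = 2 \<and> ends G g = {y, z} \<and> incident G z = {g})"

text \<open>Both missing arms are used: without one behind, \<open>\<alpha>\<close> takes 2 at
  \<open>y\<close>, so at most 2 is left for the rest; without one ahead, \<open>y\<close> is no
  leaf. By \<open>incident_beside_heavy\<close> the vertex \<open>y\<close> then carries two light
  leaves or one more edge, of contribution at most 2. That edge is a double leaf edge, or it has
  weight one and inherits both hypotheses, so the walk goes on.\<close>

lemma chain_to_fork_end:
  assumes acyc: "acyclic_graph G" and \<alpha>: "\<alpha> \<in> edges G" "ends G \<alpha> = {x, y}"
  shows "f \<alpha> = 1 \<longrightarrow> (\<forall>n. \<not> arm G f \<alpha> y n) \<longrightarrow> (\<forall>n. \<not> arm G f \<alpha> x n) \<longrightarrow>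
    (\<exists>n. chain G f fork_end \<alpha> y n)"
  using G acyc \<alpha>
proof (rule acyclic_walk_induct, intro impI)
  fix \<alpha> x y
  assume \<alpha>: "\<alpha> \<in> edges G" "ends G \<alpha> = {x, y}" "x \<noteq> y"
    and IH: "\<And>\<beta> z. \<beta> \<in> edges G \<Longrightarrow> \<beta> \<noteq> \<alpha> \<Longrightarrow> ends G \<beta> = {y, z} \<Longrightarrow> y \<noteq> z \<Longrightarrow>
      f \<beta> = 1 \<longrightarrow> (\<forall>n. \<not> arm G f \<beta> z n) \<longrightarrow> (\<forall>n. \<not> arm G f \<beta> y n) \<longrightarrow>
      (\<exists>n. chain G f fork_end \<beta> z n)"
    and f\<alpha>: "f \<alpha> = 1" and na: "\<forall>n. \<not> arm G f \<alpha> y n" "\<forall>n. \<not> arm G f \<alpha> x n"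
  have yx: "ends G \<alpha> = {y, x}" "y \<noteq> x" using \<alpha> by auto
  have y: "y \<in> verts G" "\<alpha> \<in> incident G y"
    using finite_graph_ends[OF G(1) \<alpha>(1)] \<alpha> by (auto simp: incident_def)
  have c\<alpha>: "contrib G f y \<alpha> = 2"
    using contrib_no_arm[OF \<alpha>(1) yx] na(2) f\<alpha> by simp
  have neq: "incident G y \<noteq> {\<alpha>}"
    using na(1) chain.stop[of "leaf_edge G" \<alpha> y G f] by (auto simp: leaf_edge_def)
  have heavy: "2 \<le> contrib G f y \<alpha>" using c\<alpha> by simp
  show "\<exists>n. chain G f fork_end \<alpha> y n"
  proof (cases rule: incident_beside_heavy[OF y heavy neq, case_names one two])
    case (one \<beta>)
    have "\<beta> \<in> incident G y" using one(1) by simp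
    then obtain z where z: "\<beta> \<in> edges G" "ends G \<beta> = {y, z}" by (rule incident_other_end[OF G(1)])
    have yz: "y \<noteq> z" by (rule acyclic_ends_neq[OF G acyc z])
    have "contrib G f y \<beta> \<le> 2" using one(3) c\<alpha> by linarith
    from contrib_le_2[OF z yz this] show ?thesis
    proof
      assume f\<beta>: "f \<beta> = 1"
      \<comment> \<open>An arm ahead of \<open>\<beta>\<close> would extend to one ahead of
        \<open>\<alpha>\<close>.\<close>
      have "\<not> arm G f \<beta> z n" for n
        using chain.step[where G = G and f = f and T = "leaf_edge G" and n = n, OF one(1) _ z(2) yz f\<beta>]
          one(2) na(1) by blast
      moreover have inc: "incident G y = {\<beta>, \<alpha>}" using one(1) by auto
      \<comment> \<open>An arm behind \<open>\<beta>\<close> would contain one behind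
        \<open>\<alpha>\<close>.\<close>
      have "\<not> arm G f \<beta> y n" for n
        using arm_next[OF _ inc one(2) yx(1), of f n] na(2) by blast
      ultimately obtain n where n: "chain G f fork_end \<beta> z n"
        using IH[OF z(1) one(2) z(2) yz] f\<beta> by blast
      have "chain G f fork_end \<alpha> y (Suc n)"
        by (rule chain.step[where G = G and f = f, OF one(1) _ z(2) yz f\<beta> n]) (use one(2) in simp)
      then show ?thesis by blast
    next
      assume "f \<beta> = 2 \<and> incident G z = {\<beta>}"
      then have "fork_end \<alpha> y" unfolding fork_end_def using one(1,2) z(2) by metis
      then show ?thesis using chain.stop[of fork_end \<alpha> y G f] by blast
    qed
  next
    case (two \<beta> \<gamma>)
    have bc: "\<beta> \<in> incident G y" "\<gamma> \<in> incident G y" using two(1) by auto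
    have "light_leaf y \<beta>" "light_leaf y \<gamma>"
      using light_leafI[OF acyc bc(1) two(5)] light_leafI[OF acyc bc(2) two(6)] .
    then have "fork_end \<alpha> y" unfolding fork_end_def using two(1-4) by metis
    then show ?thesis using chain.stop[of fork_end \<alpha> y G f] by blast
  qed
qed

lemma no_arm_at_degree_3:
  assumes "card (incident G x) = 3"
  shows "\<not> arm G f e x n"
proof
  assume "arm G f e x n"
  then show False using assms by (cases rule: chain.cases) (auto simp: leaf_edge_def card_insert_if split: if_splits)
qed

text \<open>The edge \<open>c\<close> takes at least 2 and the other two at least 1 each, so all
  three bounds are equalities: two light leaves, and a third edge that is either a double leaf edge
  or of weight one without an arm. In the second case the walk from \<open>c\<close> ends in a
  second fork or in a double edge.\<close>

lemma branch_case:
  assumes acyc: "acyclic_graph G" and x: "x \<in> verts G" "card (incident G x) = 3"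
    and ge: "c \<in> incident G x" "2 \<le> contrib G f x c"
  shows "generates_extended_dynkin G f"
proof -
  have "card (incident G x - {c}) = 2" using x(2) ge(1) finite_incident[OF G(1)] by (simp add: card_Diff_singleton)
  then obtain a b where ab: "incident G x - {c} = {a, b}" "a \<noteq> b" by (auto simp: card_2_iff)
  then have abc: "incident G x = {c, a, b}" "c \<noteq> a" "c \<noteq> b" using ge(1) by blast+
  have inc: "a \<in> incident G x" "b \<in> incident G x" using abc(1) by auto
  have "contrib G f x c + contrib G f x a + contrib G f x b \<le> 4"
    using sum_contrib[OF x(1)] abc ab(2) by (simp add: add.assoc)
  then have le: "contrib G f x a \<le> 1" "contrib G f x b \<le> 1" "contrib G f x c \<le> 2"
    using ge(2) contrib_ge(2)[OF inc(1)] contrib_ge(2)[OF inc(2)] by linarith+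
  have leaves: "light_leaf x a" "light_leaf x b"
    using light_leafI[OF acyc inc(1) le(1)] light_leafI[OF acyc inc(2) le(2)] .
  obtain y where y: "c \<in> edges G" "ends G c = {x, y}" by (rule incident_other_end[OF G(1) ge(1)])
  have xy: "x \<noteq> y" by (rule acyclic_ends_neq[OF G acyc y])
  from contrib_le_2[OF y xy le(3)] show ?thesis
  proof
    assume c2: "f c = 2 \<and> incident G y = {c}"
    show ?thesis
      by (rule fork_case[OF acyc, where u = "\<lambda>i. if i = 0 then x else y" and e = "\<lambda>_. c" and a = a and b = b and n = 0])
        (use abc ab(2) leaves y c2 in auto)
  next
    assume fc: "f c = 1"
    have na: "\<not> arm G f c y n" for n
    proof
      assume arm: "arm G f c y n"
      have "contrib G f x c = rho n"
        using edge_deriv_arm[OF G y xy arm] fc by (simp add: contrib_def)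
      then show False using rho_lt_2[of n] ge(2) by simp
    qed
    obtain n where ch: "chain G f fork_end c y n"
      using chain_to_fork_end[OF acyc y] fc na no_arm_at_degree_3[OF x(2)] by blast
    have n: "1 \<le> n" by (rule chain_pos[OF ch])
    obtain u e where ue: "e 0 = c" "u 0 = x"
      "\<And>i. i < n \<Longrightarrow> ends G (e i) = {u i, u (Suc i)}"
      "\<And>i. 0 < i \<Longrightarrow> i < n \<Longrightarrow> incident G (u i) = {e (i - 1), e i}"
      "\<And>i. 0 < i \<Longrightarrow> i < n \<Longrightarrow> e (i - 1) \<noteq> e i"
      "\<And>i. 0 < i \<Longrightarrow> i < n \<Longrightarrow> f (e i) = 1"
      "fork_end (e (n - 1)) (u n)"
      using chain_seq[OF ch y(2) xy] by metis
    have w: "f (e i) = 1" if "i < n" for i using ue(1) ue(6)[of i] fc that by (cases "i = 0") auto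
    from ue(7)[unfolded fork_end_def] show ?thesis
    proof (elim disjE exE conjE)
      fix p q
      assume pq: "incident G (u n) = {e (n - 1), p, q}" "e (n - 1) \<noteq> p" "e (n - 1) \<noteq> q" "p \<noteq> q"
        "light_leaf (u n) p" "light_leaf (u n) q"
      show ?thesis
        by (rule double_fork_case[OF acyc n, of u e a b p q]) (use abc ab(2) leaves ue(1-5) pq w in auto)
    next
      fix g z
      assume g: "incident G (u n) = {e (n - 1), g}" "e (n - 1) \<noteq> g" "f g = 2"
        "ends G g = {u n, z}" "incident G z = {g}"
      \<comment> \<open>The double edge beyond the stopping vertex is appended, since
        \<open>fork_case\<close> counts it as the last stem edge.\<close>
      let ?u = "u(Suc n := z)" and ?e = "e(n := g)"
      show ?thesis
      proof (rule fork_case[OF acyc, of ?u ?e a b n])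
        show "incident G (?u i) = {?e (i - 1), ?e i} \<and> ?e (i - 1) \<noteq> ?e i" if "0 < i" "i \<le> n" for i
          using that ue(4,5)[of i] g(1,2) by (cases "i = n") auto
        show "ends G (?e i) = {?u i, ?u (Suc i)}" if "i \<le> n" for i
          using that ue(3)[of i] g(4) by (cases "i = n") auto
      qed (use n abc ab(2) leaves ue(1,2) g w in auto)
    qed
  qed
qed

text \<open>Following any edge leads to a leaf; read from there, the whole graph is a single arm
  once the weights are ignored. The weights are then handled on the model path. A graph without
  edges is a single vertex and is treated apart.\<close>

lemma path_case:
  assumes acyc: "acyclic_graph G" and deg: "\<And>x. x \<in> verts G \<Longrightarrow> card (incident G x) \<le> 2"
  shows "generates_dynkin G f \<or> generates_extended_dynkin G f"
proof (cases "edges G = {}")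
  case True
  obtain x where x: "x \<in> verts G" using G(1) by (auto simp: finite_graph_def)
  have "cut_closed G {x}" using True by (simp add: cut_closed_def)
  then have "verts G = {x}" using connected_graphD[OF G(2), of "{x}" x] x by blast
  then have "is_iso (\<lambda>_. x) \<psi> (path_graph 1) G" for \<psi>
    using True by (simp add: is_iso_def bij_betw_def)
  then have "f_iso G f (path_graph 1) unit_weight"
    using finite_graph_path[of 1] by (rule f_iso_from) auto
  then show ?thesis unfolding generates_dynkin_def by blast
next
  case False
  then obtain \<alpha> where \<alpha>: "\<alpha> \<in> edges G" by blast
  obtain x y where "ends G \<alpha> = {x, y}" using ends_cases[OF G(1) \<alpha>] by metis
  from acyclic_unit_arm[OF G acyc deg \<alpha> this] obtain n where "arm G unit_weight \<alpha> y n" by blast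
  from arm_imp_leaf[OF this] obtain v e where v: "incident G v = {e}" by (elim exE)
  then have "e \<in> incident G v" by simp
  then obtain z where z: "e \<in> edges G" "ends G e = {v, z}" by (rule incident_other_end[OF G(1)])
  obtain m where arm: "arm G unit_weight e z m" using acyclic_unit_arm[OF G acyc deg z] by blast
  obtain \<phi> \<psi> where iso: "is_iso \<phi> \<psi> (path_graph (Suc m)) G"
    using pendant_arm_is_path[OF G acyc v z(2) arm] by blast
  have \<psi>: "\<psi> j \<in> edges G" if "j \<in> {1..<Suc m}" for j using iso that by (auto simp: is_iso_def bij_betw_def)
  have "f_iso G f (path_graph (Suc m)) (\<lambda>j. enat (wt (\<psi> j)))"
    by (rule f_iso_from[OF iso finite_graph_path]) (use \<psi> f_wt(1) in auto)
  then show ?thesis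
    by (rule path_generates[OF _ G]) (use \<psi> f_wt(2) rho_le_4 in auto)
qed

lemma generates: "generates_dynkin G f \<or> generates_extended_dynkin G f"
proof (cases "\<exists>e\<in>edges G. card (ends G e) \<noteq> 2")
  case True
  then obtain e where e: "e \<in> edges G" "card (ends G e) \<noteq> 2" by blast
  then have "card (ends G e) = 1" using G(1) by (auto simp: finite_graph_def)
  then obtain x where "ends G e = {x}" by (rule card_1_singletonE)
  then show ?thesis using loop_case e(1) by blast
next
  case False
  show ?thesis
  proof (cases "acyclic_graph G")
    case False
    then show ?thesis using cyclic_case \<open>\<not> (\<exists>e\<in>edges G. card (ends G e) \<noteq> 2)\<close>
      unfolding acyclic_graph_def by blast
  next
    case True
    show ?thesis
    proof (cases "\<exists>x\<in>verts G. 2 < card (incident G x)")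
      case True
      then obtain x where x: "x \<in> verts G" "2 < card (incident G x)" by blast
      then consider "card (incident G x) = 4" | "card (incident G x) = 3"
        using card_incident_le_4[OF x(1)] by linarith
      then show ?thesis
      proof cases
        case 1
        then show ?thesis using degree_4_case[OF \<open>acyclic_graph G\<close> x(1)] by blast
      next
        case 2
        show ?thesis
        proof (cases "\<exists>c\<in>incident G x. 2 \<le> contrib G f x c")
          case True
          then show ?thesis using branch_case[OF \<open>acyclic_graph G\<close> x(1) 2] by blast
        next
          case False
          then show ?thesis by (intro three_arms_case[OF \<open>acyclic_graph G\<close> x(1) 2]) force
        qed
      qed
    next
      case False
      then show ?thesis by (intro path_case[OF \<open>acyclic_graph G\<close>]) force
    qed
  qed
qed

end

section \<open>The two equivalences\<close>

theorem proposition3: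
  fixes G :: "('v, 'e) graph" and f :: "'e \<Rightarrow> enat"
  assumes "integral_f_graph G f" and "connected_graph G"
  shows "(generates_dynkin G f \<longleftrightarrow> (\<forall>x\<in>verts G. rho_degree G f x < 4)) \<and>
         (generates_extended_dynkin G f \<longleftrightarrow> Max (rho_degree G f ` verts G) = 4)"
proof -
  let ?D = "rho_degree G f ` verts G"
  have G: "finite_graph G" and f: "\<And>e. e \<in> edges G \<Longrightarrow> 1 \<le> f e"
    using assms(1) by (auto simp: integral_f_graph_def)
  have D: "finite ?D" "?D \<noteq> {}" using G by (auto simp: finite_graph_def)
  have gen: "generates_dynkin G f \<or> generates_extended_dynkin G f" if "\<forall>t\<in>?D. t \<le> 4"
  proof -
    interpret small_f_graph G f using G assms(2) f that by unfold_locales auto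
    show ?thesis by (rule generates)
  qed
  have dyn: "\<forall>t\<in>?D. t < 4" if "generates_dynkin G f"
    using generates_dynkin_imp_lt[OF that G assms(2)] by blast
  have ext: "4 \<in> ?D" "\<forall>t\<in>?D. t \<le> 4" if "generates_extended_dynkin G f"
    using generates_extended_dynkin_imp[OF that G assms(2)] by blast+
  have max: "Max ?D = 4 \<longleftrightarrow> 4 \<in> ?D \<and> (\<forall>t\<in>?D. t \<le> 4)"
    using Max_eq_iff[OF D] by blast
  \<comment> \<open>Degrees below 4 exclude the extended list, where 4 occurs; in the same way
    \<open>Max ?D = 4\<close> excludes the Dynkin list below. So the one classification
    \<open>gen\<close> yields both converses.\<close>
  have "generates_dynkin G f \<longleftrightarrow> (\<forall>t\<in>?D. t < 4)"
    using gen dyn ext(1) by (metis less_imp_le order_less_irrefl)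
  moreover have "generates_extended_dynkin G f \<longleftrightarrow> Max ?D = 4"
    unfolding max using gen dyn ext by (metis order_less_irrefl)
  ultimately show ?thesis by simp
qed

end
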